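(* Let $n\ge3$ and let $x\in\Omega^{\epsilon}(n,q)$ be semisimple. If $q$ is odd, or if $q$ is even and $x+\mathbf{1}_V$ is singular, then the conjugacy class of $x$ in $\Omega^{\epsilon}(n,q)$ coincides with the conjugacy class of $x$ in $\mathrm{SO}^{\epsilon}(n,q)$. If $q$ is even and $x+\mathbf{1}_V$ is non-singular, then the conjugacy class of $x$ in $\mathrm{SO}^{\epsilon}(n,q)$ splits into two distinct conjugacy classes in $\Omega^{\epsilon}(n,q)$, with representatives $x$ and $x^z$, where $z\in\mathrm{SO}^{\epsilon}(n,q)\setminus\Omega^{\epsilon}(n,q)$.
   Context: $q$ is a prime power, $V=\mathbb{F}_q^n$, $Q$ is a non-singular quadratic form on $V$ (i.e. its associated bilinear form $\beta(u,v)=Q(u+v)-Q(u)-Q(v)$ is non-degenerate; so $n$ is even if $q$ is even), $\mathrm{O}^{\epsilon}(n,q)$ is its isometry group ($\epsilon=\pm$ according to plus/minus type when $n$ is even, $\epsilon=\circ$ when $n$ is odd), and $\mathrm{SO}^{\epsilon}(n,q)$ is the subgroup of elements of determinant $1$ (so $\mathrm{SO}^\epsilon=\mathrm{O}^\epsilon$ if $q$ is even). For $x\in\mathrm{O}^{\epsilon}(n,q)$ put $V_x=\mathrm{im}(\mathbf{1}_V-x)$. The spinor norm $\theta(x)\in\mathbb{F}_2$ is: if $q$ is even, $\theta(x)=\dim V_x \bmod 2$; if $q$ is odd, $\theta(x)=0$ if and only if the discriminant of the (non-degenerate bilinear) Wall form $\chi_x(u,v):=\beta(w,v)$ on $V_x$,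 where $w\in V$ satisfies $u=w-wx$, is a square in $\mathbb{F}_q^*$ (and $\theta(x)=1$ otherwise). $\Omega^{\epsilon}(n,q)$ is the kernel of $\theta$ on $\mathrm{SO}^{\epsilon}(n,q)$. Semisimple means of order coprime to the characteristic; $x^z=z^{-1}xz$. *)

theory Defs
  imports
    "HOL-Analysis.Determinants"
    "HOL-Algebra.Multiplicative_Group"
    "HOL-Library.Z2"
begin

text \<open>
  Linear maps of the row space \<open>'a^'n\<close> are represented by matrices acting on the right,
  \<open>w \<mapsto> w v* x\<close>, so that \<open>x ** y\<close> means ``first \<open>x\<close>, then \<open>y\<close>''.
\<close>

definition GL :: "('a::field^'n^'n) monoid" where
  "GL = \<lparr>carrier = {x. invertible x}, monoid.mult = (**), one = mat 1\<rparr>"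

lemma group_GL: "group (GL :: ('a::field^'n^'n) monoid)"
proof (rule groupI)
  fix x :: "'a^'n^'n" assume "x \<in> carrier GL"
  then obtain y where y: "x ** y = mat 1" "y ** x = mat 1"
    by (auto simp: GL_def invertible_def)
  then have "y \<in> carrier GL" by (auto simp: GL_def invertible_def)
  with y show "\<exists>y\<in>carrier GL. y \<otimes>\<^bsub>GL\<^esub> x = \<one>\<^bsub>GL\<^esub>"
    by (auto simp: GL_def)
qed (auto simp: GL_def invertible_mult matrix_mul_assoc[symmetric], simp add: invertible_def)

definition polar :: "('a::field^'n \<Rightarrow> 'a) \<Rightarrow> 'a^'n \<Rightarrow> 'a^'n \<Rightarrow> 'a" where
  "polar Q u v = Q (u + v) - Q u - Q v"

definition quadratic_form :: "('a::field^'n \<Rightarrow> 'a) \<Rightarrow> bool" where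
  "quadratic_form Q \<longleftrightarrow>
     (\<forall>c v. Q (c *s v) = c\<^sup>2 * Q v) \<and>
     (\<forall>u. Vector_Spaces.linear (*s) (*) (\<lambda>v. polar Q u v)) \<and>
     (\<forall>v. Vector_Spaces.linear (*s) (*) (\<lambda>u. polar Q u v))"

definition nonsingular_quadratic_form :: "('a::field^'n \<Rightarrow> 'a) \<Rightarrow> bool" where
  "nonsingular_quadratic_form Q \<longleftrightarrow>
     quadratic_form Q \<and> (\<forall>u. (\<forall>v. polar Q u v = 0) \<longrightarrow> u = 0)"

definition orthogonal_group :: "('a::field^'n \<Rightarrow> 'a) \<Rightarrow> ('a^'n^'n) set" where
  "orthogonal_group Q = {x \<in> carrier GL. \<forall>v. Q (v v* x) = Q v}"

definition special_orthogonal_group :: "('a::field^'n \<Rightarrow> 'a) \<Rightarrow> ('a^'n^'n) set" where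
  "special_orthogonal_group Q = {x \<in> orthogonal_group Q. det x = 1}"

definition moved_space :: "'a::field^'n^'n \<Rightarrow> ('a^'n) set" where
  "moved_space x = range (\<lambda>w. w - w v* x)"

text \<open>
  For an isometry \<open>x\<close> and \<open>v \<in> moved_space x\<close>, the value does not depend on the choice of \<open>w\<close>,
  because \<open>moved_space x\<close> is orthogonal to the fixed vectors of \<open>x\<close>.
\<close>

definition wall_form :: "('a::field^'n \<Rightarrow> 'a) \<Rightarrow> 'a^'n^'n \<Rightarrow> 'a^'n \<Rightarrow> 'a^'n \<Rightarrow> 'a" where
  "wall_form Q x u v = polar Q (SOME w. u = w - w v* x) v"

text \<open>
  The determinant of the matrix \<open>(f b c)\<close> whose rows and columns are indexed by the finite
  set \<open>B\<close>.  This is the formula of \<open>det\<close>, with a set in place of a type as index range, since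
  the dimension of \<open>moved_space x\<close> varies with \<open>x\<close>.
\<close>

definition gram_det :: "('b \<Rightarrow> 'b \<Rightarrow> 'a::comm_ring_1) \<Rightarrow> 'b set \<Rightarrow> 'a" where
  "gram_det f B = (\<Sum>p | p permutes B. of_int (sign p) * (\<Prod>b\<in>B. f b (p b)))"

definition basis_of :: "('a::field^'n) set \<Rightarrow> ('a^'n) set \<Rightarrow> bool" where
  "basis_of B W \<longleftrightarrow> vec.independent B \<and> vec.span B = W"

text \<open>
  The discriminant is only defined up to nonzero squares: changing the basis multiplies the
  Gram determinant by the square of the determinant of the base change.  So it does not matter
  which basis is used here.
\<close>

definition square_discriminant ::
    "('a::field^'n) set \<Rightarrow> ('a^'n \<Rightarrow> 'a^'n \<Rightarrow> 'a) \<Rightarrow> bool" where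
  "square_discriminant W f \<longleftrightarrow>
     (\<exists>B. basis_of B W \<and> (\<exists>c. c \<noteq> 0 \<and> gram_det f B = c\<^sup>2))"

definition spinor_norm :: "('a::{field,finite}^'n \<Rightarrow> 'a) \<Rightarrow> 'a^'n^'n \<Rightarrow> bit" where
  "spinor_norm Q x =
     (if even CARD('a) then of_nat (vec.dim (moved_space x))
      else if square_discriminant (moved_space x) (wall_form Q x) then 0 else 1)"

definition Omega_group :: "('a::{field,finite}^'n \<Rightarrow> 'a) \<Rightarrow> ('a^'n^'n) set" where
  "Omega_group Q = {x \<in> special_orthogonal_group Q. spinor_norm Q x = 0}"

definition semisimple :: "'a::{field,finite}^'n^'n \<Rightarrow> bool" where
  "semisimple x \<longleftrightarrow> coprime (group.ord GL x) CHAR('a)"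

definition conj_by :: "'a::field^'n^'n \<Rightarrow> 'a^'n^'n \<Rightarrow> 'a^'n^'n" where
  "conj_by x z = inv\<^bsub>GL\<^esub> z \<otimes>\<^bsub>GL\<^esub> x \<otimes>\<^bsub>GL\<^esub> z"

definition conj_class :: "('a::field^'n^'n) set \<Rightarrow> 'a^'n^'n \<Rightarrow> ('a^'n^'n) set" where
  "conj_class H x = {conj_by x g | g. g \<in> H}"

end

theory Submission
  imports Defs "HOL-Computational_Algebra.Polynomial" "HOL-Number_Theory.Residues"
begin

text \<open>
  Write \<open>V\<^sub>g\<close> for the moved space of an isometry \<open>g\<close>.  The subgroup \<open>\<Omega>\<close> has index at most 2 in
  \<open>SO\<close>, so the classes of \<open>x\<close> in both groups agree if and only if the centralizer of \<open>x\<close> in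
  \<open>SO\<close> is not contained in \<open>\<Omega>\<close>.

  Even \<open>q\<close>: the parity of \<open>dim V\<^sub>g\<close> is a homomorphism, because the difference of the Wall forms
  of \<open>g\<close> and \<open>h\<close> is alternating on \<open>V\<^sub>g \<inter> V\<^sub>h\<close> and hence has even rank.  If \<open>x\<close> has a nonzero
  fixed vector, then it has a nonsingular one and the reflection in it commutes with \<open>x\<close>.  If \<open>x\<close>
  has no nonzero fixed vector and \<open>g\<close> commutes with \<open>x\<close>, an odd power of \<open>g\<close> has 2-power order, so
  let \<open>g\<close> have 2-power order; then \<open>a = x + g\<^sup>-\<^sup>1 x\<^sup>-\<^sup>1\<close> is invertible and
  \<open>(1 + g) a = (x + x\<^sup>-\<^sup>1) + (g x + (g x)\<^sup>-\<^sup>1)\<close> defines an alternating form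
  \<open>\<beta> (u, v (1 + g) a)\<close> with radical \<open>ker (1 + g)\<close>, so \<open>dim V\<^sub>g\<close> is even.

  Odd \<open>q\<close>: by the Cartan-Dieudonne theorem the discriminant of the Wall form is multiplicative.  If
  \<open>b\<close> commutes with \<open>x\<close> and with its adjoint \<open>b'\<close>, then \<open>b b'\<^sup>-\<^sup>1\<close> has spinor norm \<open>det b\<close>
  modulo squares, so one needs such a \<open>b\<close> with nonsquare determinant on a nondegenerate invariant
  subspace.  It is found in a plane on which \<open>x\<close> is scalar if \<open>x\<^sup>2 = 1\<close>, and otherwise in the
  algebra generated by \<open>x\<close> on an irreducible subspace \<open>U\<close>: if all determinants of this field were
  squares, then summing \<open>det\<^bsup>(q-1)/2\<^esup>\<close> over it would give \<open>- 1\<close>, but the sum vanishes since the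
  degree is too small.
\<close>

section \<open>Determinants over finite index sets\<close>

text \<open>In odd characteristic the obstacle is \<open>b = b'\<close>, where
  \<open>b b'\<^sup>-\<^sup>1\<close> is trivial and its moved space collapses. Put
  \<open>s = x - x\<^sup>-\<^sup>1\<close>, which is skew and is injective on any subspace where
  \<open>x\<^sup>2\<close> has no nonzero fixed vector. If \<open>b\<close> were self-adjoint on a
  nondegenerate irreducible \<open>U\<close>, then \<open>\<beta> (u s, v)\<close> and
  \<open>\<beta> (u s b, v)\<close> would both be nondegenerate and alternating. Such forms have
  square discriminants, so \<open>det b\<close> would be a square. This is why
  \<open>x\<^sup>2 = 1\<close>, where \<open>s = 0\<close>, is a case of its own. A totally
  isotropic \<open>U\<close> is paired with a second subspace \<open>U'\<close> on which
  \<open>b\<close> is set to 1, which leaves the determinant unchanged. For even \<open>q\<close>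
  the invertibility of \<open>a\<close> comes from iteration: \<open>w a = 0\<close> makes
  \<open>w\<close> fixed by \<open>x\<^sup>2 g\<close>, hence by the power of \<open>x\<close> with
  exponent \<open>2 ^ (k + 1)\<close> if \<open>g\<close> has order dividing \<open>2 ^ k\<close>.
  In characteristic 2 such a power has a nonzero fixed vector only if \<open>x\<close> has
  one.\<close>

lemma gram_det_cong:
  assumes "\<And>i j. i \<in> B \<Longrightarrow> j \<in> B \<Longrightarrow> f i j = g i j"
  shows "gram_det f B = gram_det g B"
  unfolding gram_det_def
  by (intro sum.cong refl arg_cong2[where f="(*)"] prod.cong)
    (auto simp: assms permutes_in_image)

lemma gram_det_reindex:
  assumes "inj_on h B" "finite B"
  shows "gram_det f (h ` B) = gram_det (\<lambda>i j. f (h i) (h j)) B"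
proof -
  have bij: "bij_betw h B (h ` B)" using assms(1) by (simp add: bij_betw_def)
  let ?m = "\<lambda>p x. if x \<in> h ` B then h (p (inv_into B h x)) else x"
  have eq: "?m p = map_permutation B h p" for p
    by (auto simp: map_permutation_def restrict_id_def fun_eq_iff)
  have "gram_det f (h ` B) =
      (\<Sum>p | p permutes B. of_int (sign (?m p)) * (\<Prod>b\<in>h ` B. f b (?m p b)))"
    unfolding gram_det_def
    by (rule sum.reindex_bij_betw[OF bij_betw_permutations[OF bij], symmetric])
  also have "\<dots> = gram_det (\<lambda>i j. f (h i) (h j)) B"
    unfolding gram_det_def
  proof (intro sum.cong refl arg_cong2[where f="(*)"])
    fix p assume "p \<in> {p. p permutes B}"
    then have p: "p permutes B" by simp
    show "of_int (sign (?m p)) = of_int (sign p)"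
      unfolding eq using sign_map_permutation[OF assms(1) p assms(2)] by simp
    show "(\<Prod>b\<in>h ` B. f b (?m p b)) = (\<Prod>b\<in>B. f (h b) (h (p b)))"
      using assms(1) by (simp add: prod.reindex)
  qed
  finally show ?thesis .
qed

lemma gram_det_transpose:
  assumes "finite B"
  shows "gram_det (\<lambda>i j. f j i) B = gram_det f B"
proof -
  have "gram_det f B = (\<Sum>p | p permutes B. of_int (sign (inv_into UNIV p)) * (\<Prod>b\<in>B. f b (inv_into UNIV p b)))"
    unfolding gram_det_def by (rule sum_permutations_inverse)
  also have "\<dots> = gram_det (\<lambda>i j. f j i) B"
    unfolding gram_det_def
  proof (intro sum.cong refl arg_cong2[where f="(*)"])
    fix p assume "p \<in> {p. p permutes B}"
    then have p: "p permutes B" by simp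
    then have "permutation p" using assms permutation_permutes by blast
    then show "of_int (sign (inv_into UNIV p)) = of_int (sign p)" by (simp add: sign_inverse)
    show "(\<Prod>b\<in>B. f b (inv_into UNIV p b)) = (\<Prod>b\<in>B. f (p b) b)"
      by (subst prod.reindex_bij_betw[OF permutes_imp_bij[OF p], symmetric])
        (simp add: permutes_inverses[OF p])
  qed
  finally show ?thesis ..
qed

text \<open>Only permutations fixing \<open>x\<close> contribute: any other one sends some
  \<open>b\<close> in \<open>B\<close> to \<open>x\<close> and picks up the factor
  \<open>f b x = 0\<close>.\<close>

lemma gram_det_insert:
  assumes "finite B" "x \<notin> B" and zero: "\<And>b. b \<in> B \<Longrightarrow> f b x = 0"
  shows "gram_det f (insert x B) = f x x * gram_det f B"
proof -
  let ?t = "\<lambda>p. of_int (sign p) * (\<Prod>b\<in>insert x B. f b (p b))"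
  have "gram_det f (insert x B) = (\<Sum>p | p permutes B. ?t p)"
    unfolding gram_det_def
  proof (rule sum.mono_neutral_right)
    show "finite {p. p permutes insert x B}" using assms(1) by (intro finite_permutations) auto
    show "{p. p permutes B} \<subseteq> {p. p permutes insert x B}"
      by (auto intro: permutes_subset)
    show "\<forall>p\<in>{p. p permutes insert x B} - {p. p permutes B}. ?t p = 0"
    proof
      fix p assume "p \<in> {p. p permutes insert x B} - {p. p permutes B}"
      then have p: "p permutes insert x B" and np: "\<not> p permutes B" by auto
      obtain b where b: "b \<in> insert x B" "p b = x"
        using permutes_image[OF p] by (metis imageE insertI1)
      have "b \<noteq> x"
      proof
        assume "b = x"
        with b have "p x = x" by simp
        then have "p permutes B"
          by (intro permutes_superset[OF p]) auto
        with np show False by simp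
      qed
      with b have "b \<in> B" by simp
      then have "f b (p b) = 0" using b zero by simp
      with b assms(1) have "(\<Prod>b\<in>insert x B. f b (p b)) = 0"
        by (intro prod_zero) auto
      then show "?t p = 0" by simp
    qed
  qed
  also have "\<dots> = (\<Sum>p | p permutes B. f x x * (of_int (sign p) * (\<Prod>b\<in>B. f b (p b))))"
    using assms by (intro sum.cong refl) (auto simp: permutes_not_in)
  finally show ?thesis by (simp add: gram_det_def sum_distrib_left)
qed

lemma gram_det_insert_row:
  assumes "finite B" "x \<notin> B" and zero: "\<And>b. b \<in> B \<Longrightarrow> f x b = 0"
  shows "gram_det f (insert x B) = f x x * gram_det f B"
  using gram_det_insert[of B x "\<lambda>i j. f j i"] assms gram_det_transpose[of "insert x B" f]
    gram_det_transpose[of B f] by simp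

lemma gram_det_empty [simp]: "gram_det f {} = 1"
  by (simp add: gram_det_def)

lemma gram_det_Un_identity:
  assumes "finite C" "finite B" "B \<inter> C = {}"
    and "\<And>i j. i \<in> C \<Longrightarrow> j \<in> B \<union> C \<Longrightarrow> f i j = (if i = j then 1 else 0)"
  shows "gram_det f (B \<union> C) = gram_det f B"
  using assms
proof (induction C rule: finite_induct)
  case (insert x C)
  have "gram_det f (insert x (B \<union> C)) = f x x * gram_det f (B \<union> C)"
    using insert.hyps insert.prems by (intro gram_det_insert_row) auto
  with insert show ?case by simp
qed auto

text \<open>Filling up with an identity block gives a square matrix over the whole index type, to
  which the library determinant and its multiplicativity apply.\<close>

definition padded :: "('b \<Rightarrow> 'b \<Rightarrow> 'a::comm_ring_1) \<Rightarrow> 'b set \<Rightarrow> 'a^'b^'b" where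
  "padded f B = (\<chi> i j. if i \<in> B \<and> j \<in> B then f i j else if i = j then 1 else 0)"

lemma gram_det_eq_det: "gram_det f B = det (padded f B)" for B :: "'b::finite set"
proof -
  have "det (padded f B) = gram_det (\<lambda>i j. padded f B $ i $ j) UNIV"
    by (simp add: det_def gram_det_def)
  also have "\<dots> = gram_det (\<lambda>i j. padded f B $ i $ j) B"
    using gram_det_Un_identity[of "- B" B "\<lambda>i j. padded f B $ i $ j"]
    by (auto simp: padded_def Compl_partition)
  also have "\<dots> = gram_det f B"
    by (rule gram_det_cong) (simp add: padded_def)
  finally show ?thesis ..
qed

lemma padded_mult:
  fixes B :: "'b::finite set"
  shows "padded f B ** padded g B = padded (\<lambda>i j. \<Sum>k\<in>B. f i k * g k j) B"
proof -
  have "(\<Sum>k\<in>UNIV. padded f B $ i $ k * padded g B $ k $ j) =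
        padded (\<lambda>i j. \<Sum>k\<in>B. f i k * g k j) B $ i $ j" for i j
  proof (cases "i \<in> B")
    case True
    have "(\<Sum>k\<in>UNIV. padded f B $ i $ k * padded g B $ k $ j) =
          (\<Sum>k\<in>B. padded f B $ i $ k * padded g B $ k $ j)"
      using True by (intro sum.mono_neutral_right) (auto simp: padded_def)
    also have "\<dots> = (\<Sum>k\<in>B. if j \<in> B then f i k * g k j else 0)"
      using True by (intro sum.cong) (auto simp: padded_def)
    finally show ?thesis using True by (auto simp: padded_def)
  next
    case False
    have "(\<Sum>k\<in>UNIV. padded f B $ i $ k * padded g B $ k $ j) =
          (\<Sum>k\<in>UNIV. if k = i then padded g B $ k $ j else 0)"
      using False by (intro sum.cong) (auto simp: padded_def)
    then show ?thesis using False by (auto simp: padded_def)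
  qed
  then show ?thesis by (simp add: matrix_matrix_mult_def vec_eq_iff)
qed

lemma gram_det_mult:
  fixes B :: "'b::finite set"
  shows "gram_det (\<lambda>i j. \<Sum>k\<in>B. f i k * g k j) B = gram_det f B * gram_det g B"
  by (simp add: gram_det_eq_det padded_mult[symmetric] det_mul)

lemma gram_det_swap_rows:
  fixes B :: "'b::finite set"
  assumes "a \<in> B" "b \<in> B" "a \<noteq> b"
  shows "gram_det (\<lambda>i. f (Transposition.transpose a b i)) B = - gram_det f B"
proof -
  let ?t = "Transposition.transpose a b"
  have "padded (\<lambda>i. f (?t i)) B = (\<chi> i. padded f B $ ?t i)"
    using assms by (auto simp: padded_def vec_eq_iff Transposition.transpose_def)
  moreover have "det (\<chi> i. padded f B $ ?t i) = of_int (sign ?t) * det (padded f B)"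
    by (intro det_permute_rows permutes_swap_id) auto
  ultimately show ?thesis
    using assms by (simp add: gram_det_eq_det sign_swap_id)
qed

text \<open>Interchanging the rows \<open>e\<close> and \<open>f\<close> turns the hyperbolic block
  into a diagonal one with entries \<open>- 1\<close> and \<open>1\<close>; the sign of the swap
  cancels the \<open>- 1\<close>.\<close>

lemma gram_det_hyperbolic:
  fixes B :: "'b::finite set"
  assumes "e \<notin> B" "f \<notin> B" "e \<noteq> f"
    and "A e e = 0" "A f f = 0" "A e f = 1" "A f e = - 1"
    and "\<And>b. b \<in> B \<Longrightarrow> A e b = 0" "\<And>b. b \<in> B \<Longrightarrow> A f b = 0"
  shows "gram_det A (insert e (insert f B)) = gram_det A B"
proof -
  let ?A = "\<lambda>i. A (Transposition.transpose e f i)"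
  have "- gram_det A (insert e (insert f B)) = gram_det ?A (insert e (insert f B))"
    using assms by (subst gram_det_swap_rows) auto
  also have "\<dots> = ?A e e * gram_det ?A (insert f B)"
    using assms by (intro gram_det_insert_row) auto
  also have "gram_det ?A (insert f B) = ?A f f * gram_det ?A B"
    using assms by (intro gram_det_insert_row) auto
  also have "gram_det ?A B = gram_det A B"
    using assms by (intro gram_det_cong) (auto simp: Transposition.transpose_def)
  finally show ?thesis using assms by simp
qed

section \<open>Bilinear forms on subspaces\<close>

text \<open>Relative to a subspace, because \<open>wall_form\<close> is computed from a choice and
  is well behaved only on the moved space.\<close>

definition bilinear_on :: "('a::field^'n) set \<Rightarrow> ('a^'n \<Rightarrow> 'a^'n \<Rightarrow> 'a) \<Rightarrow> bool" where
  "bilinear_on W f \<longleftrightarrow>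
     (\<forall>u\<in>W. \<forall>v\<in>W. \<forall>w\<in>W. f (u + v) w = f u w + f v w \<and> f w (u + v) = f w u + f w v) \<and>
     (\<forall>c. \<forall>u\<in>W. \<forall>v\<in>W. f (c *s u) v = c * f u v \<and> f u (c *s v) = c * f u v)"

lemma bilinear_onD:
  assumes "bilinear_on W f" "u \<in> W" "v \<in> W"
  shows "w \<in> W \<Longrightarrow> f (u + v) w = f u w + f v w" "w \<in> W \<Longrightarrow> f w (u + v) = f w u + f w v"
    "f (c *s u) v = c * f u v" "f u (c *s v) = c * f u v"
  using assms unfolding bilinear_on_def by blast+

lemma bilinear_on_subset: "bilinear_on W f \<Longrightarrow> U \<subseteq> W \<Longrightarrow> bilinear_on U f"
  unfolding bilinear_on_def by blast

lemma bilinear_on_0: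
  assumes "bilinear_on W f" "v \<in> W"
  shows "f 0 v = 0" "f v 0 = 0"
  using bilinear_onD(3)[OF assms assms(2), of 0] bilinear_onD(4)[OF assms assms(2), of 0] by simp_all

lemma bilinear_on_sum:
  assumes f: "bilinear_on W f" and W: "vec.subspace W"
    and g: "\<And>b. b \<in> B \<Longrightarrow> g b \<in> W" and w: "w \<in> W" and B: "finite B"
  shows "f (\<Sum>b\<in>B. c b *s g b) w = (\<Sum>b\<in>B. c b * f (g b) w)"
    and "f w (\<Sum>b\<in>B. c b *s g b) = (\<Sum>b\<in>B. c b * f w (g b))"
proof -
  have *: "(\<Sum>b\<in>B'. c b *s g b) \<in> W" if "B' \<subseteq> B" for B'
    using that g W by (intro vec.subspace_sum vec.subspace_scale) auto
  have "f (\<Sum>b\<in>B. c b *s g b) w = (\<Sum>b\<in>B. c b * f (g b) w) \<and>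
        f w (\<Sum>b\<in>B. c b *s g b) = (\<Sum>b\<in>B. c b * f w (g b))"
    using B g *
  proof (induction B rule: finite_induct)
    case empty
    then show ?case using bilinear_on_0[OF f w] by simp
  next
    case (insert x F)
    have 1: "c x *s g x \<in> W" "g x \<in> W" using insert.prems W by (auto intro: vec.subspace_scale)
    have 2: "(\<Sum>b\<in>F. c b *s g b) \<in> W" using insert.prems(2)[of F] by blast
    have IH: "f (\<Sum>b\<in>F. c b *s g b) w = (\<Sum>b\<in>F. c b * f (g b) w)"
        "f w (\<Sum>b\<in>F. c b *s g b) = (\<Sum>b\<in>F. c b * f w (g b))"
      using insert.IH insert.prems by (auto simp: subset_iff)
    show ?case
      using insert.hyps bilinear_onD[OF f 1(1) 2] bilinear_onD[OF f 1(2) w] bilinear_onD[OF f w 1(2)] w IH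
      by simp
  qed
  then show "f (\<Sum>b\<in>B. c b *s g b) w = (\<Sum>b\<in>B. c b * f (g b) w)"
    "f w (\<Sum>b\<in>B. c b *s g b) = (\<Sum>b\<in>B. c b * f w (g b))" by auto
qed

section \<open>Bases, coordinates and change of basis\<close>

lemma basis_of_facts:
  assumes "basis_of B W"
  shows "finite B" "B \<subseteq> W" "vec.subspace W" "card B = vec.dim W" "vec.independent B" "vec.span B = W"
  using assms unfolding basis_of_def
  by (auto simp: vec.finiteI_independent vec.span_base vec.dim_eq_card_independent)

lemma basis_of_exists:
  assumes "vec.subspace W"
  shows "\<exists>B. basis_of B W"
proof -
  obtain B where "B \<subseteq> W" "vec.independent B" "W \<subseteq> vec.span B" "card B = vec.dim W"
    by (rule vec.basis_exists)
  then show ?thesis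
    unfolding basis_of_def using assms by (metis vec.span_minimal subset_antisym)
qed

lemma basis_of_expansion:
  assumes "basis_of B W" "v \<in> W"
  shows "\<exists>c. v = (\<Sum>b\<in>B. c b *s b)"
proof -
  have "v \<in> range (\<lambda>u. \<Sum>b\<in>B. u b *s b)"
    using vec.span_finite[of B] basis_of_facts[OF assms(1)] assms(2) by simp
  then show ?thesis by blast
qed

lemma basis_matrix:
  assumes "basis_of B W" "\<And>e. e \<in> A \<Longrightarrow> g e \<in> W"
  shows "\<exists>M. \<forall>e\<in>A. g e = (\<Sum>b\<in>B. M e b *s b)"
proof -
  have "\<forall>e. \<exists>c. e \<in> A \<longrightarrow> g e = (\<Sum>b\<in>B. c b *s b)"
    using basis_of_expansion[OF assms(1)] assms(2) by blast
  then show ?thesis by metis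
qed

lemma basis_coeffs_unique:
  assumes "basis_of B W" "(\<Sum>b\<in>B. c b *s b) = (\<Sum>b\<in>B. d b *s b)" "b \<in> B"
  shows "c b = d b"
proof -
  have "(\<Sum>b\<in>B. (c b - d b) *s b) = 0"
    using assms(2) by (simp add: vector_sub_rdistrib sum_subtractf)
  then have "c b - d b = 0"
    using iffD1[OF vec.independent_explicit basis_of_facts(5)[OF assms(1)], THEN conjunct2,
        THEN spec[where x="\<lambda>b. c b - d b"]] assms(3) by blast
  then show ?thesis by simp
qed

text \<open>Comparing coefficients in the basis turns the assumption into the matrix identity
  \<open>R M = 1\<close>.\<close>

lemma gram_det_left_inverse:
  fixes B :: "('a::{field,finite}^'n) set"
  assumes B: "basis_of B W"
    and R: "\<And>e. e \<in> B \<Longrightarrow> e = (\<Sum>k\<in>B. R e k *s (\<Sum>b\<in>B. M k b *s b))"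
  shows "gram_det R B * gram_det M B = 1"
proof -
  note fin = basis_of_facts(1)[OF B]
  have "(\<Sum>k\<in>B. R e k * M k e') = (if e = e' then 1 else 0)" if "e \<in> B" "e' \<in> B" for e e'
  proof -
    have "(\<Sum>e'\<in>B. (\<Sum>k\<in>B. R e k * M k e') *s e') = (\<Sum>e'\<in>B. \<Sum>k\<in>B. R e k *s (M k e' *s e'))"
      by (simp add: vec.scale_sum_left vec.scale_scale)
    also have "\<dots> = (\<Sum>k\<in>B. R e k *s (\<Sum>e'\<in>B. M k e' *s e'))"
      by (subst sum.swap) (simp add: vec.scale_sum_right vec.scale_scale)
    also have "\<dots> = e" by (rule R[OF that(1), symmetric])
    also have "e = (\<Sum>e'\<in>B. (if e = e' then 1 else 0) *s e')"
      using that(1) fin by (simp add: if_distrib[of "\<lambda>c. c *s _"] cong: if_cong)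
    finally show ?thesis by (rule basis_coeffs_unique[OF B _ that(2)])
  qed
  then have "gram_det (\<lambda>e e'. \<Sum>k\<in>B. R e k * M k e') B = gram_det (\<lambda>e e'. if e = e' then 1 else 0) B"
    by (intro gram_det_cong) auto
  also have "\<dots> = 1"
    using gram_det_Un_identity[OF fin, of "{}" "\<lambda>e e'. if e = e' then 1 else 0"] by simp
  finally show ?thesis by (simp add: gram_det_mult)
qed

text \<open>After transport along a bijection \<open>h\<close> between the bases, the two Gram
  matrices are congruent by the base change matrix \<open>P\<close>, whose determinant enters
  twice.\<close>

lemma gram_det_basis_change:
  fixes f :: "'a::{field,finite}^'n \<Rightarrow> 'a^'n \<Rightarrow> 'a"
  assumes B: "basis_of B W" and B': "basis_of B' W" and f: "bilinear_on W f"
  shows "\<exists>k. k \<noteq> 0 \<and> gram_det f B' = k\<^sup>2 * gram_det f B"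
proof -
  note b = basis_of_facts[OF B] and b' = basis_of_facts[OF B']
  obtain h where h: "bij_betw h B B'"
    using b(1,4) b'(1,4) finite_same_card_bij by metis
  have hW: "h e \<in> W" if "e \<in> B" for e
    using h that b'(2) by (auto simp: bij_betw_def)
  obtain P where P: "\<And>e. e \<in> B \<Longrightarrow> h e = (\<Sum>b\<in>B. P e b *s b)"
    using basis_matrix[OF B, of B h] hW by blast
  obtain R' where R': "\<And>e. e \<in> B \<Longrightarrow> e = (\<Sum>b\<in>B'. R' e b *s b)"
    using basis_matrix[OF B', of B "\<lambda>e. e"] b(2) by blast
  define R where "R e b = R' e (h b)" for e b
  have R: "e = (\<Sum>b\<in>B. R e b *s h b)" if "e \<in> B" for e
  proof -
    have "(\<Sum>b\<in>B. R e b *s h b) = (\<Sum>b\<in>B'. R' e b *s b)"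
      unfolding R_def by (rule sum.reindex_bij_betw[OF h])
    with R'[OF that] show ?thesis by (rule trans[OF _ sym])
  qed
  have "gram_det R B * gram_det P B = 1"
  proof (rule gram_det_left_inverse[OF B])
    fix e assume e: "e \<in> B"
    have "(\<Sum>k\<in>B. R e k *s (\<Sum>b\<in>B. P k b *s b)) = (\<Sum>k\<in>B. R e k *s h k)"
      using P by (intro sum.cong) auto
    then show "e = (\<Sum>k\<in>B. R e k *s (\<Sum>b\<in>B. P k b *s b))" using R[OF e] by (rule trans[OF _ sym, symmetric])
  qed
  then have RP: "gram_det P B \<noteq> 0" by auto
  have "gram_det f B' = gram_det (\<lambda>e e'. f (h e) (h e')) B"
    using gram_det_reindex[of h B f] h b(1) by (simp add: bij_betw_def)
  also have "\<dots> = gram_det (\<lambda>e e'. \<Sum>i\<in>B. P e i * (\<Sum>j\<in>B. f i j * P e' j)) B"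
  proof (rule gram_det_cong)
    fix e e' assume e: "e \<in> B" "e' \<in> B"
    have "f (h e) (h e') = (\<Sum>i\<in>B. P e i * f i (h e'))"
      using P[OF e(1)] bilinear_on_sum(1)[OF f b(3), of B "\<lambda>i. i" "h e'" "P e"] b hW e by auto
    also have "\<dots> = (\<Sum>i\<in>B. P e i * (\<Sum>j\<in>B. f i j * P e' j))"
    proof (intro sum.cong refl arg_cong2[where f="(*)"])
      fix i assume i: "i \<in> B"
      show "f i (h e') = (\<Sum>j\<in>B. f i j * P e' j)"
        using P[OF e(2)] bilinear_on_sum(2)[OF f b(3), of B "\<lambda>i. i" "i" "P e'"] b hW e i
        by (auto simp: mult.commute)
    qed
    finally show "f (h e) (h e') = (\<Sum>i\<in>B. P e i * (\<Sum>j\<in>B. f i j * P e' j))" .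
  qed
  also have "\<dots> = gram_det P B * (gram_det f B * gram_det (\<lambda>i j. P j i) B)"
    by (simp only: gram_det_mult)
  also have "\<dots> = (gram_det P B)\<^sup>2 * gram_det f B"
    using gram_det_transpose[OF b(1), of P] by (simp add: power2_eq_square)
  finally show ?thesis using RP by blast
qed

section \<open>Alternating forms\<close>

lemma alternating_on_skew:
  assumes f: "bilinear_on W f" and W: "vec.subspace W" and alt: "\<forall>u\<in>W. f u u = 0"
    and uv: "u \<in> W" "v \<in> W"
  shows "f u v = - f v u"
proof -
  have s: "u + v \<in> W" using W uv by (rule vec.subspace_add)
  have "f (u + v) (u + v) = 0" using alt s by blast
  then have "f u v + f v u = 0"
    using bilinear_onD(1)[OF f uv s] bilinear_onD(2)[OF f uv] uv alt by simp
  then show ?thesis by (simp add: eq_neg_iff_add_eq_0)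
qed

text \<open>Induction on the dimension: a hyperbolic pair \<open>e\<close>, \<open>d\<close> splits
  off, and its orthogonal \<open>W0\<close> is again nondegenerate because \<open>pr\<close>
  projects \<open>W\<close> to it. The part on determinants is the source of every square
  discriminant in the odd case.\<close>

lemma alternating_symplectic_basis:
  fixes f :: "'a::{field,finite}^'n \<Rightarrow> 'a^'n \<Rightarrow> 'a"
  assumes "bilinear_on W f" "vec.subspace W" "\<forall>u\<in>W. f u u = 0"
    and "\<forall>u\<in>W. (\<forall>v\<in>W. f u v = 0) \<longrightarrow> u = 0"
  shows "even (vec.dim W) \<and> (\<exists>B. basis_of B W \<and> gram_det f B = 1)"
  using assms
proof (induction "vec.dim W" arbitrary: W rule: less_induct)
  case less
  note f = less.prems(1) and W = less.prems(2) and alt = less.prems(3) and nd = less.prems(4)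
  note skew = alternating_on_skew[OF f W alt]
  show ?case
  proof (cases "W = {0}")
    case True
    have "basis_of {} W" using True by (simp add: basis_of_def vec.independent_empty)
    moreover have "gram_det f {} = 1" by simp
    ultimately show ?thesis using True by (metis basis_of_facts(4) card.empty even_zero)
  next
    case False
    then obtain e where e: "e \<in> W" "e \<noteq> 0" using vec.subspace_0[OF W] by auto
    then obtain f0 where f0: "f0 \<in> W" "f e f0 \<noteq> 0" using nd by blast
    define d where "d = inverse (f e f0) *s f0"
    have d: "d \<in> W" "f e d = 1"
      using f0 W bilinear_onD(4)[OF f e(1) f0(1)] by (auto simp: d_def vec.subspace_scale)
    have de: "f d e = - 1" using skew[OF d(1) e(1)] d(2) by simp
    define W0 where "W0 = {w \<in> W. f w e = 0 \<and> f w d = 0}"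
    have W0: "vec.subspace W0"
      unfolding W0_def
      by (rule vec.subspaceI)
        (auto simp: vec.subspace_0[OF W] vec.subspace_add[OF W] vec.subspace_scale[OF W]
          bilinear_on_0[OF f] bilinear_onD[OF f] e(1) d(1))
    have sub: "W0 \<subseteq> W" by (auto simp: W0_def)
    \<comment> \<open>The coefficients are forced by the two conditions
      \<open>f (pr v) e = 0\<close> and \<open>f (pr v) d = 0\<close>, given
      \<open>f e d = 1\<close> and \<open>f d e = - 1\<close>.\<close>
    define pr where "pr v = v - f v d *s e + f v e *s d" for v
    have pr: "pr v \<in> W0" if "v \<in> W" for v
    proof -
      have 1: "f v d *s e \<in> W" "f v e *s d \<in> W" "(- 1) *s (f v d *s e) \<in> W" "(- f v d) *s e \<in> W"
        using e d W by (auto simp: vec.subspace_scale vec.subspace_neg)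
      have eq: "pr v = v + ((- f v d) *s e + f v e *s d)"
        by (simp add: pr_def)
      have in1: "(- f v d) *s e + f v e *s d \<in> W" using 1 W vec.subspace_add by blast
      then have "pr v \<in> W" unfolding eq using that W vec.subspace_add by blast
      moreover have "f (pr v) w = f v w + (- f v d) * f e w + f v e * f d w" if "w \<in> W" for w
        unfolding eq using bilinear_onD(1)[OF f \<open>v \<in> W\<close> in1 that] bilinear_onD(1)[OF f 1(4) 1(2) that]
          bilinear_onD(3)[OF f e(1) that, of "- f v d"] bilinear_onD(3)[OF f d(1) that] by simp
      ultimately show ?thesis
        using e d de alt by (simp add: W0_def)
    qed
    have nd0: "\<forall>u\<in>W0. (\<forall>v\<in>W0. f u v = 0) \<longrightarrow> u = 0"
    proof (intro ballI impI)
      fix u assume u: "u \<in> W0" and z: "\<forall>v\<in>W0. f u v = 0"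
      have "u \<in> W" using u sub by blast
      have "\<forall>v\<in>W. f u v = 0"
      proof
        fix v assume v: "v \<in> W"
        have ue: "f u e = 0" "f u d = 0" using u by (auto simp: W0_def)
        have "f v d *s e + (- f v e) *s d \<in> W" "f v d *s e \<in> W" "(- f v e) *s d \<in> W"
          using W e d by (auto intro!: vec.subspace_add vec.subspace_diff vec.subspace_neg vec.subspace_scale)
        moreover have "v = pr v + (f v d *s e + (- f v e) *s d)" by (simp add: pr_def)
        moreover have "pr v \<in> W" using pr[OF v] sub by blast
        ultimately have "f u v = f u (pr v) + (f u (f v d *s e) + f u ((- f v e) *s d))"
          using bilinear_onD(2)[OF f] \<open>u \<in> W\<close> by metis
        then show "f u v = 0"
          using z pr[OF v] ue bilinear_onD(4)[OF f \<open>u \<in> W\<close> e(1)]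
            bilinear_onD(4)[OF f \<open>u \<in> W\<close> d(1), of "- f v e"]
          by simp
      qed
      with nd \<open>u \<in> W\<close> show "u = 0" by blast
    qed
    have "e \<notin> W0" using d by (auto simp: W0_def)
    then have "W0 \<subset> W" using sub e by blast
    then have "vec.dim W0 < vec.dim W"
      using vec.dim_psubset[of W0 W] vec.span_eq_iff W W0 by metis
    from less.hyps[OF this bilinear_on_subset[OF f sub] W0 _ nd0] alt sub
    obtain B0 where B0: "even (vec.dim W0)" "basis_of B0 W0" "gram_det f B0 = 1" by blast
    note b0 = basis_of_facts[OF B0(2)]
    have dn: "d \<notin> vec.span B0" using b0(6) de by (auto simp: W0_def)
    have en: "e \<notin> vec.span (insert d B0)"
    proof
      assume "e \<in> vec.span (insert d B0)"
      moreover have "vec.span (insert d B0) \<subseteq> {w \<in> W. f w d = 0}"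
        using b0(2) d alt
        by (intro vec.span_minimal vec.subspaceI)
          (auto simp: W0_def vec.subspace_0[OF W] vec.subspace_add[OF W] vec.subspace_scale[OF W]
            bilinear_on_0[OF f] bilinear_onD[OF f])
      ultimately show False using d(2) by auto
    qed
    let ?B = "insert e (insert d B0)"
    have ind: "vec.independent ?B"
      using b0(5) dn en vec.independent_insertI by blast
    have "vec.span ?B = W"
    proof
      show "vec.span ?B \<subseteq> W" using e d b0(2) sub W by (intro vec.span_minimal) auto
      show "W \<subseteq> vec.span ?B"
      proof
        fix v assume v: "v \<in> W"
        have "pr v \<in> vec.span ?B"
          using pr[OF v] b0(6) vec.span_mono[of B0 ?B] by auto
        moreover have "f v d *s e - f v e *s d \<in> vec.span ?B"
          by (intro vec.span_diff vec.span_scale vec.span_base) auto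
        moreover have "v = pr v + (f v d *s e - f v e *s d)" by (simp add: pr_def)
        ultimately show "v \<in> vec.span ?B" using vec.span_add by metis
      qed
    qed
    with ind have bas: "basis_of ?B W" by (simp add: basis_of_def)
    have notin: "e \<notin> B0" "d \<notin> B0" "e \<noteq> d"
      using dn en vec.span_base by blast+
    have "gram_det f ?B = gram_det f B0"
    proof (rule gram_det_hyperbolic[OF notin])
      fix b assume b: "b \<in> B0"
      then have "f b e = 0" "f b d = 0" "b \<in> W" using b0(2) by (auto simp: W0_def)
      then show "f e b = 0" "f d b = 0" using skew[OF e(1)] skew[OF d(1)] by simp_all
    qed (use alt e d de in auto)
    moreover have "vec.dim W = Suc (Suc (vec.dim W0))"
      using basis_of_facts(4)[OF bas] b0(1,4) notin by simp
    ultimately have "even (vec.dim W)" "gram_det f ?B = 1" using B0 by simp_all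
    with bas show ?thesis by blast
  qed
qed

lemma complement_exists:
  fixes R W :: "('a::field^'n) set"
  assumes R: "vec.subspace R" and W: "vec.subspace W" and sub: "R \<subseteq> W"
  shows "\<exists>U. vec.subspace U \<and> U \<subseteq> W \<and> R \<inter> U = {0} \<and>
             (\<forall>w\<in>W. \<exists>r\<in>R. \<exists>u\<in>U. w = r + u) \<and>
             vec.dim W = vec.dim R + vec.dim U"
proof -
  obtain B where B: "basis_of B R" using basis_of_exists[OF R] by blast
  note b = basis_of_facts[OF B]
  obtain C where C: "B \<subseteq> C" "C \<subseteq> W" "vec.independent C" "W \<subseteq> vec.span C"
    using vec.maximal_independent_subset_extend[of B W] b(2,5) sub by blast
  have sC: "vec.span C = W" using C vec.span_minimal[OF C(2) W] by blast
  let ?U = "vec.span (C - B)"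
  have fin: "finite C" using C(3) vec.finiteI_independent by blast
  have dU: "vec.dim ?U = card (C - B)"
    using C(3) vec.independent_mono[of C "C - B"] by (simp add: vec.dim_eq_card_independent)
  have dW: "vec.dim W = card C"
    using sC C(3) by (metis vec.dim_span_eq_card_independent)
  have sumd: "vec.dim W = vec.dim R + vec.dim ?U"
    using dU dW b(4) fin C(1) card_mono[OF fin C(1)] by (simp add: card_Diff_subset finite_subset)
  have Weq: "W = {r + u |r u. r \<in> R \<and> u \<in> ?U}"
  proof -
    have "C = B \<union> (C - B)" using C(1) by blast
    then have "W = {x + y |x y. x \<in> vec.span B \<and> y \<in> vec.span (C - B)}"
      using sC vec.span_Un[of B "C - B"] by simp
    then show ?thesis using b(6) by simp
  qed
  have "vec.dim (R \<inter> ?U) = 0"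
    using vec.dim_sums_Int[OF R vec.subspace_span[of "C - B"]] sumd Weq by simp
  then have "R \<inter> ?U \<subseteq> {0}" by simp
  then have "R \<inter> ?U = {0}" using vec.subspace_0[OF R] vec.span_zero by blast
  moreover have "?U \<subseteq> W" using C W by (intro vec.span_minimal) auto
  moreover have "\<forall>w\<in>W. \<exists>r\<in>R. \<exists>u\<in>?U. w = r + u" by (subst Weq) blast
  ultimately show ?thesis using sumd vec.subspace_span by blast
qed

text \<open>On a complement of the radical the form is nondegenerate, so that complement has even
  dimension. The sum in the statement has the parity of the rank and avoids subtraction of
  naturals.\<close>

lemma alternating_rank_even:
  fixes f :: "'a::{field,finite}^'n \<Rightarrow> 'a^'n \<Rightarrow> 'a"
  assumes f: "bilinear_on W f" and W: "vec.subspace W" and alt: "\<forall>u\<in>W. f u u = 0"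
  shows "even (vec.dim W + vec.dim {u \<in> W. \<forall>v\<in>W. f u v = 0})"
proof -
  let ?R = "{u \<in> W. \<forall>v\<in>W. f u v = 0}"
  note skew = alternating_on_skew[OF f W alt]
  have R: "vec.subspace ?R"
    by (rule vec.subspaceI)
      (auto simp: vec.subspace_0[OF W] vec.subspace_add[OF W] vec.subspace_scale[OF W]
          bilinear_on_0[OF f] bilinear_onD[OF f])
  obtain U where U: "vec.subspace U" "U \<subseteq> W" "?R \<inter> U = {0}" "\<forall>w\<in>W. \<exists>r\<in>?R. \<exists>u\<in>U. w = r + u"
      "vec.dim W = vec.dim ?R + vec.dim U"
    using complement_exists[OF R W] by blast
  have "even (vec.dim U)"
  proof (rule alternating_symplectic_basis[THEN conjunct1])
    show "bilinear_on U f" using f U(2) by (rule bilinear_on_subset)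
    show "\<forall>u\<in>U. (\<forall>v\<in>U. f u v = 0) \<longrightarrow> u = 0"
    proof (intro ballI impI)
      fix u assume u: "u \<in> U" "\<forall>v\<in>U. f u v = 0"
      have "f u w = 0" if w: "w \<in> W" for w
      proof -
        obtain r v where rv: "r \<in> ?R" "v \<in> U" "w = r + v"
          using bspec[OF U(4) w] by (elim bexE)
        have uW: "u \<in> W" "v \<in> W" using u rv U(2) by auto
        have "f u r = 0" using skew[of u r] rv(1) uW by auto
        then show ?thesis using bilinear_onD(2)[OF f, of r v u] rv u uW by auto
      qed
      then have "u \<in> ?R" using u U(2) by blast
      then show "u = 0" using u U(3) by blast
    qed
    show "\<forall>u\<in>U. f u u = 0" using alt U(2) by blast
  qed (rule U(1))
  then show ?thesis using U(5) by simp
qed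

lemma dim_image_plus_kernel:
  fixes f :: "'a::field^'n \<Rightarrow> 'a^'n"
  assumes f: "Vector_Spaces.linear (*s) (*s) f" and W: "vec.subspace W"
  shows "vec.dim W = vec.dim (f ` W) + vec.dim {w \<in> W. f w = 0}"
proof -
  interpret f: Vector_Spaces.linear "(*s)" "(*s)" f by fact
  let ?K = "{w \<in> W. f w = 0}"
  have K: "vec.subspace ?K"
    by (rule vec.subspaceI)
      (auto simp: vec.subspace_0[OF W] vec.subspace_add[OF W] vec.subspace_scale[OF W] f.add f.scale)
  obtain U where U: "vec.subspace U" "U \<subseteq> W" "?K \<inter> U = {0}" "\<forall>w\<in>W. \<exists>r\<in>?K. \<exists>u\<in>U. w = r + u"
      "vec.dim W = vec.dim ?K + vec.dim U"
    using complement_exists[OF K W] by blast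
  have "f ` W = f ` U"
  proof
    show "f ` U \<subseteq> f ` W" using U(2) by blast
    show "f ` W \<subseteq> f ` U"
    proof
      fix y assume "y \<in> f ` W"
      then obtain w where w: "w \<in> W" "y = f w" by blast
      obtain r u where "r \<in> ?K" "u \<in> U" "w = r + u"
        using bspec[OF U(4) w(1)] by (elim bexE)
      then have "r \<in> ?K" "u \<in> U" "y = f (r + u)" using w(2) by simp_all
      then show "y \<in> f ` U" by (simp add: f.add)
    qed
  qed
  moreover have "inj_on f (vec.span U)"
  proof (rule inj_onI)
    fix a b assume ab: "a \<in> vec.span U" "b \<in> vec.span U" "f a = f b"
    then have "a - b \<in> U" using U(1) by (metis vec.span_eq_iff vec.subspace_diff)
    then have "a - b \<in> ?K \<inter> U" using ab U(2) by (auto simp: f.diff)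
    then show "a = b" using U(3) by auto
  qed
  then have "vec.dim (f ` U) = vec.dim U" using f by (rule vec.dim_image_eq[rotated])
  ultimately show ?thesis using U(5) by simp
qed

section \<open>Isometries of a quadratic form and their Wall forms\<close>

lemma linear_vector_matrix [simp]: "Vector_Spaces.linear (*s) (*s) (\<lambda>v::'a::field^'n. v v* g)"
  by (metis (no_types, lifting) ext matrix_vector_mul_linear_gen transpose_matrix_vector)

interpretation vm: Vector_Spaces.linear "(*s)" "(*s)" "\<lambda>v::'a::field^'n. v v* (g::'a^'m^'n)"
proof -
  have "(\<lambda>v::'a::field^'n. v v* (g::'a^'m^'n)) = (*v) (Finite_Cartesian_Product.transpose g)"
    by (simp add: fun_eq_iff)
  then show "Vector_Spaces.linear (*s) (*s) (\<lambda>v::'a::field^'n. v v* (g::'a^'m^'n))" by simp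
qed

lemma linear_eq_vector_matrix:
  fixes f :: "'a::field^'n \<Rightarrow> 'a^'n"
  assumes "Vector_Spaces.linear (*s) (*s) f"
  shows "\<exists>A. \<forall>v. f v = v v* A"
  by (intro exI[of _ "Finite_Cartesian_Product.transpose (matrix f)"])
    (simp add: matrix_works[OF assms])

lemma vector_matrix_eq_iff: "A = B \<longleftrightarrow> (\<forall>v. v v* A = v v* (B::'a::field^'m^'n))"
proof
  assume *: "\<forall>v. v v* A = v v* B"
  then have "Finite_Cartesian_Product.transpose A *v v = Finite_Cartesian_Product.transpose B *v v" for v
    by simp
  then show "A = B" by (metis matrix_eq transpose_transpose)
qed simp

lemma invertible_iff_kernel: "invertible A \<longleftrightarrow> (\<forall>v. v v* A = 0 \<longrightarrow> v = 0)" for A :: "'a::field^'n^'n"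
proof
  assume "invertible A"
  then obtain B where B: "A ** B = mat 1" by (auto simp: invertible_def)
  show "\<forall>v. v v* A = 0 \<longrightarrow> v = 0"
  proof (intro allI impI)
    fix v assume "v v* A = 0"
    then have "v v* A v* B = 0" by simp
    then show "v = 0" by (simp add: vector_matrix_mul_assoc B)
  qed
next
  assume "\<forall>v. v v* A = 0 \<longrightarrow> v = 0"
  then have "inj ((*v) (Finite_Cartesian_Product.transpose A))" by (simp add: vec.inj_iff_eq_0)
  then obtain B where "B ** Finite_Cartesian_Product.transpose A = mat 1"
    using matrix_left_invertible_injective by blast
  then have "A ** Finite_Cartesian_Product.transpose B = mat 1"
    by (metis matrix_transpose_mul transpose_mat transpose_transpose)
  then show "invertible A" using invertible_right_inverse by blast
qed

lemma dim_kernel_functional: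
  fixes Y :: "('a::field^'n) set"
  assumes Y: "vec.subspace Y" and f: "\<And>u v. f (u + v) = f u + f v" "\<And>c v. f (c *s v) = c * f v"
  shows "vec.dim Y \<le> vec.dim {y \<in> Y. f y = (0::'a)} + 1"
proof (cases "\<forall>y\<in>Y. f y = 0")
  case True
  then have "{y \<in> Y. f y = 0} = Y" by blast
  then show ?thesis by simp
next
  case False
  then obtain y0 where y0: "y0 \<in> Y" "f y0 \<noteq> 0" by blast
  let ?K = "{y \<in> Y. f y = 0}"
  have "Y \<subseteq> vec.span (insert y0 ?K)"
  proof
    fix y assume y: "y \<in> Y"
    let ?c = "f y / f y0"
    have eq: "y = ?c *s y0 + (y + (- ?c) *s y0)" by simp
    have "f (y + (- ?c) *s y0) = 0" using y0 by (simp only: f) simp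
    moreover have "y + (- ?c) *s y0 \<in> Y"
      using y y0 Y by (simp add: vec.subspace_diff vec.subspace_scale)
    ultimately have "y + (- ?c) *s y0 \<in> vec.span (insert y0 ?K)" by (intro vec.span_base) simp
    moreover have "?c *s y0 \<in> vec.span (insert y0 ?K)" by (intro vec.span_scale vec.span_base) simp
    ultimately show "y \<in> vec.span (insert y0 ?K)" by (subst eq) (rule vec.span_add)
  qed
  then have "vec.dim Y \<le> vec.dim (insert y0 ?K)" by (rule vec.dim_mono)
  also have "\<dots> \<le> vec.dim ?K + 1" by (simp add: vec.dim_insert)
  finally show ?thesis .
qed

section \<open>Fixed spaces, moved spaces and orthogonal complements\<close>

definition fixed_space :: "'a::field^'n^'n \<Rightarrow> ('a^'n) set" where
  "fixed_space g = {v. v v* g = v}"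

lemma subspace_fixed_space [simp]: "vec.subspace (fixed_space g)"
  by (rule vec.subspaceI) (auto simp: fixed_space_def vm.add vm.scale)

lemma linear_moved: "Vector_Spaces.linear (*s) (*s) (\<lambda>w. w - w v* (g::'a::field^'n^'n))"
  by unfold_locales (auto simp: vm.add vm.scale vector_add_ldistrib vec.scale_right_diff_distrib)

lemma subspace_moved_space [simp]: "vec.subspace (moved_space g)"
proof -
  interpret m: Vector_Spaces.linear "(*s)" "(*s)" "\<lambda>w. w - w v* g" by (rule linear_moved)
  show ?thesis unfolding moved_space_def using m.subspace_image[OF vec.subspace_UNIV] .
qed

lemma dim_fixed_plus_moved:
  "vec.dim (fixed_space g) + vec.dim (moved_space g) = CARD('n)" for g :: "'a::field^'n^'n"
proof -
  have "{w \<in> UNIV. w - w v* g = 0} = fixed_space g" by (auto simp: fixed_space_def)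
  then show ?thesis
    using dim_image_plus_kernel[OF linear_moved[of g] vec.subspace_UNIV]
    by (simp add: moved_space_def vec.dim_UNIV card_cart_basis)
qed

locale nonsing_form =
  fixes Q :: "'a::{field,finite}^'n \<Rightarrow> 'a"
  assumes nonsing: "nonsingular_quadratic_form Q"
begin

abbreviation pol (\<open>\<beta>\<close>) where "\<beta> \<equiv> polar Q"

lemma pol_linear: "Vector_Spaces.linear (*s) (*) (\<lambda>v. \<beta> u v)"
  "Vector_Spaces.linear (*s) (*) (\<lambda>u. \<beta> u v)"
  using nonsing unfolding nonsingular_quadratic_form_def quadratic_form_def by blast+

lemma pol_add: "\<beta> u (v + w) = \<beta> u v + \<beta> u w" "\<beta> (v + w) u = \<beta> v u + \<beta> w u"
  and pol_scale: "\<beta> u (c *s v) = c * \<beta> u v" "\<beta> (c *s v) u = c * \<beta> v u"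
  using pol_linear[THEN Vector_Spaces.linear.axioms(3)]
  by (auto simp: module_hom_axioms_def module_hom_def dest!: module_hom.axioms(3))

lemma pol_commute: "\<beta> u v = \<beta> v u"
  by (simp add: polar_def add.commute)

lemma pol_zero [simp]: "\<beta> 0 v = 0" "\<beta> v 0 = 0"
  using pol_scale[where c=0] by simp_all

lemma pol_minus [simp]: "\<beta> u (- v) = - \<beta> u v" "\<beta> (- v) u = - \<beta> v u"
  using pol_scale[where c="-1"] by simp_all

lemma pol_diff: "\<beta> u (v - w) = \<beta> u v - \<beta> u w" "\<beta> (v - w) u = \<beta> v u - \<beta> w u"
  using pol_add(1)[of u v "- w"] pol_add(2)[of v "- w" u] by simp_all

lemma pol_nondeg: "(\<And>v. \<beta> u v = 0) \<Longrightarrow> u = 0"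
  using nonsing unfolding nonsingular_quadratic_form_def by blast

lemma bilinear_on_pol [simp]: "bilinear_on W \<beta>"
  by (simp add: bilinear_on_def pol_add pol_scale)

lemma Q_scale: "Q (c *s v) = c\<^sup>2 * Q v"
  using nonsing unfolding nonsingular_quadratic_form_def quadratic_form_def by blast

lemma Q_add: "Q (u + v) = Q u + Q v + \<beta> u v"
  by (simp add: polar_def)

lemma Q_zero [simp]: "Q 0 = 0"
  using Q_scale[of 0] by simp

lemma Q_minus [simp]: "Q (- v) = Q v"
  using Q_scale[of "- 1" v] by simp

lemma Q_diff: "Q (u - v) = Q u + Q v - \<beta> u v"
  using Q_add[of u "- v"] by simp

lemma pol_self: "\<beta> v v = 2 * Q v"
proof -
  have "v + v = 2 *s v" by (simp add: vec_eq_iff)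
  then show ?thesis using Q_add[of v v] Q_scale[of 2 v] by simp
qed

abbreviation isometry :: "'a^'n^'n \<Rightarrow> bool" where
  "isometry g \<equiv> g \<in> orthogonal_group Q"

lemma orthogonalD:
  assumes "isometry g"
  shows "invertible g" "Q (v v* g) = Q v" "\<beta> (u v* g) (v v* g) = \<beta> u v"
  using assms by (auto simp: orthogonal_group_def GL_def polar_def simp flip: vm.add)

lemma orthogonalI:
  assumes "\<And>v. Q (v v* g) = Q v"
  shows "isometry g"
proof -
  have pol: "\<beta> (u v* g) (v v* g) = \<beta> u v" for u v
    using assms by (simp add: polar_def flip: vm.add)
  have "v = 0" if "v v* g = 0" for v
  proof (rule pol_nondeg)
    fix w
    show "\<beta> v w = 0" using pol[of v w] that by simp
  qed
  then have "invertible g" by (simp add: invertible_iff_kernel)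
  then show ?thesis using assms by (simp add: orthogonal_group_def GL_def)
qed

lemma orthogonal_one: "isometry (mat 1)"
  by (rule orthogonalI) simp

lemma orthogonal_mult:
  "isometry g \<Longrightarrow> isometry h \<Longrightarrow> isometry (g ** h)"
  by (rule orthogonalI) (simp add: orthogonalD flip: vector_matrix_mul_assoc)

lemma orthogonal_inverse:
  assumes "isometry g" "h ** g = mat 1"
  shows "isometry h"
proof (rule orthogonalI)
  fix v
  have "Q (v v* h) = Q (v v* h v* g)" using orthogonalD(2)[OF assms(1)] by simp
  also have "\<dots> = Q v" by (simp add: vector_matrix_mul_assoc assms(2))
  finally show "Q (v v* h) = Q v" .
qed

lemma orthogonal_obtain_inverse:
  assumes "isometry g"
  obtains h where "isometry h" "h ** g = mat 1" "g ** h = mat 1"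
  using assms orthogonalD(1)[OF assms] orthogonal_inverse unfolding invertible_def by blast

definition perp :: "('a^'n) set \<Rightarrow> ('a^'n) set" where
  "perp W = {v. \<forall>w\<in>W. \<beta> v w = 0}"

lemma subspace_perp [simp]: "vec.subspace (perp W)"
  by (rule vec.subspaceI) (auto simp: perp_def pol_add pol_scale)

lemma perp_span: "perp (vec.span B) = perp B"
proof
  show "perp (vec.span B) \<subseteq> perp B" by (auto simp: perp_def vec.span_base)
  show "perp B \<subseteq> perp (vec.span B)"
  proof
    fix v assume "v \<in> perp B"
    then have "B \<subseteq> {w. \<beta> v w = 0}" by (auto simp: perp_def)
    moreover have "vec.subspace {w. \<beta> v w = 0}"
      by (rule vec.subspaceI) (auto simp: pol_add pol_scale)
    ultimately have "vec.span B \<subseteq> {w. \<beta> v w = 0}" by (rule vec.span_minimal)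
    then show "v \<in> perp (vec.span B)" by (auto simp: perp_def)
  qed
qed

lemma dim_Int_perp:
  assumes "finite B" "vec.subspace Y"
  shows "vec.dim Y \<le> vec.dim (Y \<inter> perp B) + card B"
  using assms
proof (induction B rule: finite_induct)
  case empty
  then show ?case by (simp add: perp_def)
next
  case (insert b B)
  have "vec.dim (Y \<inter> perp B) \<le> vec.dim {y \<in> Y \<inter> perp B. \<beta> y b = 0} + 1"
    using insert.prems by (intro dim_kernel_functional) (auto simp: pol_add pol_scale vec.subspace_inter)
  also have "{y \<in> Y \<inter> perp B. \<beta> y b = 0} = Y \<inter> perp (insert b B)"
    by (auto simp: perp_def)
  finally show ?case using insert by simp
qed

lemma perp_UNIV [simp]: "perp UNIV = {0}"
  using pol_nondeg by (auto simp: perp_def)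

text \<open>One inequality counts the linear conditions imposed by a basis of \<open>W\<close>. The
  other counts those of a complement \<open>U\<close>: they cut \<open>perp W\<close> down to zero,
  because a vector orthogonal to both \<open>W\<close> and \<open>U\<close> is orthogonal to
  everything.\<close>

lemma dim_perp:
  assumes W: "vec.subspace W"
  shows "vec.dim (perp W) + vec.dim W = CARD('n)"
proof -
  obtain B where B: "basis_of B W" using basis_of_exists[OF W] by blast
  note b = basis_of_facts[OF B]
  obtain U where U: "vec.subspace U" "\<forall>w\<in>UNIV. \<exists>r\<in>W. \<exists>u\<in>U. w = r + u"
      "vec.dim (UNIV :: ('a^'n) set) = vec.dim W + vec.dim U"
    using complement_exists[OF W vec.subspace_UNIV] by blast
  obtain C where C: "basis_of C U" using basis_of_exists[OF U(1)] by blast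
  note c = basis_of_facts[OF C]
  have n: "vec.dim (UNIV :: ('a^'n) set) = CARD('n)" by (simp add: vec.dim_UNIV card_cart_basis)
  have 1: "CARD('n) \<le> vec.dim (perp W) + vec.dim W"
    using dim_Int_perp[OF b(1) vec.subspace_UNIV] b(4,6) perp_span[of B] n by simp
  have "perp W \<inter> perp U \<subseteq> perp UNIV"
  proof
    fix v assume v: "v \<in> perp W \<inter> perp U"
    have "\<beta> v w = 0" for w
    proof -
      obtain r u where "r \<in> W" "u \<in> U" "w = r + u" using bspec[OF U(2), of w] by blast
      then show ?thesis using v by (simp add: perp_def pol_add)
    qed
    then show "v \<in> perp UNIV" by (simp add: perp_def)
  qed
  then have "vec.dim (perp W \<inter> perp U) = 0" by simp
  moreover have "perp U = perp C" using c(6) perp_span[of C] by simp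
  ultimately have "vec.dim (perp W) \<le> vec.dim U"
    using dim_Int_perp[OF c(1) subspace_perp[of W]] unfolding c(4) by (metis add_0)
  then show ?thesis using 1 U(3) n by linarith
qed

lemma perp_perp:
  assumes W: "vec.subspace W"
  shows "perp (perp W) = W"
proof -
  have sub: "W \<subseteq> perp (perp W)" by (auto simp: perp_def pol_commute)
  have "vec.dim (perp (perp W)) = vec.dim W"
    using dim_perp[OF W] dim_perp[OF subspace_perp[of W]] by simp
  then show ?thesis using vec.subspace_dim_equal[OF W subspace_perp sub] by simp
qed

text \<open>If \<open>v\<close> is orthogonal to all \<open>w - w g\<close>, then
  \<open>\<beta> v (w g) = \<beta> v w = \<beta> (v g) (w g)\<close> for all \<open>w\<close>; the
  vectors \<open>w g\<close> exhaust the space, so \<open>v = v g\<close>.\<close>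

lemma perp_moved_space:
  assumes g: "isometry g"
  shows "perp (moved_space g) = fixed_space g"
proof
  show "fixed_space g \<subseteq> perp (moved_space g)"
    unfolding fixed_space_def perp_def moved_space_def
    using orthogonalD(3)[OF g] by (auto simp: pol_diff) (metis)
  show "perp (moved_space g) \<subseteq> fixed_space g"
  proof
    fix v assume "v \<in> perp (moved_space g)"
    then have *: "\<beta> v w = \<beta> v (w v* g)" for w
      by (auto simp: perp_def moved_space_def pol_diff)
    obtain h where h: "h ** g = mat 1" using orthogonal_obtain_inverse[OF g] by metis
    have "\<beta> (v - v v* g) w = 0" for w
    proof -
      have w: "w = (w v* h) v* g" by (simp add: vector_matrix_mul_assoc h)
      have "\<beta> v w = \<beta> v (w v* h)" using *[of "w v* h"] w by simp
      also have "\<dots> = \<beta> (v v* g) w" using orthogonalD(3)[OF g, of v "w v* h"] w by simp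
      finally show ?thesis by (simp add: pol_diff)
    qed
    then have "v - v v* g = 0" by (rule pol_nondeg)
    then show "v \<in> fixed_space g" by (simp add: fixed_space_def)
  qed
qed

lemma perp_fixed_space:
  assumes "isometry g"
  shows "perp (fixed_space g) = moved_space g"
  using perp_moved_space[OF assms] perp_perp[OF subspace_moved_space[of g]] by simp

lemma wall_form_eq:
  assumes g: "isometry g" and v: "v \<in> moved_space g" and u: "u = w - w v* g"
  shows "wall_form Q g u v = \<beta> w v"
proof -
  define w' where "w' = (SOME w. u = w - w v* g)"
  have "u = w' - w' v* g" unfolding w'_def using u by (rule someI)
  with u have "w - w' \<in> fixed_space g"
    by (simp add: fixed_space_def vm.diff algebra_simps)
  then have "\<beta> (w - w') v = 0"
    using v perp_moved_space[OF g] by (auto simp: perp_def)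
  then show ?thesis by (simp add: wall_form_def w'_def[symmetric] pol_diff)
qed

lemma bilinear_on_wall_form:
  assumes g: "isometry g"
  shows "bilinear_on (moved_space g) (wall_form Q g)"
proof -
  note V = subspace_moved_space[of g]
  have *: "\<exists>w. u = w - w v* g" if "u \<in> moved_space g" for u
    using that by (auto simp: moved_space_def)
  show ?thesis
    unfolding bilinear_on_def
  proof (intro conjI ballI allI)
    fix u v w assume uv: "u \<in> moved_space g" "v \<in> moved_space g" "w \<in> moved_space g"
    obtain u' v' w' where e: "u = u' - u' v* g" "v = v' - v' v* g" "w = w' - w' v* g"
      using * uv by metis
    have s: "u + v = (u' + v') - (u' + v') v* g" by (simp add: e vm.add)
    have "u + v \<in> moved_space g" using V uv vec.subspace_add by blast
    then show "wall_form Q g (u + v) w = wall_form Q g u w + wall_form Q g v w"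
      "wall_form Q g w (u + v) = wall_form Q g w u + wall_form Q g w v"
      using wall_form_eq[OF g uv(3) s] wall_form_eq[OF g uv(3) e(1)] wall_form_eq[OF g uv(3) e(2)]
        wall_form_eq[OF g _ e(3)] uv by (simp_all add: pol_add)
  next
    fix c u v assume uv: "u \<in> moved_space g" "v \<in> moved_space g"
    obtain u' v' where e: "u = u' - u' v* g" "v = v' - v' v* g"
      using * uv by metis
    have s: "c *s u = (c *s u') - (c *s u') v* g" by (simp add: e vm.scale vec.scale_right_diff_distrib)
    have "c *s v \<in> moved_space g" using V uv vec.subspace_scale by blast
    then show "wall_form Q g (c *s u) v = c * wall_form Q g u v"
      "wall_form Q g u (c *s v) = c * wall_form Q g u v"
      using wall_form_eq[OF g uv(2) s] wall_form_eq[OF g uv(2) e(1)] wall_form_eq[OF g _ e(1)] uv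
      by (simp_all add: pol_scale)
  qed
qed

text \<open>For \<open>u = w - w g\<close> both sides equal \<open>2 Q w - \<beta> w (w g)\<close>,
  as \<open>Q (w g) = Q w\<close> and \<open>\<beta> w w = 2 Q w\<close>. The diagonal of the Wall
  form thus does not depend on \<open>g\<close>, in any characteristic.\<close>

lemma wall_form_self:
  assumes g: "isometry g" and u: "u \<in> moved_space g"
  shows "wall_form Q g u u = Q u"
proof -
  obtain w where w: "u = w - w v* g" using u by (auto simp: moved_space_def)
  have "wall_form Q g u u = \<beta> w u" by (rule wall_form_eq[OF g u w])
  also have "\<dots> = Q u"
    unfolding w using orthogonalD(2)[OF g] by (simp add: pol_diff pol_self Q_diff)
  finally show ?thesis .
qed

end

section \<open>Parity of the dimension of the moved space\<close>

lemma GL_mult: "x \<otimes>\<^bsub>GL\<^esub> y = x ** y" and GL_one: "\<one>\<^bsub>GL\<^esub> = mat 1"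
  by (simp_all add: GL_def)

lemma vector_GL_pow: "v v* (x [^]\<^bsub>GL\<^esub> (n::nat)) = ((\<lambda>v. v v* x) ^^ n) v"
  for x :: "'a::field^'n^'n"
  by (induction n) (simp_all add: GL_mult GL_one flip: vector_matrix_mul_assoc)

lemma invertible_finite_order:
  fixes x :: "'a::{field,finite}^'n^'n"
  assumes "invertible x"
  shows "group.ord GL x > 0" "((\<lambda>v. v v* x) ^^ group.ord GL x) v = v"
proof -
  interpret GL: group "GL :: ('a^'n^'n) monoid" by (rule group_GL)
  have x: "x \<in> carrier GL" using assms by (simp add: GL_def)
  show "group.ord GL x > 0" using GL.ord_ge_1[OF _ x] by simp
  show "((\<lambda>v. v v* x) ^^ group.ord GL x) v = v"
    using GL.pow_ord_eq_1[OF x] by (simp add: GL_one flip: vector_GL_pow)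
qed

lemma funpow_compose_commute:
  assumes "\<And>v. f (g v) = g (f v)"
  shows "((\<lambda>v. f (g v)) ^^ n) v = (f ^^ n) ((g ^^ n) v)"
proof (induction n arbitrary: v)
  case (Suc n)
  have *: "(f ^^ n) (g v) = g ((f ^^ n) v)" for n v
    using assms by (induction n) simp_all
  show ?case by (simp add: Suc *)
qed simp

lemma conj_by_eq:
  fixes z :: "'a::field^'n^'n"
  assumes "h ** z = mat 1" "z ** h = mat 1"
  shows "conj_by x z = h ** x ** z"
proof -
  interpret GL: group "GL :: ('a^'n^'n) monoid" by (rule group_GL)
  have "z \<in> carrier GL" "h \<in> carrier GL" using assms by (auto simp: GL_def invertible_def)
  then have "inv\<^bsub>GL\<^esub> z = h"
    using GL.inv_equality[of h z] assms(1) by (simp add: GL_mult GL_one)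
  then show ?thesis by (simp add: conj_by_def GL_mult)
qed

lemma conj_by_mult:
  fixes g h :: "'a::field^'n^'n"
  assumes "invertible g" "invertible h"
  shows "conj_by x (g ** h) = conj_by (conj_by x g) h"
proof -
  interpret GL: group "GL :: ('a^'n^'n) monoid" by (rule group_GL)
  have "g \<in> carrier GL" "h \<in> carrier GL" using assms by (auto simp: GL_def)
  then have "inv\<^bsub>GL\<^esub> (g \<otimes>\<^bsub>GL\<^esub> h) = inv\<^bsub>GL\<^esub> h \<otimes>\<^bsub>GL\<^esub> inv\<^bsub>GL\<^esub> g" by (rule GL.inv_mult_group)
  then show ?thesis by (simp add: conj_by_def GL_mult matrix_mul_assoc)
qed

lemma conj_by_eq_iff:
  fixes g h :: "'a::field^'n^'n"
  assumes g: "g' ** g = mat 1" "g ** g' = mat 1" and h: "h' ** h = mat 1" "h ** h' = mat 1"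
  shows "conj_by x g = conj_by x h \<longleftrightarrow> (g ** h') ** x = x ** (g ** h')"
proof -
  have "g' ** x ** g = h' ** x ** h \<longleftrightarrow> g ** (g' ** x ** g) ** h' = g ** (h' ** x ** h) ** h'"
  proof
    assume "g ** (g' ** x ** g) ** h' = g ** (h' ** x ** h) ** h'"
    then have "g' ** (g ** (g' ** x ** g) ** h') ** h = g' ** (g ** (h' ** x ** h) ** h') ** h" by simp
    then have "(g' ** g) ** g' ** x ** g ** (h' ** h) = (g' ** g) ** h' ** x ** h ** (h' ** h)"
      by (simp add: matrix_mul_assoc)
    then show "g' ** x ** g = h' ** x ** h" by (simp add: g h)
  qed simp
  also have "g ** (g' ** x ** g) ** h' = (g ** g') ** x ** (g ** h')" by (simp add: matrix_mul_assoc)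
  also have "g ** (h' ** x ** h) ** h' = (g ** h') ** x ** (h ** h')" by (simp add: matrix_mul_assoc)
  finally show ?thesis by (simp add: conj_by_eq[OF g] conj_by_eq[OF h] g h) metis
qed

text \<open>If \<open>w = v - v x\<close> is fixed by \<open>x\<close>, then \<open>v x\<^sup>i = v - i w\<close> for all \<open>i\<close>.\<close>

lemma fixed_Int_moved:
  fixes x :: "'a::field^'n^'n"
  assumes ord: "\<And>v. ((\<lambda>v. v v* x) ^^ m) v = v" and m: "of_nat m \<noteq> (0::'a)"
  shows "fixed_space x \<inter> moved_space x = {0}"
proof
  show "fixed_space x \<inter> moved_space x \<subseteq> {0}"
  proof
    fix w assume "w \<in> fixed_space x \<inter> moved_space x"
    then obtain v where w: "w v* x = w" "w = v - v v* x"
      by (auto simp: fixed_space_def moved_space_def)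
    have vx: "v v* x = v - w" using w(2) by simp
    have "((\<lambda>v. v v* x) ^^ i) v = v - of_nat i *s w" for i
      by (induction i) (simp_all add: vm.diff vm.scale w(1) vx vector_sadd_rdistrib)
    from this[of m] have "of_nat m *s w = 0" using ord by simp
    then show "w \<in> {0}" using m by simp
  qed
qed (simp add: vec.subspace_0)

lemma semisimple_order:
  fixes x :: "'a::{field,finite}^'n^'n"
  assumes "semisimple x"
  shows "of_nat (group.ord GL x) \<noteq> (0::'a)"
proof
  assume "of_nat (group.ord GL x) = (0::'a)"
  then have "CHAR('a) dvd group.ord GL x" by (simp add: of_nat_eq_0_iff_char_dvd)
  then have "CHAR('a) = 1" using assms unfolding semisimple_def
    by (metis coprime_common_divisor_nat dvd_refl)
  then show False by simp
qed

context nonsing_form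
begin

lemma perp_sum:
  assumes "vec.subspace A" "vec.subspace B"
  shows "perp {x + y |x y. x \<in> A \<and> y \<in> B} = perp A \<inter> perp B"
proof
  have "A \<subseteq> {x + y |x y. x \<in> A \<and> y \<in> B}" using vec.subspace_0[OF assms(2)] by force
  moreover have "B \<subseteq> {x + y |x y. x \<in> A \<and> y \<in> B}" using vec.subspace_0[OF assms(1)] by force
  ultimately show "perp {x + y |x y. x \<in> A \<and> y \<in> B} \<subseteq> perp A \<inter> perp B"
    unfolding perp_def by blast
  show "perp A \<inter> perp B \<subseteq> perp {x + y |x y. x \<in> A \<and> y \<in> B}"
    by (auto simp: perp_def pol_add)
qed

text \<open>
  The difference of the Wall forms of \<open>g\<close> and \<open>h\<close> is alternating on the intersection of their
  moved spaces, since both forms restrict to \<open>Q\<close> on the diagonal.  Its radical is the image of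
  the space where \<open>g\<close> and \<open>h\<close> agree.
\<close>

lemma dim_moved_mult:
  assumes g: "isometry g" and k: "isometry k"
  shows "even (vec.dim (moved_space (k ** g)) + vec.dim (moved_space k) + vec.dim (moved_space g))"
proof -
  \<comment> \<open>The Wall forms compared are those of \<open>g\<close> and \<open>k g\<close>,
    since these two isometries agree exactly on the fixed space of \<open>k\<close>.\<close>
  define h where "h = k ** g"
  have h: "isometry h" unfolding h_def by (rule orthogonal_mult[OF k g])
  define X where "X = moved_space g \<inter> moved_space h"
  define f where "f u v = wall_form Q g u v - wall_form Q h u v" for u v
  have X: "vec.subspace X" by (simp add: X_def vec.subspace_inter)
  have "bilinear_on X f"
    using bilinear_on_subset[OF bilinear_on_wall_form[OF g], of X]
      bilinear_on_subset[OF bilinear_on_wall_form[OF h], of X]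
    unfolding f_def X_def by (simp add: bilinear_on_def algebra_simps)
  moreover have "\<forall>u\<in>X. f u u = 0"
    by (simp add: f_def X_def wall_form_self g h)
  ultimately have ev: "even (vec.dim X + vec.dim {u \<in> X. \<forall>v\<in>X. f u v = 0})"
    using X by (intro alternating_rank_even)
  have perpX: "perp X = {x + y |x y. x \<in> fixed_space g \<and> y \<in> fixed_space h}"
  proof -
    have "X = perp {x + y |x y. x \<in> fixed_space g \<and> y \<in> fixed_space h}"
      using perp_sum[of "fixed_space g" "fixed_space h"] perp_fixed_space g h by (simp add: X_def)
    then show ?thesis using perp_perp[OF vec.subspace_sums] by simp
  qed
  define E where "E = {w. w v* g = w v* h}"
  have rad: "{u \<in> X. \<forall>v\<in>X. f u v = 0} = (\<lambda>w. w - w v* g) ` E"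
  proof
    show "(\<lambda>w. w - w v* g) ` E \<subseteq> {u \<in> X. \<forall>v\<in>X. f u v = 0}"
    proof
      fix u assume "u \<in> (\<lambda>w. w - w v* g) ` E"
      then obtain w where "u = w - w v* g" "w v* g = w v* h" by (auto simp: E_def)
      then have w: "u = w - w v* g" "u = w - w v* h" by simp_all
      then have "u \<in> moved_space g" "u \<in> moved_space h" unfolding moved_space_def by blast+
      then have "u \<in> X" by (simp add: X_def)
      moreover have "f u v = 0" if "v \<in> X" for v
        using wall_form_eq[OF g _ w(1), of v] wall_form_eq[OF h _ w(2), of v] that
        by (simp add: f_def X_def)
      ultimately show "u \<in> {u \<in> X. \<forall>v\<in>X. f u v = 0}" by blast
    qed
    show "{u \<in> X. \<forall>v\<in>X. f u v = 0} \<subseteq> (\<lambda>w. w - w v* g) ` E"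
    proof
      fix u assume u: "u \<in> {u \<in> X. \<forall>v\<in>X. f u v = 0}"
      then have "u \<in> moved_space g" "u \<in> moved_space h" by (simp_all add: X_def)
      then obtain w w' where w: "u = w - w v* g" "u = w' - w' v* h"
        unfolding moved_space_def by blast
      have "\<beta> (w - w') v = 0" if "v \<in> X" for v
        using wall_form_eq[OF g _ w(1), of v] wall_form_eq[OF h _ w(2), of v] that u
        by (simp add: f_def X_def pol_diff)
      then have "w - w' \<in> perp X" by (simp add: perp_def)
      then obtain x y where xy: "w - w' = x + y" "x v* g = x" "y v* h = y"
        unfolding perpX by (auto simp: fixed_space_def)
      \<comment> \<open>Shifting \<open>w\<close> by a vector fixed by \<open>g\<close>, and
        \<open>w'\<close> by one fixed by \<open>h\<close>, makes the two preimages of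
        \<open>u\<close> coincide.\<close>
      let ?z = "w - x"
      have z: "?z = w' + y" using xy(1) by (simp add: algebra_simps)
      have 1: "?z - ?z v* g = u" using w(1) xy(2) by (simp add: vm.diff)
      have 2: "?z - ?z v* h = u" unfolding z using w(2) xy(3) by (simp add: vm.add)
      have "?z v* g = ?z v* h" using 1 2 by (metis diff_diff_eq2 diff_add_cancel add_diff_cancel_left')
      then show "u \<in> (\<lambda>w. w - w v* g) ` E" using 1 by (auto simp: E_def)
    qed
  qed
  have Ek: "E = fixed_space k"
  proof -
    obtain g' where g': "g ** g' = mat 1" using orthogonal_obtain_inverse[OF g] by metis
    have "w v* k = w" if "w v* g = w v* k v* g" for w
    proof -
      have "w v* g v* g' = w v* k v* g v* g'" using that by simp
      then show ?thesis
        by (simp add: vector_matrix_mul_assoc g' flip: matrix_mul_assoc)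
    qed
    then show ?thesis by (auto simp: E_def fixed_space_def h_def simp flip: vector_matrix_mul_assoc)
  qed
  have kerE: "{w \<in> E. w - w v* g = 0} = perp {x + y |x y. x \<in> moved_space g \<and> y \<in> moved_space h}"
    using perp_sum[of "moved_space g" "moved_space h"] perp_moved_space[OF g] perp_moved_space[OF h]
    by (auto simp: E_def fixed_space_def)
  have "vec.dim (fixed_space k) = vec.dim ((\<lambda>w. w - w v* g) ` E) + vec.dim {w \<in> E. w - w v* g = 0}"
    unfolding Ek by (rule dim_image_plus_kernel[OF linear_moved subspace_fixed_space])
  moreover have "vec.dim {w \<in> E. w - w v* g = 0} +
      vec.dim {x + y |x y. x \<in> moved_space g \<and> y \<in> moved_space h} = CARD('n)"
    unfolding kerE by (rule dim_perp) (simp add: vec.subspace_sums)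
  moreover have "vec.dim {x + y |x y. x \<in> moved_space g \<and> y \<in> moved_space h} + vec.dim X =
      vec.dim (moved_space g) + vec.dim (moved_space h)"
    unfolding X_def by (rule vec.dim_sums_Int) simp_all
  \<comment> \<open>Bookkeeping of dimensions: \<open>f\<close> and \<open>v\<close> belong to the
    fixed and moved space of \<open>k\<close>, \<open>a\<close> and \<open>b\<close> to the moved
    spaces of \<open>g\<close> and \<open>h\<close>, \<open>s\<close> and \<open>x\<close> to their
    sum and intersection, \<open>r\<close> to the radical and \<open>m\<close> to the kernel of
    \<open>1 - g\<close> on \<open>E\<close>.\<close>
  moreover have "even (b + v + a)"
    if "f = r + m" "m + s = n" "s + x = a + b" "even (x + r)" "f + v = n" for f r m s n x a b v :: nat
    using that by presburger
  ultimately show ?thesis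
    using ev dim_fixed_plus_moved[of k] unfolding rad h_def[symmetric] by blast
qed

lemma moved_space_one [simp]: "moved_space (mat 1) = {0}"
  by (auto simp: moved_space_def)

lemma even_moved_inverse:
  assumes "isometry g" "isometry h" "h ** g = mat 1"
  shows "even (vec.dim (moved_space h)) \<longleftrightarrow> even (vec.dim (moved_space g))"
  using dim_moved_mult[OF assms(1,2)] unfolding assms(3) by simp

text \<open>Dividing by \<open>Q u\<close> instead of \<open>\<beta> u u\<close> covers
  characteristic 2 as well, where the map is an orthogonal transvection.\<close>

definition reflection :: "'a^'n \<Rightarrow> 'a^'n^'n" where
  "reflection u = Finite_Cartesian_Product.transpose (matrix (\<lambda>v. v - (\<beta> v u / Q u) *s u))"

lemma reflection_apply: "v v* reflection u = v - (\<beta> v u / Q u) *s u"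
proof -
  have "Vector_Spaces.linear (*s) (*s) (\<lambda>v. v - (\<beta> v u / Q u) *s u)"
    by unfold_locales
      (auto simp: pol_add pol_scale vec_eq_iff algebra_simps add_divide_distrib)
  then show ?thesis by (simp add: reflection_def matrix_works)
qed

lemma reflection_orthogonal:
  assumes "Q u \<noteq> 0"
  shows "isometry (reflection u)"
  by (rule orthogonalI)
    (use assms in \<open>simp add: reflection_apply Q_diff Q_scale pol_scale power2_eq_square\<close>)

lemma reflection_involution:
  assumes "Q u \<noteq> 0"
  shows "reflection u ** reflection u = mat 1"
  unfolding vector_matrix_eq_iff
  using assms
  by (auto simp: reflection_apply pol_diff pol_scale pol_self vec_eq_iff field_simps
      simp flip: vector_matrix_mul_assoc)

lemma moved_space_reflection:
  assumes "Q u \<noteq> 0"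
  shows "moved_space (reflection u) = vec.span {u}"
proof -
  have "u \<noteq> 0" using assms by auto
  then obtain v where v: "\<beta> v u \<noteq> 0" using pol_nondeg pol_commute by metis
  show ?thesis
  proof
    show "moved_space (reflection u) \<subseteq> vec.span {u}"
      by (auto simp: moved_space_def reflection_apply vec.span_singleton)
    show "vec.span {u} \<subseteq> moved_space (reflection u)"
    proof
      fix y assume "y \<in> vec.span {u}"
      then obtain c where "y = c *s u" by (auto simp: vec.span_singleton)
      then have "y = (c * Q u / \<beta> v u) *s v - ((c * Q u / \<beta> v u) *s v) v* reflection u"
        using v assms by (simp add: reflection_apply pol_scale)
      then show "y \<in> moved_space (reflection u)" unfolding moved_space_def by blast
    qed
  qed
qed

lemma dim_moved_reflection: "Q u \<noteq> 0 \<Longrightarrow> vec.dim (moved_space (reflection u)) = 1"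
  using moved_space_reflection by (auto simp: vec.dim_singleton)

lemma commutes_reflection:
  assumes "isometry x" "u v* x = u"
  shows "reflection u ** x = x ** reflection u"
proof -
  have "\<beta> (v v* x) u = \<beta> v u" for v using orthogonalD(3)[OF assms(1), of v u] assms(2) by simp
  then show ?thesis
    unfolding vector_matrix_eq_iff
    by (auto simp: reflection_apply vm.diff vm.scale assms(2) simp flip: vector_matrix_mul_assoc)
qed

text \<open>Polarization: if \<open>Q\<close> vanished on \<open>W\<close>, so would
  \<open>\<beta>\<close>, and \<open>w\<close> would lie in \<open>perp W\<close>.\<close>

lemma nonsingular_vector_exists:
  assumes "W \<inter> perp W = {0}" "w \<in> W" "w \<noteq> 0" "vec.subspace W"
  shows "\<exists>u\<in>W. Q u \<noteq> 0"
proof (rule ccontr)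
  assume *: "\<not> ?thesis"
  then have "\<beta> w v = 0" if "v \<in> W" for v
    using that assms(2) vec.subspace_add[OF assms(4)] unfolding polar_def by auto
  then show False using assms by (auto simp: perp_def)
qed

text \<open>In characteristic 2 the operator \<open>x ^ (2 ^ j) - 1\<close> equals
  \<open>(x - 1) ^ (2 ^ j)\<close>. Stepwise: if \<open>f\<close> is an involution on
  \<open>w\<close>, then \<open>w + f w\<close> is fixed by \<open>f\<close>, hence zero by
  induction, so \<open>w\<close> itself is fixed by \<open>f\<close>.\<close>

lemma fixed_space_square_trivial:
  assumes two: "(2::'a) = 0" and x: "fixed_space x = {0}"
  shows "((\<lambda>v. v v* x) ^^ (2 ^ j)) w = w \<Longrightarrow> w = (0 :: 'a^'n)"
proof (induction j arbitrary: w)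
  case 0
  then have "w \<in> fixed_space x" by (simp add: fixed_space_def)
  with x show ?case by simp
next
  case (Suc j)
  let ?f = "(\<lambda>v::'a^'n. v v* x) ^^ (2 ^ j)"
  have lin: "?f (u + v) = ?f u + ?f v" for u v
    by (simp add: vm.add flip: vector_GL_pow)
  have ff: "?f (?f w) = w"
    using Suc.prems by (simp add: mult_2 funpow_add)
  have dbl: "u + u = 0" for u :: "'a^'n"
  proof -
    have "u + u = 2 *s u" by (simp add: vec_eq_iff)
    then show ?thesis using two by simp
  qed
  have "?f (w + ?f w) = w + ?f w" using lin ff by (simp add: add.commute)
  then have "w + ?f w = 0" by (rule Suc.IH)
  then have "?f w = w" using dbl[of w] by (metis add_left_cancel)
  then show ?case by (rule Suc.IH)
qed

text \<open>\<open>T\<close> is the sum of \<open>y + y'\<close> over the two isometries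
  \<open>y = h x\<close> and \<open>y = x\<close>, where \<open>y'\<close> is the inverse of
  \<open>y\<close>. Each summand gives an alternating form in characteristic 2, since
  \<open>\<beta> u (u y') = \<beta> (u y) u\<close>. It remains to identify the radical, the kernel
  of \<open>T\<close>, with the fixed space of \<open>h\<close>.\<close>

lemma even_moved_two_power_order:
  assumes two: "(2::'a) = 0" and x: "isometry x" "fixed_space x = {0}"
    and h: "isometry h" "h ** x = x ** h" "\<And>v. ((\<lambda>v. v v* h) ^^ (2 ^ k)) v = v"
  shows "even (vec.dim (moved_space h))"
proof -
  have dbl: "u + u = 0" for u :: "'a^'n"
  proof -
    have "u + u = 2 *s u" by (simp add: vec_eq_iff)
    then show ?thesis using two by simp
  qed
  have dbl': "a + a = 0" for a :: 'a using two by (simp add: mult_2[symmetric])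
  have addeq: "u = v" if "u + v = 0" for u v :: "'a^'n"
    using that dbl[of v] by (metis add_right_cancel)
  obtain x' where x': "isometry x'" "x' ** x = mat 1" "x ** x' = mat 1"
    using orthogonal_obtain_inverse[OF x(1)] by metis
  obtain h' where h': "isometry h'" "h' ** h = mat 1" "h ** h' = mat 1"
    using orthogonal_obtain_inverse[OF h(1)] by metis
  have c1: "v v* x v* x' = v" "v v* x' v* x = v" "v v* h v* h' = v" "v v* h' v* h = v" for v
    by (simp_all add: vector_matrix_mul_assoc x' h')
  have c2: "v v* h v* x = v v* x v* h" for v by (simp add: vector_matrix_mul_assoc h(2))
  have c3: "v v* h' v* x = v v* x v* h'" for v using c1 c2 by metis
  have c4: "v v* h v* x' = v v* x' v* h" for v using c1 c2 by metis
  have c5: "v v* h' v* x' = v v* x' v* h'" for v using c1 c4 by metis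
  have adj: "\<beta> u (v v* x) = \<beta> (u v* x') v" "\<beta> u (v v* x') = \<beta> (u v* x) v"
    "\<beta> u (v v* h) = \<beta> (u v* h') v" "\<beta> u (v v* h') = \<beta> (u v* h) v" for u v
    using orthogonalD(3)[OF x(1), of "u v* x'" v] orthogonalD(3)[OF x'(1), of "u v* x" v]
      orthogonalD(3)[OF h(1), of "u v* h'" v] orthogonalD(3)[OF h'(1), of "u v* h" v]
    by (simp_all add: c1)
  define T where "T v = v v* h v* x + v v* h' v* x' + v v* x + v v* x'" for v
  define F where "F u v = \<beta> u (T v)" for u v
  have Tlin: "T (u + v) = T u + T v" "T (c *s v) = c *s T v" for u v c
    by (simp_all add: T_def vm.add vm.scale vector_add_ldistrib algebra_simps)
  have bil: "bilinear_on UNIV F"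
    by (simp add: bilinear_on_def F_def Tlin pol_add pol_scale)
  have Fadj: "F u v = \<beta> (T u) v" for u v
    unfolding F_def T_def by (simp add: pol_add adj c2 c3 c4 c5)
  have alt: "F u u = 0" for u
  proof -
    have "\<beta> u (u v* h' v* x') = \<beta> u (u v* h v* x)"
      by (simp only: adj(2,4) c2 pol_commute[of "u v* x v* h" u])
    moreover have "\<beta> u (u v* x') = \<beta> u (u v* x)"
      by (simp only: adj(2) pol_commute[of "u v* x" u])
    ultimately have "F u u = (\<beta> u (u v* h v* x) + \<beta> u (u v* h v* x)) + (\<beta> u (u v* x) + \<beta> u (u v* x))"
      by (simp add: F_def T_def pol_add)
    then show ?thesis by (simp add: dbl')
  qed
  have rad: "{u \<in> UNIV. \<forall>v\<in>UNIV. F u v = 0} = fixed_space h"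
  proof
    show "fixed_space h \<subseteq> {u \<in> UNIV. \<forall>v\<in>UNIV. F u v = 0}"
    proof
      fix u assume "u \<in> fixed_space h"
      then have u: "u v* h = u" by (simp add: fixed_space_def)
      then have "u v* h' = u" using c1(3)[of u] by simp
      then have "T u = (u v* x + u v* x) + (u v* x' + u v* x')" using u by (simp add: T_def)
      then have "T u = 0" by (simp add: dbl)
      then show "u \<in> {u \<in> UNIV. \<forall>v\<in>UNIV. F u v = 0}" by (simp add: Fadj)
    qed
    show "{u \<in> UNIV. \<forall>v\<in>UNIV. F u v = 0} \<subseteq> fixed_space h"
    proof
      fix u assume "u \<in> {u \<in> UNIV. \<forall>v\<in>UNIV. F u v = 0}"
      then have "T u = 0" by (auto intro: pol_nondeg simp: Fadj)
      \<comment> \<open>With \<open>w = u (1 + h)\<close> the operator factors: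
        \<open>T u = w (x + h' x')\<close>.\<close>
      define w where "w = u + u v* h"
      have "w v* x + w v* h' v* x' = T u"
        by (simp add: w_def T_def vm.add c1)
      then have "w v* x + w v* h' v* x' = 0" using \<open>T u = 0\<close> by simp
      then have "w v* x = w v* h' v* x'" by (rule addeq)
      \<comment> \<open>Iterating this relation \<open>2 ^ k\<close> times removes \<open>h\<close>
        and leaves \<open>w\<close> fixed by the power of \<open>x\<close> with exponent
        \<open>2 ^ Suc k\<close>.\<close>
      then have "w v* x v* x v* h = w" by (simp add: c1)
      then have fx: "((\<lambda>v. v v* x v* x v* h) ^^ n) w = w" for n
        by (induction n) simp_all
      have "((\<lambda>v. (v v* x v* x) v* h) ^^ n) w = ((\<lambda>v. v v* h) ^^ n) (((\<lambda>v. v v* x v* x) ^^ n) w)" for n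
        by (rule funpow_compose_commute) (simp add: c2)
      moreover have "((\<lambda>v. v v* x v* x) ^^ n) w = ((\<lambda>v. v v* x) ^^ (2 * n)) w" for n
        by (induction n) simp_all
      ultimately have "((\<lambda>v. v v* x) ^^ (2 ^ Suc k)) w = w"
        using fx[of "2 ^ k"] h(3) by simp
      then have "w = 0" by (rule fixed_space_square_trivial[OF two x(2)])
      then have "u v* h = u" unfolding w_def using addeq by metis
      then show "u \<in> fixed_space h" by (simp add: fixed_space_def)
    qed
  qed
  have "even (vec.dim (UNIV :: ('a^'n) set) + vec.dim (fixed_space h))"
    using alternating_rank_even[OF bil vec.subspace_UNIV] alt unfolding rad by simp
  then show ?thesis
    using dim_fixed_plus_moved[of h] by (simp add: vec.dim_UNIV card_cart_basis) (metis even_add)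
qed

text \<open>By \<open>pw\<close> the parity for the power with exponent \<open>n\<close> is
  \<open>n\<close> times the parity for \<open>g\<close>, so raising \<open>g\<close> to the odd
  part \<open>m\<close> of its order loses nothing.\<close>

lemma even_moved_commuting:
  assumes two: "(2::'a) = 0" and x: "isometry x" "fixed_space x = {0}"
    and g: "isometry g" "g ** x = x ** g"
  shows "even (vec.dim (moved_space g))"
proof -
  have pw: "isometry (g [^]\<^bsub>GL\<^esub> n) \<and> g [^]\<^bsub>GL\<^esub> n ** x = x ** g [^]\<^bsub>GL\<^esub> n \<and>
      (even (vec.dim (moved_space (g [^]\<^bsub>GL\<^esub> n))) \<longleftrightarrow> even (n * vec.dim (moved_space g)))" for n :: nat
  proof (induction n)
    case 0
    then show ?case by (simp add: GL_one orthogonal_one)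
  next
    case (Suc n)
    have "g [^]\<^bsub>GL\<^esub> n ** g ** x = g [^]\<^bsub>GL\<^esub> n ** x ** g" using g(2) by (metis matrix_mul_assoc)
    also have "\<dots> = x ** (g [^]\<^bsub>GL\<^esub> n ** g)" using Suc by (metis matrix_mul_assoc)
    finally have 1: "g [^]\<^bsub>GL\<^esub> n ** g ** x = x ** (g [^]\<^bsub>GL\<^esub> n ** g)" .
    have "even (vec.dim (moved_space (g [^]\<^bsub>GL\<^esub> n ** g)) + vec.dim (moved_space (g [^]\<^bsub>GL\<^esub> n)) +
        vec.dim (moved_space g))"
      using dim_moved_mult[OF g(1)] Suc by blast
    then have "even (vec.dim (moved_space (g [^]\<^bsub>GL\<^esub> n ** g))) \<longleftrightarrow> even (Suc n * vec.dim (moved_space g))"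
      using Suc by auto
    then show ?case using 1 orthogonal_mult[OF _ g(1)] Suc by (simp add: GL_mult)
  qed
  have N: "group.ord GL g > 0" "\<And>v. ((\<lambda>v. v v* g) ^^ group.ord GL g) v = v"
    using invertible_finite_order orthogonalD(1)[OF g(1)] by auto
  have nz: "group.ord GL g \<noteq> 0" "\<not> is_unit (2::nat)" using N(1) by simp_all
  obtain m where m: "group.ord GL g = 2 ^ multiplicity 2 (group.ord GL g) * m" "odd m"
    by (rule multiplicity_decompose'[OF nz])
  define k where "k = multiplicity 2 (group.ord GL g)"
  have km: "group.ord GL g = 2 ^ k * m" "odd m" using m by (simp_all add: k_def)
  let ?h = "g [^]\<^bsub>GL\<^esub> m"
  have "((\<lambda>v. v v* ?h) ^^ (2 ^ k)) v = v" for v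
    using N(2)[of v] unfolding km(1) vector_GL_pow by (simp add: funpow_mult mult.commute)
  then have "even (vec.dim (moved_space ?h))"
    using pw[of m] by (intro even_moved_two_power_order[OF two x]) auto
  then show ?thesis using pw[of m] km(2) by simp
qed

end

section \<open>Reflections and the spinor norm in odd characteristic\<close>

lemma eq_minus_self_imp_zero:
  fixes x :: "'a::field"
  assumes "(2::'a) \<noteq> 0" "x = - x"
  shows "x = 0"
proof -
  have "2 * x = 0" using assms(2) by (metis add.right_inverse mult_2)
  then show ?thesis using assms(1) by simp
qed

lemma power_card_minus_one:
  fixes x :: "'a::{field,finite}"
  assumes "x \<noteq> 0"
  shows "x ^ (CARD('a) - 1) = 1"
proof -
  let ?A = "UNIV - {0::'a}"
  have "bij_betw (\<lambda>y. x * y) ?A ?A"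
    by (rule bij_betw_byWitness[where f'="\<lambda>y. y / x"]) (use assms in auto)
  then have "prod (\<lambda>y. y) ?A = (\<Prod>y\<in>?A. x * y)"
    using prod.reindex_bij_betw[of "\<lambda>y. x * y" ?A ?A "\<lambda>y. y"] by simp
  also have "\<dots> = x ^ card ?A * prod (\<lambda>y. y) ?A" by (simp add: prod.distrib)
  finally have "x ^ card ?A * prod (\<lambda>y. y) ?A = 1 * prod (\<lambda>y. y) ?A" by simp
  moreover have "prod (\<lambda>y. y) ?A \<noteq> 0" by simp
  ultimately show ?thesis by (simp add: card_Diff_subset)
qed

text \<open>Squaring is two-to-one on the nonzero elements, and 0 is one further square.\<close>

lemma card_squares:
  assumes "(2::'a::{field,finite}) \<noteq> 0"
  shows "2 * card (range (\<lambda>c::'a. c\<^sup>2)) = CARD('a) + 1"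
proof -
  let ?N = "UNIV - {0::'a}" and ?s = "\<lambda>c::'a. c\<^sup>2"
  have "card ?N = (\<Sum>y\<in>?s ` ?N. card {c \<in> ?N. ?s c = y})"
    using sum.image_gen[of ?N "\<lambda>_. 1::nat" ?s] by simp
  also have "\<dots> = (\<Sum>y\<in>?s ` ?N. 2)"
  proof (rule sum.cong)
    fix y assume "y \<in> ?s ` ?N"
    then obtain c where c: "y = c\<^sup>2" "c \<noteq> 0" by auto
    then have "{c \<in> ?N. ?s c = y} = {c, - c}" by (auto simp: power2_eq_iff)
    moreover have "c \<noteq> - c" using eq_minus_self_imp_zero[OF assms] c(2) by blast
    ultimately show "card {c \<in> ?N. ?s c = y} = 2" by simp
  qed simp
  finally have 1: "card ?N = 2 * card (?s ` ?N)" by simp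
  have "range ?s = insert 0 (?s ` ?N)" by (auto simp: image_iff)
  moreover have "0 \<notin> ?s ` ?N" by auto
  ultimately have "card (range ?s) = Suc (card (?s ` ?N))" by simp
  moreover have "card ?N = CARD('a) - 1" by (simp add: card_Diff_subset)
  moreover have "CARD('a) > 0" by simp
  ultimately show ?thesis using 1 by linarith
qed

text \<open>If \<open>2\<close> is nonzero, the count of squares shows that \<open>q + 1\<close> is
  even.\<close>

lemma even_card_iff_two_eq_zero: "even CARD('a::{field,finite}) \<longleftrightarrow> (2::'a) = 0"
proof
  assume "(2::'a) = 0"
  then have "CHAR('a) dvd 2" using of_nat_eq_0_iff_char_dvd[of 2, where 'a='a] by simp
  then have "CHAR('a) = 2" using prime_nat_iff two_is_prime_nat CHAR_not_1'[where 'a='a] by auto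
  then show "even CARD('a)" using CHAR_dvd_CARD[where 'a='a] by simp
next
  assume "even CARD('a)"
  then show "(2::'a) = 0" using card_squares[where 'a='a] by (metis dvd_triv_left even_plus_one_iff)
qed

text \<open>The set of squares and its multiple by \<open>a\<close> share only 0 and have
  \<open>(q + 1) / 2\<close> elements each, so together they cover the field and \<open>b\<close>
  lies in the second one.\<close>

lemma square_mult_nonsquares:
  fixes a b :: "'a::{field,finite}"
  assumes two: "(2::'a) \<noteq> 0" and a: "\<nexists>c. a = c\<^sup>2" and b: "\<nexists>c. b = c\<^sup>2"
  shows "\<exists>c. a * b = c\<^sup>2"
proof -
  let ?S = "range (\<lambda>c::'a. c\<^sup>2)"
  let ?T = "(\<lambda>s. a * s) ` ?S"
  have a0: "a \<noteq> 0" using a by (metis zero_power2)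
  have cT: "card ?T = card ?S" using a0 by (intro card_image inj_onI) auto
  have "?S \<inter> ?T \<subseteq> {0}"
  proof
    fix y assume "y \<in> ?S \<inter> ?T"
    then obtain c d where y: "y = c\<^sup>2" "y = a * d\<^sup>2" by blast
    show "y \<in> {0}"
    proof (rule ccontr)
      assume "y \<notin> {0}"
      then have "d \<noteq> 0" using y by auto
      then have "a = (c / d)\<^sup>2" using y by (simp add: power_divide field_simps)
      with a show False by blast
    qed
  qed
  then have "card (?S \<inter> ?T) \<le> 1" using card_mono[of "{0::'a}"] by fastforce
  then have "card (?S \<union> ?T) \<ge> CARD('a)"
    using card_Un_Int[of ?S ?T] cT card_squares[OF two] by simp
  then have "?S \<union> ?T = UNIV" using card_seteq[of UNIV "?S \<union> ?T"] by simp
  then obtain d where "b = a * d\<^sup>2" using b by blast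
  then have "a * b = (a * d)\<^sup>2" by (simp add: power2_eq_square)
  then show ?thesis by blast
qed

text \<open>Pigeonhole: the values of \<open>a\<^sup>2\<close> and those of
  \<open>y - d * t\<^sup>2\<close> fill more than half of the field each, so the two sets
  meet.\<close>

lemma sum_weighted_squares:
  fixes d y :: "'a::{field,finite}"
  assumes two: "(2::'a) \<noteq> 0" and d: "d \<noteq> 0"
  shows "\<exists>a t. a\<^sup>2 + d * t\<^sup>2 = y"
proof -
  let ?S = "range (\<lambda>c::'a. c\<^sup>2)"
  let ?T = "(\<lambda>s. y - d * s) ` ?S"
  have cT: "card ?T = card ?S" using d by (intro card_image inj_onI) auto
  have "?S \<inter> ?T \<noteq> {}"
  proof
    assume "?S \<inter> ?T = {}"
    then have "card (?S \<union> ?T) = card ?S + card ?T" by (simp add: card_Un_disjoint)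
    moreover have "card (?S \<union> ?T) \<le> CARD('a)" by (intro card_mono) auto
    ultimately show False using cT card_squares[OF two] by simp
  qed
  then obtain a t where "a\<^sup>2 = y - d * t\<^sup>2" by blast
  then show ?thesis by (metis diff_add_cancel)
qed

context nonsing_form
begin

section \<open>Discriminants of Wall forms and products of reflections\<close>

abbreviation trivial_spinor :: "'a^'n^'n \<Rightarrow> bool" where
  "trivial_spinor g \<equiv> square_discriminant (moved_space g) (wall_form Q g)"

text \<open>A relation, because the Gram determinant varies with the basis; by
  \<open>wall_disc_unique\<close> its values for an isometry lie in one class modulo nonzero
  squares.\<close>

definition wall_disc :: "'a^'n^'n \<Rightarrow> 'a \<Rightarrow> bool" where
  "wall_disc g d \<longleftrightarrow> (\<exists>B. basis_of B (moved_space g) \<and> gram_det (wall_form Q g) B = d)"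

lemma wall_disc_exists: "\<exists>d. wall_disc g d"
  using basis_of_exists[OF subspace_moved_space[of g]] by (auto simp: wall_disc_def)

lemma wall_disc_unique:
  assumes "isometry g" "wall_disc g d" "wall_disc g d'"
  shows "\<exists>k. k \<noteq> 0 \<and> d' = k\<^sup>2 * d"
  using assms(2,3) gram_det_basis_change[OF _ _ bilinear_on_wall_form[OF assms(1)]]
  unfolding wall_disc_def by blast

text \<open>As \<open>u\<close> is not orthogonal to the fixed space of \<open>g\<close>, some fixed
  vector \<open>k\<close> pairs nontrivially with it. Adding multiples of \<open>k\<close> adjusts
  preimages without changing their pairing with the moved space of \<open>g\<close>, so the new Gram
  matrix is the old one bordered by \<open>Q u\<close>, with zeros in the rest of the row of
  \<open>u\<close>.\<close>

lemma wall_disc_mult_reflection: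
  assumes g: "isometry g" and u: "Q u \<noteq> 0" "u \<notin> moved_space g" and d: "wall_disc g d"
  shows "wall_disc (g ** reflection u) (Q u * d)"
proof -
  let ?h = "g ** reflection u"
  have h: "isometry ?h" by (rule orthogonal_mult[OF g reflection_orthogonal[OF u(1)]])
  obtain B where B: "basis_of B (moved_space g)" "gram_det (wall_form Q g) B = d"
    using d unfolding wall_disc_def by blast
  note b = basis_of_facts[OF B(1)]
  have "u \<notin> perp (fixed_space g)" using u(2) perp_fixed_space[OF g] by simp
  then obtain k where k: "k v* g = k" "\<beta> k u \<noteq> 0" by (auto simp: perp_def fixed_space_def pol_commute)
  have kV: "\<beta> k v = 0" if "v \<in> moved_space g" for v
    using that k(1) perp_moved_space[OF g] by (auto simp: fixed_space_def perp_def)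
  have happ: "w v* ?h = w v* g - (\<beta> (w v* g) u / Q u) *s u" for w
    by (simp add: reflection_apply flip: vector_matrix_mul_assoc)
  \<comment> \<open>Scaled to \<open>\<beta> k' u = Q u\<close>: then \<open>g\<close> fixes
    \<open>k'\<close> and the reflection subtracts exactly \<open>u\<close>.\<close>
  define k' where "k' = (Q u / \<beta> k u) *s k"
  have k': "u = k' - k' v* ?h"
    using k u(1) by (simp add: happ k'_def vm.scale pol_scale)
  have lift: "\<exists>w'. v = w' - w' v* ?h \<and> (\<forall>y\<in>moved_space g. \<beta> w' y = wall_form Q g v y)"
    if v: "v \<in> moved_space g" for v
  proof -
    obtain w where w: "v = w - w v* g" using v by (auto simp: moved_space_def)
    \<comment> \<open>The multiple of \<open>k\<close> is chosen to make \<open>w' g\<close>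
      orthogonal to \<open>u\<close>, so that the reflection leaves it alone.\<close>
    define w' where "w' = w - (\<beta> (w v* g) u / \<beta> k u) *s k"
    have "\<beta> (w' v* g) u = 0"
      using k by (simp add: w'_def vm.diff vm.scale pol_diff pol_scale)
    then have "v = w' - w' v* ?h"
      unfolding happ by (simp add: w'_def vm.diff vm.scale k w)
    moreover have "\<beta> w' y = wall_form Q g v y" if "y \<in> moved_space g" for y
      using wall_form_eq[OF g that w] kV[OF that] by (simp add: w'_def pol_diff pol_scale)
    ultimately show ?thesis by blast
  qed
  have uh: "u \<in> moved_space ?h" using k' unfolding moved_space_def by blast
  have gh: "moved_space g \<subseteq> moved_space ?h" using lift unfolding moved_space_def by blast
  have "moved_space ?h \<subseteq> vec.span (insert u B)"
  proof
    fix y assume "y \<in> moved_space ?h"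
    then obtain w where w: "y = w - w v* ?h" by (auto simp: moved_space_def)
    have "w - w v* g \<in> vec.span B" unfolding b(6) by (auto simp: moved_space_def)
    then have "w - w v* g \<in> vec.span (insert u B)" using vec.span_mono[of B "insert u B"] by blast
    moreover have "(\<beta> (w v* g) u / Q u) *s u \<in> vec.span (insert u B)"
      by (intro vec.span_scale vec.span_base) simp
    ultimately have "(w - w v* g) + (\<beta> (w v* g) u / Q u) *s u \<in> vec.span (insert u B)"
      by (rule vec.span_add)
    then show "y \<in> vec.span (insert u B)" by (simp add: w happ algebra_simps)
  qed
  moreover have "vec.span (insert u B) \<subseteq> moved_space ?h"
    using uh gh b(2) by (intro vec.span_minimal) auto
  moreover have "vec.independent (insert u B)"
    using u(2) b(5,6) vec.independent_insertI by blast
  ultimately have bas: "basis_of (insert u B) (moved_space ?h)" by (auto simp: basis_of_def)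
  have "u \<notin> B" using u(2) b(2) by blast
  have "gram_det (wall_form Q ?h) (insert u B) = wall_form Q ?h u u * gram_det (wall_form Q ?h) B"
  proof (rule gram_det_insert_row[OF b(1) \<open>u \<notin> B\<close>])
    fix v assume "v \<in> B"
    then have v: "v \<in> moved_space g" using b(2) by blast
    then have "wall_form Q ?h u v = \<beta> k' v" using wall_form_eq[OF h _ k'] gh by blast
    then show "wall_form Q ?h u v = 0" using kV[OF v] by (simp add: k'_def pol_scale)
  qed
  moreover have "gram_det (wall_form Q ?h) B = gram_det (wall_form Q g) B"
  proof (rule gram_det_cong)
    fix v y assume "v \<in> B" "y \<in> B"
    then have v: "v \<in> moved_space g" "y \<in> moved_space g" using b(2) by auto
    obtain w' where w': "v = w' - w' v* ?h" "\<forall>y\<in>moved_space g. \<beta> w' y = wall_form Q g v y"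
      using lift[OF v(1)] by blast
    have "wall_form Q ?h v y = \<beta> w' y" using wall_form_eq[OF h _ w'(1)] gh v(2) by blast
    then show "wall_form Q ?h v y = wall_form Q g v y" using w'(2) v(2) by simp
  qed
  ultimately have "gram_det (wall_form Q ?h) (insert u B) = Q u * d"
    using wall_form_self[OF h uh] B(2) by simp
  then show ?thesis using bas unfolding wall_disc_def by blast
qed

text \<open>If \<open>u = w - w g\<close>, then \<open>\<beta> w u = Q u\<close> and the reflection
  sends \<open>w g = w - u\<close> back to \<open>w\<close>. So \<open>w\<close> is fixed by the
  product without being orthogonal to \<open>u\<close>.\<close>

lemma not_in_moved_space_mult_reflection:
  assumes g: "isometry g" and u: "Q u \<noteq> 0" "u \<in> moved_space g"
  shows "u \<notin> moved_space (g ** reflection u)"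
proof
  let ?h = "g ** reflection u"
  have h: "isometry ?h" by (rule orthogonal_mult[OF g reflection_orthogonal[OF u(1)]])
  assume uh: "u \<in> moved_space ?h"
  obtain w where w: "u = w - w v* g" using u(2) by (auto simp: moved_space_def)
  have wu: "\<beta> w u = Q u" using wall_form_eq[OF g u(2) w] wall_form_self[OF g u(2)] by simp
  have wg: "w v* g = w - u" using w by simp
  have "\<beta> (w - u) u = - Q u" using wu by (simp add: pol_diff pol_self)
  then have "w v* ?h = w"
    using u(1) by (simp add: wg reflection_apply flip: vector_matrix_mul_assoc)
  then have "w \<in> perp (moved_space ?h)" using perp_moved_space[OF h] by (simp add: fixed_space_def)
  then have "\<beta> w u = 0" using uh by (simp add: perp_def)
  then show False using wu u(1) by simp
qed

text \<open>The head of the list is the last factor: consing multiplies on the right, as in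
  \<open>wall_disc_mult_reflection\<close>.\<close>

fun reflections :: "('a^'n) list \<Rightarrow> 'a^'n^'n" where
  "reflections [] = mat 1"
| "reflections (u # us) = reflections us ** reflection u"

lemma reflections_append: "reflections (us @ vs) = reflections vs ** reflections us"
  by (induction us) (simp_all add: matrix_mul_assoc)

lemma reflections_orthogonal: "(\<forall>u\<in>set us. Q u \<noteq> 0) \<Longrightarrow> isometry (reflections us)"
  by (induction us) (simp_all add: orthogonal_one orthogonal_mult reflection_orthogonal)

text \<open>No minimality of the factorization is assumed. If \<open>u\<close> already lies in the
  moved space of the product so far, it leaves the moved space after multiplication, and
  \<open>wall_disc_mult_reflection\<close> is read backwards; dividing by \<open>Q u\<close> or
  multiplying by it is the same modulo squares.\<close>

lemma wall_disc_reflections: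
  "(\<forall>u\<in>set us. Q u \<noteq> 0) \<Longrightarrow> \<exists>k. k \<noteq> 0 \<and> wall_disc (reflections us) (k\<^sup>2 * prod_list (map Q us))"
proof (induction us)
  case Nil
  have "basis_of {} (moved_space (mat 1))" by (simp add: basis_of_def vec.independent_empty)
  then have "wall_disc (mat 1) 1" unfolding wall_disc_def using gram_det_empty by blast
  then show ?case by (intro exI[of _ 1]) simp
next
  case (Cons u us)
  let ?g = "reflections us" and ?P = "prod_list (map Q us)"
  have g: "isometry ?g" using Cons.prems by (intro reflections_orthogonal) simp
  have u: "Q u \<noteq> 0" using Cons.prems by simp
  obtain k where k: "k \<noteq> 0" "wall_disc ?g (k\<^sup>2 * ?P)" using Cons by auto
  show ?case
  proof (cases "u \<in> moved_space ?g")
    case False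
    have "wall_disc (?g ** reflection u) (Q u * (k\<^sup>2 * ?P))"
      by (rule wall_disc_mult_reflection[OF g u False k(2)])
    then show ?thesis using k(1) by (intro exI[of _ k]) (simp add: ac_simps)
  next
    case True
    let ?h = "?g ** reflection u"
    have h: "isometry ?h" by (rule orthogonal_mult[OF g reflection_orthogonal[OF u]])
    have hr: "?h ** reflection u = ?g"
      by (simp add: reflection_involution[OF u] flip: matrix_mul_assoc)
    obtain d where d: "wall_disc ?h d" using wall_disc_exists by blast
    have "wall_disc ?g (Q u * d)"
      using wall_disc_mult_reflection[OF h u not_in_moved_space_mult_reflection[OF g u True] d]
      by (simp add: hr)
    from wall_disc_unique[OF g k(2) this]
    obtain m where m: "m \<noteq> 0" "Q u * d = m\<^sup>2 * (k\<^sup>2 * ?P)" by blast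
    have "d = (m * k / Q u)\<^sup>2 * (Q u * ?P)"
      using m(2) u by (simp add: field_simps power2_eq_square)
    then show ?thesis using d m(1) k(1) u by (intro exI[of _ "m * k / Q u"]) simp
  qed
qed

lemma fixes_span_insert:
  assumes "T \<subseteq> fixed_space g" "v v* g = v"
  shows "vec.span (insert v T) \<subseteq> fixed_space g"
  using assms by (intro vec.span_minimal subspace_fixed_space) (auto simp: fixed_space_def)

text \<open>The nondegenerate subspace \<open>T\<close> fixed by \<open>g\<close> is enlarged by a
  nonsingular \<open>v\<close> orthogonal to it. If \<open>v g - v\<close> is nonsingular, its
  reflection returns \<open>v g\<close> to \<open>v\<close>. Otherwise \<open>v g + v\<close> is
  nonsingular, because the values of \<open>Q\<close> at both add up to \<open>4 Q v\<close>; its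
  reflection sends \<open>v g\<close> to \<open>- v\<close>, and the reflection in \<open>v\<close>
  repairs the sign. All these vectors are orthogonal to \<open>T\<close>, which stays fixed.\<close>

lemma reflections_fixing:
  assumes two: "(2::'a) \<noteq> 0"
  shows "isometry g \<Longrightarrow> vec.subspace T \<Longrightarrow> T \<inter> perp T = {0} \<Longrightarrow> T \<subseteq> fixed_space g \<Longrightarrow>
    \<exists>us. (\<forall>u\<in>set us. Q u \<noteq> 0) \<and> g = reflections us"
proof (induction "vec.dim (perp T)" arbitrary: T g rule: less_induct)
  case less
  note g = less.prems(1) and T = less.prems(2) and nd = less.prems(3) and fT = less.prems(4)
  show ?case
  proof (cases "perp T = {0}")
    case True
    then have "T = perp {0}" using perp_perp[OF T] by simp
    then have "T = UNIV" by (auto simp: perp_def)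
    then have "g = mat 1" using fT unfolding vector_matrix_eq_iff by (auto simp: fixed_space_def)
    then show ?thesis by (intro exI[of _ "[]"]) simp
  next
    case False
    then obtain v0 where v0: "v0 \<in> perp T" "v0 \<noteq> 0"
      using vec.subspace_0[OF subspace_perp[of T]] by blast
    have "perp T \<inter> perp (perp T) = {0}" using perp_perp[OF T] nd by auto
    then obtain v where v: "v \<in> perp T" "Q v \<noteq> 0"
      using nonsingular_vector_exists[OF _ v0 subspace_perp] by blast
    define T' where "T' = vec.span (insert v T)"
    have T': "vec.subspace T'" by (simp add: T'_def vec.subspace_span)
    have vT: "\<beta> v t = 0" "\<beta> t v = 0" if "t \<in> T" for t
      using v(1) that by (auto simp: perp_def pol_commute)
    have T'eq: "\<exists>t\<in>T. \<exists>c. y = t + c *s v" if y: "y \<in> T'" for y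
    proof -
      obtain c where "y - c *s v \<in> vec.span T"
        using y vec.span_breakdown_eq[of y v T] unfolding T'_def by blast
      then have "y - c *s v \<in> T" using T by (metis vec.span_eq_iff)
      then show ?thesis by (intro bexI[of _ "y - c *s v"]) auto
    qed
    have nd': "T' \<inter> perp T' = {0}"
    proof
      show "T' \<inter> perp T' \<subseteq> {0}"
      proof
        fix y assume y: "y \<in> T' \<inter> perp T'"
        obtain t c where t: "t \<in> T" "y = t + c *s v" using T'eq y by blast
        have "\<beta> y v = 0" using y by (auto simp: perp_def T'_def vec.span_base)
        then have "c = 0" using t vT v(2) two by (simp add: pol_add pol_scale pol_self)
        then have "y = t" using t by simp
        moreover have "y \<in> perp T" using y by (auto simp: perp_def T'_def vec.span_base)
        ultimately show "y \<in> {0}" using t nd by blast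
      qed
    qed (use T' in \<open>simp add: vec.subspace_0\<close>)
    have "perp T' = perp (insert v T)" unfolding T'_def by (rule perp_span)
    moreover have "\<beta> v v \<noteq> 0" using v(2) two by (simp add: pol_self)
    ultimately have "perp T' \<subset> perp T" using v(1) unfolding perp_def by blast
    then have lt: "vec.dim (perp T') < vec.dim (perp T)"
      using vec.dim_psubset subspace_perp vec.span_eq_iff by metis
    note IH = less.hyps[OF lt _ T' nd']
    have fixT: "T \<subseteq> fixed_space (a ** reflection u)"
      if "T \<subseteq> fixed_space a" "\<forall>t\<in>T. \<beta> t u = 0" for a u
      using that by (force simp: fixed_space_def reflection_apply simp flip: vector_matrix_mul_assoc)
    let ?v = "v v* g"
    have Qv: "Q ?v = Q v" by (rule orthogonalD(2)[OF g])
    have tv: "\<beta> t ?v = 0" if "t \<in> T" for t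
      using orthogonalD(3)[OF g, of t v] fT that vT(2)[OF that] by (auto simp: fixed_space_def)
    show ?thesis
    proof (cases "Q (?v - v) = 0")
      case False
      let ?u = "?v - v"
      have "\<beta> ?v ?u = Q ?u" by (simp add: pol_diff pol_self Q_diff Qv)
      then have "?v v* reflection ?u = v" using False by (simp add: reflection_apply)
      then have 1: "v v* (g ** reflection ?u) = v" by (simp flip: vector_matrix_mul_assoc)
      have 2: "T \<subseteq> fixed_space (g ** reflection ?u)"
        using fixT[OF fT] tv vT by (simp add: pol_diff)
      have "T' \<subseteq> fixed_space (g ** reflection ?u)"
        unfolding T'_def by (rule fixes_span_insert[OF 2 1])
      from IH[OF orthogonal_mult[OF g reflection_orthogonal[OF False]] this]
      obtain us where us: "\<forall>u\<in>set us. Q u \<noteq> 0" "g ** reflection ?u = reflections us" by blast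
      have "g = g ** (reflection ?u ** reflection ?u)" by (simp add: reflection_involution[OF False])
      also have "\<dots> = reflections (?u # us)" using us(2) by (simp add: matrix_mul_assoc)
      finally show ?thesis using us(1) False by (intro exI[of _ "?u # us"]) auto
    next
      case True
      let ?u = "?v + v"
      have 0: "2 * Q v = \<beta> ?v v" using True by (simp add: Q_diff Qv)
      have Qu: "Q ?u = 2 * (2 * Q v)" unfolding Q_add Qv using 0 by simp
      have u: "Q ?u \<noteq> 0" unfolding Qu using v(2) two by (metis mult_eq_0_iff)
      have "\<beta> ?v ?u = Q ?u" by (simp add: pol_add pol_self Q_add Qv)
      then have r1: "?v v* reflection ?u = - v" using u by (simp add: reflection_apply)
      have r2: "(- v) v* reflection v = v"
      proof -
        have "(- v) v* reflection v = (- v) + 2 *s v" using v(2) by (simp add: reflection_apply pol_self)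
        also have "\<dots> = v" by (simp add: vec_eq_iff)
        finally show ?thesis .
      qed
      let ?a = "g ** reflection ?u ** reflection v"
      have 1: "v v* ?a = v" by (simp add: r1 r2 flip: vector_matrix_mul_assoc)
      have "T \<subseteq> fixed_space (g ** reflection ?u)"
        using fixT[OF fT] tv vT by (simp add: pol_add)
      then have 2: "T \<subseteq> fixed_space ?a" using fixT vT by blast
      have "T' \<subseteq> fixed_space ?a"
        unfolding T'_def by (rule fixes_span_insert[OF 2 1])
      moreover have "isometry ?a"
        by (intro orthogonal_mult g reflection_orthogonal u v(2))
      ultimately obtain us where us: "\<forall>u\<in>set us. Q u \<noteq> 0" "?a = reflections us" using IH by blast
      have "?a ** reflection v ** reflection ?u = g ** reflection ?u ** (reflection v ** reflection v) ** reflection ?u"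
        by (simp add: matrix_mul_assoc)
      also have "\<dots> = g ** (reflection ?u ** reflection ?u)"
        by (simp add: reflection_involution[OF v(2)] matrix_mul_assoc)
      also have "\<dots> = g" by (simp add: reflection_involution[OF u])
      finally have "g = reflections (?u # v # us)" using us(2) by simp
      then show ?thesis using us(1) u v(2) by (intro exI[of _ "?u # v # us"]) auto
    qed
  qed
qed

theorem Cartan_Dieudonne:
  assumes "(2::'a) \<noteq> 0" "isometry g"
  shows "\<exists>us. (\<forall>u\<in>set us. Q u \<noteq> 0) \<and> g = reflections us"
  using reflections_fixing[OF assms, of "{0}"]
  by (simp add: perp_def fixed_space_def vec.subspace_0)

lemma trivial_spinor_reflections:
  assumes us: "\<forall>u\<in>set us. Q u \<noteq> 0" and g: "g = reflections us"
  shows "trivial_spinor g \<longleftrightarrow> (\<exists>c. prod_list (map Q us) = c\<^sup>2)"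
proof -
  let ?P = "prod_list (map Q us)"
  have gO: "isometry g" unfolding g by (rule reflections_orthogonal[OF us])
  have P: "?P \<noteq> 0" using us by (induction us) auto
  obtain k where k: "k \<noteq> 0" "wall_disc g (k\<^sup>2 * ?P)" using wall_disc_reflections[OF us] g by blast
  have "trivial_spinor g \<longleftrightarrow> (\<exists>c. c \<noteq> 0 \<and> wall_disc g (c\<^sup>2))"
    unfolding square_discriminant_def wall_disc_def by blast
  also have "\<dots> \<longleftrightarrow> (\<exists>c. ?P = c\<^sup>2)"
  proof
    assume "\<exists>c. c \<noteq> 0 \<and> wall_disc g (c\<^sup>2)"
    then obtain c where c: "wall_disc g (c\<^sup>2)" by blast
    obtain m where m: "m \<noteq> 0" "c\<^sup>2 = m\<^sup>2 * (k\<^sup>2 * ?P)" using wall_disc_unique[OF gO k(2) c] by blast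
    then have "?P = (c / (m * k))\<^sup>2" using k(1) by (simp add: field_simps power2_eq_square)
    then show "\<exists>c. ?P = c\<^sup>2" by blast
  next
    assume "\<exists>c. ?P = c\<^sup>2"
    then obtain c where c: "?P = c\<^sup>2" by blast
    then have "c \<noteq> 0" using P by auto
    have "wall_disc g ((k * c)\<^sup>2)" using k(2) c by (simp add: power_mult_distrib)
    then show "\<exists>c. c \<noteq> 0 \<and> wall_disc g (c\<^sup>2)" using k(1) \<open>c \<noteq> 0\<close> by (intro exI[of _ "k * c"]) simp
  qed
  finally show ?thesis .
qed

text \<open>Serves to bring an element outside \<open>\<Omega>\<close> back into it by means of a
  centralizing element outside \<open>\<Omega>\<close>.\<close>

lemma trivial_spinor_mult:
  assumes two: "(2::'a) \<noteq> 0"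
    and g: "isometry g" "\<not> trivial_spinor g"
    and h: "isometry h" "\<not> trivial_spinor h"
  shows "trivial_spinor (g ** h)"
proof -
  obtain us where us: "\<forall>u\<in>set us. Q u \<noteq> 0" "g = reflections us"
    using Cartan_Dieudonne[OF two g(1)] by blast
  obtain vs where vs: "\<forall>u\<in>set vs. Q u \<noteq> 0" "h = reflections vs"
    using Cartan_Dieudonne[OF two h(1)] by blast
  have "\<exists>c. prod_list (map Q us) * prod_list (map Q vs) = c\<^sup>2"
    using square_mult_nonsquares[OF two] g(2) h(2)
    unfolding trivial_spinor_reflections[OF us] trivial_spinor_reflections[OF vs] by blast
  then have "\<exists>c. prod_list (map Q (vs @ us)) = c\<^sup>2" by (simp add: mult.commute)
  moreover have "g ** h = reflections (vs @ us)" using us vs by (simp add: reflections_append)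
  ultimately show ?thesis
    using trivial_spinor_reflections[of "vs @ us" "g ** h"] us(1) vs(1) by auto
qed

end

section \<open>Isometries with prescribed spinor norm\<close>

text \<open>For use when \<open>A + B\<close> is a proper subspace: there \<open>P\<close> is only
  prescribed on the sum and may be anything elsewhere.\<close>

lemma projection_exists:
  fixes A B :: "('a::field^'n) set"
  assumes A: "vec.subspace A" and B: "vec.subspace B" and AB: "A \<inter> B = {0}"
  shows "\<exists>P. \<forall>a\<in>A. \<forall>b\<in>B. P (a + b) = a"
proof (intro exI ballI)
  fix a b assume a: "a \<in> A" and b: "b \<in> B"
  let ?P = "\<lambda>w. SOME a. a \<in> A \<and> w - a \<in> B"
  have "a \<in> A \<and> (a + b) - a \<in> B" using a b by simp
  then have *: "?P (a + b) \<in> A \<and> (a + b) - ?P (a + b) \<in> B" by (rule someI)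
  then have "a - ?P (a + b) \<in> A" using vec.subspace_diff[OF A a] by blast
  moreover have "a - ?P (a + b) \<in> B"
    using vec.subspace_diff[OF B, of "(a + b) - ?P (a + b)" b] * b by (simp add: algebra_simps)
  ultimately have "a - ?P (a + b) = 0" using AB by blast
  then show "?P (a + b) = a" by simp
qed

lemma linear_projection_exists:
  fixes A B :: "('a::field^'n) set"
  assumes A: "vec.subspace A" and B: "vec.subspace B" and AB: "A \<inter> B = {0}"
    and dec: "\<And>v. \<exists>a\<in>A. \<exists>b\<in>B. v = a + b"
  shows "\<exists>P. Vector_Spaces.linear (*s) (*s) P \<and> (\<forall>v. P v \<in> A \<and> v - P v \<in> B) \<and>
    (\<forall>v. \<forall>a\<in>A. v - a \<in> B \<longrightarrow> P v = a)"
proof -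
  obtain P where P: "\<And>a b. a \<in> A \<Longrightarrow> b \<in> B \<Longrightarrow> P (a + b) = a"
    using projection_exists[OF A B AB] by blast
  have Pu: "P v = a" if "a \<in> A" "v - a \<in> B" for v a using P[OF that] by simp
  have in_AB: "P v \<in> A" "v - P v \<in> B" for v
  proof -
    obtain a b where "a \<in> A" "b \<in> B" "v = a + b" using dec by blast
    then show "P v \<in> A" "v - P v \<in> B" using P by simp_all
  qed
  have "P (u + v) = P u + P v" for u v
  proof (rule Pu)
    show "P u + P v \<in> A" using in_AB A vec.subspace_add by blast
    have "(u - P u) + (v - P v) \<in> B" using in_AB B vec.subspace_add by blast
    then show "u + v - (P u + P v) \<in> B" by (simp add: algebra_simps)
  qed
  moreover have "P (c *s v) = c *s P v" for c v
  proof (rule Pu)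
    show "c *s P v \<in> A" using in_AB A vec.subspace_scale by blast
    have "c *s (v - P v) \<in> B" using in_AB B vec.subspace_scale by blast
    then show "c *s v - c *s P v \<in> B" by (simp add: vec.scale_right_diff_distrib)
  qed
  ultimately have "Vector_Spaces.linear (*s) (*s) P" by unfold_locales auto
  then show ?thesis using in_AB Pu by blast
qed

lemma injective_linear_surj_on:
  fixes f :: "'a::{field,finite}^'n \<Rightarrow> 'a^'n"
  assumes W: "vec.subspace W" and f: "\<And>w. w \<in> W \<Longrightarrow> f w \<in> W"
    and diff: "\<And>u v. u \<in> W \<Longrightarrow> v \<in> W \<Longrightarrow> f (u - v) = f u - f v"
    and inj: "\<And>w. w \<in> W \<Longrightarrow> f w = 0 \<Longrightarrow> w = 0"
  shows "f ` W = W"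
proof (rule endo_inj_surj)
  show "inj_on f W"
  proof (rule inj_onI)
    fix u v assume uv: "u \<in> W" "v \<in> W" "f u = f v"
    then have "f (u - v) = 0" using diff by simp
    then have "u - v = 0" using inj vec.subspace_diff[OF W] uv by blast
    then show "u = v" by simp
  qed
qed (use f in auto)

lemma injective_gram_det_nonzero:
  fixes g :: "'a::{field,finite}^'n \<Rightarrow> 'a^'n"
  assumes B: "basis_of B W" and surj: "g ` W = W"
    and add: "\<And>u v. u \<in> W \<Longrightarrow> v \<in> W \<Longrightarrow> g (u + v) = g u + g v"
    and scale: "\<And>c u. u \<in> W \<Longrightarrow> g (c *s u) = c *s g u"
    and M: "\<And>e. e \<in> B \<Longrightarrow> g e = (\<Sum>b\<in>B. M e b *s b)"
  shows "gram_det M B \<noteq> 0"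
proof -
  note b = basis_of_facts[OF B]
  have lin: "g (\<Sum>k\<in>A. c k *s k) = (\<Sum>k\<in>A. c k *s g k)" if "A \<subseteq> B" for A c
  proof -
    have "finite A" using that b(1) finite_subset by blast
    then show ?thesis using that
    proof (induction A rule: finite_induct)
      case empty
      show ?case using scale[of 0 0] vec.subspace_0[OF b(3)] by simp
    next
      case (insert a A)
      have "a \<in> W" "c a *s a \<in> W" "(\<Sum>k\<in>A. c k *s k) \<in> W"
        using insert.prems b(2,3) by (auto intro!: vec.subspace_scale vec.subspace_sum)
      then show ?case using insert by (simp add: add scale)
    qed
  qed
  have "\<exists>c. e = (\<Sum>k\<in>B. c k *s g k)" if e: "e \<in> B" for e
  proof -
    obtain y where y: "y \<in> W" "e = g y" using e b(2) surj by blast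
    obtain c where "y = (\<Sum>k\<in>B. c k *s k)" using basis_of_expansion[OF B y(1)] by blast
    then show ?thesis using lin[of B c] y by auto
  qed
  then obtain R where R: "\<And>e. e \<in> B \<Longrightarrow> e = (\<Sum>k\<in>B. R e k *s g k)" by metis
  have "gram_det R B * gram_det M B = 1"
  proof (rule gram_det_left_inverse[OF B])
    fix e assume e: "e \<in> B"
    have "(\<Sum>k\<in>B. R e k *s (\<Sum>b\<in>B. M k b *s b)) = (\<Sum>k\<in>B. R e k *s g k)"
      using M by (intro sum.cong) auto
    then show "e = (\<Sum>k\<in>B. R e k *s (\<Sum>b\<in>B. M k b *s b))" using R[OF e] by (rule trans[OF _ sym, symmetric])
  qed
  then show ?thesis by auto
qed

text \<open>A symplectic basis has Gram determinant 1, and changing to \<open>B\<close> multiplies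
  it by a nonzero square.\<close>

lemma alternating_gram_det_square:
  fixes f :: "'a::{field,finite}^'n \<Rightarrow> 'a^'n \<Rightarrow> 'a"
  assumes B: "basis_of B W" and f: "bilinear_on W f" "\<forall>u\<in>W. f u u = 0"
    and nd: "\<forall>u\<in>W. (\<forall>v\<in>W. f u v = 0) \<longrightarrow> u = 0"
  shows "\<exists>k. k \<noteq> 0 \<and> gram_det f B = k\<^sup>2"
proof -
  obtain B' where "basis_of B' W" "gram_det f B' = 1"
    using alternating_symplectic_basis[OF f(1) basis_of_facts(3)[OF B] f(2) nd] by blast
  then show ?thesis using gram_det_basis_change[OF _ B f(1), of B'] by auto
qed

definition invariant :: "'a::field^'n^'n \<Rightarrow> ('a^'n) set \<Rightarrow> bool" where
  "invariant x U \<longleftrightarrow> vec.subspace U \<and> (\<forall>u\<in>U. u v* x \<in> U)"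

context nonsing_form
begin

lemma Int_perp_zeroI:
  assumes "vec.subspace W" "\<And>w. w \<in> W \<Longrightarrow> (\<And>u. u \<in> W \<Longrightarrow> \<beta> w u = 0) \<Longrightarrow> w = 0"
  shows "W \<inter> perp W = {0}"
  using assms vec.subspace_0[OF assms(1)] by (auto simp: perp_def)

lemma orthogonalI_pol:
  assumes "(2::'a) \<noteq> 0" "\<And>v. \<beta> (v v* g) (v v* g) = \<beta> v v"
  shows "isometry g"
  using assms by (intro orthogonalI) (simp add: pol_self)

lemma decompose_perp:
  assumes W: "vec.subspace W" and nd: "W \<inter> perp W = {0}"
  shows "\<exists>w\<in>W. \<exists>p\<in>perp W. v = w + p"
proof -
  let ?S = "{x + y |x y. x \<in> W \<and> y \<in> perp W}"
  have "vec.dim ?S = CARD('n)"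
    using vec.dim_sums_Int[OF W subspace_perp[of W]] dim_perp[OF W] nd by simp
  then have "vec.dim (UNIV :: ('a^'n) set) \<le> vec.dim ?S" by (simp add: vec.dim_UNIV card_cart_basis)
  then have "?S = UNIV"
    by (intro vec.subspace_dim_equal vec.subspace_sums[OF W subspace_perp[of W]] vec.subspace_UNIV) auto
  then have "v \<in> ?S" by simp
  then show ?thesis by blast
qed

text \<open>With \<open>J\<close> the Gram matrix of \<open>\<beta>\<close> in the standard basis,
  adjointness reads \<open>A J = J A'\<^sup>T\<close>, where \<open>T\<close> denotes the transpose,
  and \<open>J\<close> is invertible.\<close>

lemma det_adjoint:
  assumes adj: "\<And>u v. \<beta> (u v* A) v = \<beta> u (v v* A')"
  shows "det A = det A'"
proof -
  define J where "J = (\<chi> i j. \<beta> (axis i 1) (axis j 1))"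
  have exp: "v = (\<Sum>i\<in>UNIV. v $ i *s axis i 1)" for v :: "'a^'n"
    by (simp add: basis_expansion)
  have J: "(v v* J) $ j = \<beta> v (axis j 1)" for v j
  proof -
    have "\<beta> v (axis j 1) = \<beta> (\<Sum>i\<in>UNIV. v $ i *s axis i 1) (axis j 1)"
      using exp[of v] by simp
    also have "\<dots> = (\<Sum>i\<in>UNIV. v $ i * \<beta> (axis i 1) (axis j 1))"
      by (rule bilinear_on_sum(1)[of UNIV]) (auto simp: vec.subspace_UNIV)
    finally show ?thesis by (simp add: J_def vector_matrix_mult_def mult.commute)
  qed
  have "v = 0" if "v v* J = 0" for v
  proof (rule pol_nondeg)
    fix w
    have "\<beta> v w = \<beta> v (\<Sum>i\<in>UNIV. w $ i *s axis i 1)" using exp[of w] by simp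
    also have "\<dots> = (\<Sum>i\<in>UNIV. w $ i * \<beta> v (axis i 1))"
      by (rule bilinear_on_sum(2)[of UNIV]) (auto simp: vec.subspace_UNIV)
    also have "\<dots> = 0" using J[of v] that by simp
    finally show "\<beta> v w = 0" .
  qed
  then have dJ: "det J \<noteq> 0" using invertible_iff_kernel invertible_det_nz by blast
  have "A ** J = J ** Finite_Cartesian_Product.transpose A'"
    unfolding vector_matrix_eq_iff
  proof
    fix v
    have "(v v* (A ** J)) $ j = (v v* (J ** Finite_Cartesian_Product.transpose A')) $ j" for j
    proof -
      have "(v v* (A ** J)) $ j = \<beta> v (axis j 1 v* A')"
        by (simp add: J adj flip: vector_matrix_mul_assoc)
      also have "\<dots> = \<beta> v (\<Sum>k\<in>UNIV. A' $ j $ k *s axis k 1)"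
      proof -
        have "axis j 1 v* A' = A' $ j"
          by (simp add: vec_eq_iff vector_matrix_mult_def axis_def if_distrib[of "\<lambda>c. c * _"] if_distrib[of "\<lambda>c. _ * c"]
                cong: if_cong)
        then show ?thesis using exp[of "A' $ j"] by simp
      qed
      also have "\<dots> = (\<Sum>k\<in>UNIV. A' $ j $ k * \<beta> v (axis k 1))"
        by (rule bilinear_on_sum(2)[of UNIV]) (auto simp: vec.subspace_UNIV)
      also have "\<dots> = (v v* (J ** Finite_Cartesian_Product.transpose A')) $ j"
        by (simp add: J matrix_vector_mult_def flip: vector_matrix_mul_assoc)
      finally show ?thesis .
    qed
    then show "v v* (A ** J) = v v* (J ** Finite_Cartesian_Product.transpose A')"
      by (simp add: vec_eq_iff)
  qed
  then have "det A * det J = det J * det A'" by (metis det_mul Determinants.det_transpose)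
  then show ?thesis using dJ by simp
qed

lemma invariant_inverse:
  fixes x :: "'a^'n^'n"
  assumes "invariant x U" "x' ** x = mat 1" "x ** x' = mat 1" "u \<in> U"
  shows "u v* x' \<in> U"
proof -
  have "(\<lambda>w. w v* x) ` U = U"
  proof (rule injective_linear_surj_on)
    fix w assume "w v* x = 0"
    then have "w v* x v* x' = 0" by simp
    then show "w = 0" by (simp add: vector_matrix_mul_assoc assms(3))
  qed (use assms(1) in \<open>auto simp: invariant_def vm.diff\<close>)
  then obtain w where "w \<in> U" "u = w v* x" using assms(4) by blast
  then show ?thesis by (simp add: vector_matrix_mul_assoc assms(3))
qed

lemma invariant_perp:
  assumes x: "isometry x" and W: "invariant x W"
  shows "invariant x (perp W)"
proof -
  obtain x' where x': "x' ** x = mat 1" "x ** x' = mat 1" using orthogonal_obtain_inverse[OF x] by metis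
  have "\<beta> (v v* x) w = 0" if "v \<in> perp W" "w \<in> W" for v w
    using orthogonalD(3)[OF x, of v "w v* x'"] invariant_inverse[OF W x' that(2)] that(1)
    by (simp add: perp_def vector_matrix_mul_assoc x')
  then show ?thesis by (simp add: invariant_def) (simp add: perp_def)
qed

abbreviation nontrivial_spinor_centralizer :: "'a^'n^'n \<Rightarrow> bool" where
  "nontrivial_spinor_centralizer x \<equiv>
    \<exists>c\<in>special_orthogonal_group Q. c ** x = x ** c \<and> \<not> trivial_spinor c"

text \<open>
  Let \<open>b\<close> be an operator on \<open>W\<close> commuting with its adjoint \<open>b'\<close>.  Then \<open>c = b b'\<^sup>-\<^sup>1\<close> is an isometry
  of \<open>W\<close>, and its Wall form \<open>\<chi>\<close> satisfies \<open>\<chi> ((b' - b) u, v) = \<beta> (b' u, v) = \<beta> (u, b v)\<close>.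
  As \<open>\<beta> ((b' - b) u, v)\<close> is alternating, the discriminant of \<open>\<chi>\<close> is that of \<open>b\<close> up to squares.
\<close>

lemma commuting_adjoint_centralizer:
  fixes b b' :: "'a^'n \<Rightarrow> 'a^'n"
  assumes two: "(2::'a) \<noteq> 0" and x: "isometry x"
    and B: "basis_of B W" and nd: "W \<inter> perp W = {0}"
    and xW: "invariant x W"
    and bW: "\<And>w. w \<in> W \<Longrightarrow> b w \<in> W" "\<And>w. w \<in> W \<Longrightarrow> b' w \<in> W"
    and b_add: "\<And>u v. u \<in> W \<Longrightarrow> v \<in> W \<Longrightarrow> b (u + v) = b u + b v"
      "\<And>u v. u \<in> W \<Longrightarrow> v \<in> W \<Longrightarrow> b' (u + v) = b' u + b' v"
    and b_scale: "\<And>c u. u \<in> W \<Longrightarrow> b (c *s u) = c *s b u" "\<And>c u. u \<in> W \<Longrightarrow> b' (c *s u) = c *s b' u"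
    and adj: "\<And>u v. u \<in> W \<Longrightarrow> v \<in> W \<Longrightarrow> \<beta> (b u) v = \<beta> u (b' v)"
    and comm: "\<And>w. w \<in> W \<Longrightarrow> b (b' w) = b' (b w)"
    and bx: "\<And>w. w \<in> W \<Longrightarrow> b (w v* x) = b w v* x" "\<And>w. w \<in> W \<Longrightarrow> b' (w v* x) = b' w v* x"
    and inj: "\<And>w. w \<in> W \<Longrightarrow> b w = 0 \<Longrightarrow> w = 0" "\<And>w. w \<in> W \<Longrightarrow> b w = b' w \<Longrightarrow> w = 0"
    and M: "\<And>e. e \<in> B \<Longrightarrow> b e = (\<Sum>k\<in>B. M e k *s k)" and nonsq: "\<nexists>c. gram_det M B = c\<^sup>2"
  shows "nontrivial_spinor_centralizer x"
proof -
  note bas = basis_of_facts[OF B]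
  note W = bas(3)
  have W0: "0 \<in> W" by (rule vec.subspace_0[OF W])
  have b_minus: "b (- u) = - b u" "b' (- u) = - b' u" if "u \<in> W" for u
    using b_scale[OF that, of "- 1"] by simp_all
  have b_diff: "b (u - v) = b u - b v" "b' (u - v) = b' u - b' v" if "u \<in> W" "v \<in> W" for u v
    using b_add[of u "- v"] b_minus[of v] that vec.subspace_neg[OF W] by simp_all
  have b0: "b 0 = 0" "b' 0 = 0" using b_scale[OF W0, of 0] by simp_all
  have bsurj: "b ` W = W" by (rule injective_linear_surj_on[OF W bW(1) b_diff(1) inj(1)])
  have inj': "w = 0" if w: "w \<in> W" "b' w = 0" for w
  proof -
    have "\<beta> w u = 0" if u: "u \<in> W" for u
    proof -
      obtain y where "y \<in> W" "u = b y" using u bsurj by blast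
      then show ?thesis using adj[of y w] w by (simp add: pol_commute[of w])
    qed
    then have "w \<in> perp W" by (simp add: perp_def)
    then show ?thesis using w nd by blast
  qed
  obtain P where lP: "Vector_Spaces.linear (*s) (*s) P" and dec: "\<forall>v. P v \<in> W \<and> v - P v \<in> perp W"
      and P: "\<forall>v. \<forall>w\<in>W. v - w \<in> perp W \<longrightarrow> P v = w"
    using linear_projection_exists[OF W subspace_perp nd decompose_perp[OF W nd]] by blast
  interpret P: Vector_Spaces.linear "(*s)" "(*s)" P by (rule lP)
  have PinW: "P v \<in> W" and PinP: "v - P v \<in> perp W" for v using dec by blast+
  have Pu: "P v = w" if "w \<in> W" "v - w \<in> perp W" for v w using P that by blast
  have PW: "P w = w" if "w \<in> W" for w
    using Pu[OF that, of w] vec.subspace_0[OF subspace_perp] by simp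
  have Px: "P (v v* x) = P v v* x" for v
  proof (rule Pu)
    show "P v v* x \<in> W" using xW PinW by (simp add: invariant_def)
    show "v v* x - P v v* x \<in> perp W"
      using invariant_perp[OF x xW] PinP[of v] by (simp add: invariant_def flip: vm.diff)
  qed
  \<comment> \<open>Extension by the identity on \<open>perp W\<close>, so that the resulting
    isometry moves nothing outside \<open>W\<close>.\<close>
  define ext where "ext a v = a (P v) + (v - P v)" for a :: "'a^'n \<Rightarrow> 'a^'n" and v
  have lin: "Vector_Spaces.linear (*s) (*s) (ext a)"
    if "\<And>u v. u \<in> W \<Longrightarrow> v \<in> W \<Longrightarrow> a (u + v) = a u + a v" "\<And>c u. u \<in> W \<Longrightarrow> a (c *s u) = c *s a u" for a
    by unfold_locales
      (auto simp: ext_def P.add P.scale that[OF PinW] that(1)[OF PinW PinW] vec_eq_iff algebra_simps)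
  obtain Bm where Bm: "\<And>v. ext b v = v v* Bm"
    using linear_eq_vector_matrix[OF lin[of b]] b_add(1) b_scale(1) by blast
  obtain Bm' where Bm': "\<And>v. ext b' v = v v* Bm'"
    using linear_eq_vector_matrix[OF lin[of b']] b_add(2) b_scale(2) by blast
  have Pext: "P (ext a v) = a (P v)" if "\<And>w. w \<in> W \<Longrightarrow> a w \<in> W" for a v
    by (rule Pu) (use that[OF PinW] PinP in \<open>auto simp: ext_def\<close>)
  have ext_comm: "ext b (ext b' v) = ext b' (ext b v)" for v
    using Pext[of b v] Pext[of b' v] bW comm[OF PinW] by (simp add: ext_def)
  have pol_split: "\<beta> u v = \<beta> (P u) (P v) + \<beta> (u - P u) (v - P v)" for u v
  proof -
    have "\<beta> (P u) (v - P v) = 0" "\<beta> (u - P u) (P v) = 0"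
      using PinW PinP pol_commute unfolding perp_def by (metis (mono_tags, lifting) mem_Collect_eq)+
    moreover have "\<beta> u v = \<beta> (P u + (u - P u)) (P v + (v - P v))" by simp
    ultimately show ?thesis by (simp only: pol_add) simp
  qed
  have ext_adj: "\<beta> (ext b u) v = \<beta> u (ext b' v)" for u v
  proof -
    have "ext b u - P (ext b u) = u - P u" "ext b' v - P (ext b' v) = v - P v"
      using Pext[of b u] Pext[of b' v] bW by (simp_all add: ext_def)
    then show ?thesis
      using pol_split[of "ext b u" v] pol_split[of u "ext b' v"] Pext[of b u] Pext[of b' v] bW
        adj[OF PinW PinW, of u v] by simp
  qed
  have ext_x: "ext a (v v* x) = ext a v v* x" if "\<And>w. w \<in> W \<Longrightarrow> a (w v* x) = a w v* x" for a v
    by (simp add: ext_def Px that[OF PinW] vm.add vm.diff)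
  have "v = 0" if "v v* Bm' = 0" for v
  proof -
    have 0: "ext b' v = 0" using that by (simp add: Bm')
    then have "b' (P v) = 0" using Pext[of b' v] bW PW[OF W0] by simp
    then have "P v = 0" by (rule inj'[OF PinW])
    then show "v = 0" using 0 b0 by (simp add: ext_def)
  qed
  then have "invertible Bm'" by (simp add: invertible_iff_kernel)
  then obtain C where C1: "Bm' ** C = mat 1" and C2: "C ** Bm' = mat 1" by (auto simp: invertible_def)
  define c where "c = Bm ** C"
  have BmC: "Bm' ** Bm = Bm ** Bm'"
    unfolding vector_matrix_eq_iff using ext_comm by (simp add: Bm Bm' flip: vector_matrix_mul_assoc)
  have capp: "(v v* Bm') v* c = v v* Bm" for v
  proof -
    have "Bm' ** c = Bm ** (Bm' ** C)" by (simp add: c_def matrix_mul_assoc BmC)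
    then show ?thesis by (simp add: vector_matrix_mul_assoc C1)
  qed
  have cinv: "v = (v v* C) v* Bm'" for v by (simp add: vector_matrix_mul_assoc C2)
  have cO: "isometry c"
  proof (rule orthogonalI_pol[OF two])
    fix v
    let ?y = "v v* C"
    have "\<beta> (v v* c) (v v* c) = \<beta> (?y v* Bm) (?y v* Bm)" using capp[of ?y] cinv[of v] by simp
    also have "\<dots> = \<beta> ?y (?y v* Bm v* Bm')" using ext_adj[of ?y "?y v* Bm"] by (simp add: Bm Bm')
    also have "?y v* Bm v* Bm' = ?y v* Bm' v* Bm" by (metis vector_matrix_mul_assoc BmC)
    also have "\<beta> ?y (?y v* Bm' v* Bm) = \<beta> (?y v* Bm') (?y v* Bm')"
      using ext_adj[of "?y v* Bm'" ?y] by (simp add: Bm Bm' pol_commute)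
    finally show "\<beta> (v v* c) (v v* c) = \<beta> v v" using cinv[of v] by simp
  qed
  have "det Bm = det Bm'" by (rule det_adjoint) (use ext_adj in \<open>simp add: Bm Bm'\<close>)
  then have "det c = det (Bm' ** C)" by (simp add: c_def det_mul)
  then have cSO: "c \<in> special_orthogonal_group Q"
    using cO by (simp add: special_orthogonal_group_def C1)
  have xBm: "Bm ** x = x ** Bm" "Bm' ** x = x ** Bm'"
    unfolding vector_matrix_eq_iff using ext_x[of b] ext_x[of b'] bx
    by (simp_all add: Bm Bm' flip: vector_matrix_mul_assoc)
  have "C ** x = C ** x ** (Bm' ** C)" by (simp add: C1)
  also have "\<dots> = C ** (Bm' ** x) ** C" by (simp add: xBm matrix_mul_assoc)
  also have "\<dots> = x ** C" by (simp add: matrix_mul_assoc C2)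
  finally have "C ** x = x ** C" .
  then have cx: "c ** x = x ** c"
    unfolding c_def by (metis matrix_mul_assoc xBm(1))
  define \<sigma> where "\<sigma> w = b' w - b w" for w
  have \<sigma>W: "\<sigma> w \<in> W" if "w \<in> W" for w
    unfolding \<sigma>_def using bW that W vec.subspace_diff by blast
  have \<sigma>_inj: "w = 0" if "w \<in> W" "\<sigma> w = 0" for w
    using inj(2)[OF that(1)] that(2) by (simp add: \<sigma>_def)
  have \<sigma>surj: "\<sigma> ` W = W"
    by (rule injective_linear_surj_on[OF W \<sigma>W _ \<sigma>_inj]) (auto simp: \<sigma>_def b_diff)
  \<comment> \<open>Preimages under \<open>1 - c\<close> are written in the form
    \<open>v b'\<close>; this expresses the moved space through \<open>\<sigma> = b' - b\<close>
    with no inverse of \<open>b'\<close>.\<close>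
  have mv: "v v* Bm' - (v v* Bm') v* c = \<sigma> (P v)" for v
    unfolding capp by (simp add: ext_def \<sigma>_def flip: Bm Bm')
  have Vc: "moved_space c = W"
  proof
    show "moved_space c \<subseteq> W"
    proof
      fix y assume "y \<in> moved_space c"
      then obtain w where "y = w - w v* c" by (auto simp: moved_space_def)
      then have "y = \<sigma> (P (w v* C))" using mv[of "w v* C"] cinv[of w] by simp
      then show "y \<in> W" using \<sigma>W PinW by simp
    qed
    show "W \<subseteq> moved_space c"
    proof
      fix y assume "y \<in> W"
      then obtain w where "w \<in> W" "y = \<sigma> w" using \<sigma>surj by blast
      then have "y = w v* Bm' - (w v* Bm') v* c" using mv[of w] PW by simp
      then show "y \<in> moved_space c" unfolding moved_space_def by blast
    qed
  qed
  have wall: "wall_form Q c (\<sigma> u) v = \<beta> (b' u) v" if "u \<in> W" "v \<in> W" for u v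
  proof -
    have "\<sigma> u = u v* Bm' - (u v* Bm') v* c" using mv[of u] PW that by simp
    from wall_form_eq[OF cO _ this] have "wall_form Q c (\<sigma> u) v = \<beta> (u v* Bm') v"
      using that Vc by simp
    also have "u v* Bm' = b' u" using PW[OF that(1)] by (simp add: ext_def flip: Bm')
    finally show ?thesis .
  qed
  obtain S where S: "\<And>e. e \<in> B \<Longrightarrow> \<sigma> e = (\<Sum>k\<in>B. S e k *s k)"
    using basis_matrix[OF B, of B \<sigma>] \<sigma>W bas(2) by blast
  let ?G = "gram_det (wall_form Q c) B" and ?J = "gram_det \<beta> B"
  \<comment> \<open>The determinant of \<open>\<sigma>\<close> is compared with both forms: times
    the Wall discriminant \<open>?G\<close> it gives \<open>?J * gram_det M B\<close>, times
    \<open>?J\<close> it gives a square. Eliminating \<open>?J\<close> shows that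
    \<open>gram_det M B\<close> and \<open>?G\<close> agree modulo squares.\<close>
  have "gram_det S B * ?G = gram_det (\<lambda>e f. \<Sum>k\<in>B. S e k * wall_form Q c k f) B"
    by (simp add: gram_det_mult)
  also have "\<dots> = gram_det (\<lambda>e f. \<Sum>k\<in>B. \<beta> e k * M f k) B"
  proof (rule gram_det_cong)
    fix e f assume ef: "e \<in> B" "f \<in> B"
    then have efW: "e \<in> W" "f \<in> W" using bas(2) by auto
    have "(\<Sum>k\<in>B. S e k * wall_form Q c k f) = wall_form Q c (\<Sum>k\<in>B. S e k *s k) f"
      by (rule bilinear_on_sum(1)[OF bilinear_on_wall_form[OF cO, unfolded Vc] W _ efW(2) bas(1),
            where g="\<lambda>k. k", symmetric]) (use bas(2) in blast)
    also have "\<dots> = \<beta> (b' e) f" using wall[OF efW] S[OF ef(1)] by simp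
    also have "\<dots> = \<beta> e (b f)" using adj[OF efW(2,1)] by (simp add: pol_commute)
    also have "\<dots> = \<beta> e (\<Sum>k\<in>B. M f k *s k)" using M[OF ef(2)] by simp
    also have "\<dots> = (\<Sum>k\<in>B. M f k * \<beta> e k)"
      by (rule bilinear_on_sum(2)[OF bilinear_on_pol W _ efW(1) bas(1), where g="\<lambda>k. k"])
        (use bas(2) in blast)
    finally show "(\<Sum>k\<in>B. S e k * wall_form Q c k f) = (\<Sum>k\<in>B. \<beta> e k * M f k)"
      by (simp add: mult.commute)
  qed
  also have "\<dots> = ?J * gram_det M B"
    using gram_det_mult[of \<beta> "\<lambda>k f. M f k" B] gram_det_transpose[OF bas(1), of M] by simp
  finally have 1: "gram_det S B * ?G = ?J * gram_det M B" .
  have "gram_det S B * ?J = gram_det (\<lambda>e f. \<beta> (\<sigma> e) f) B"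
  proof -
    have "gram_det S B * ?J = gram_det (\<lambda>e f. \<Sum>k\<in>B. S e k * \<beta> k f) B" by (simp add: gram_det_mult)
    also have "\<dots> = gram_det (\<lambda>e f. \<beta> (\<sigma> e) f) B"
    proof (rule gram_det_cong)
      fix e f assume ef: "e \<in> B" "f \<in> B"
      then have "f \<in> W" using bas(2) by blast
      have "\<beta> (\<Sum>k\<in>B. S e k *s k) f = (\<Sum>k\<in>B. S e k * \<beta> k f)"
        by (rule bilinear_on_sum(1)[OF bilinear_on_pol W _ \<open>f \<in> W\<close> bas(1), where g="\<lambda>k. k"])
          (use bas(2) in blast)
      then show "(\<Sum>k\<in>B. S e k * \<beta> k f) = \<beta> (\<sigma> e) f" using S[OF ef(1)] by simp
    qed
    finally show ?thesis .
  qed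
  moreover have "\<exists>k. k \<noteq> 0 \<and> gram_det (\<lambda>e f. \<beta> (\<sigma> e) f) B = k\<^sup>2"
  proof (rule alternating_gram_det_square[OF B])
    show "bilinear_on W (\<lambda>e f. \<beta> (\<sigma> e) f)"
      by (simp add: bilinear_on_def \<sigma>_def b_add b_scale pol_add pol_diff pol_scale algebra_simps)
    show "\<forall>u\<in>W. \<beta> (\<sigma> u) u = 0"
      using adj by (simp add: \<sigma>_def pol_diff) (metis pol_commute)
    show "\<forall>u\<in>W. (\<forall>v\<in>W. \<beta> (\<sigma> u) v = 0) \<longrightarrow> u = 0"
    proof (intro ballI impI)
      fix u assume u: "u \<in> W" "\<forall>v\<in>W. \<beta> (\<sigma> u) v = 0"
      then have "\<sigma> u \<in> W \<inter> perp W" using \<sigma>W by (simp add: perp_def)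
      then show "u = 0" using nd \<sigma>_inj[OF u(1)] by blast
    qed
  qed
  ultimately obtain k where k: "k \<noteq> 0" "gram_det S B * ?J = k\<^sup>2" by auto
  have Meq: "gram_det M B = (gram_det S B / k)\<^sup>2 * ?G"
  proof -
    have "k\<^sup>2 * gram_det M B = gram_det S B * (?J * gram_det M B)" using k(2) by (simp add: mult.assoc)
    also have "\<dots> = (gram_det S B)\<^sup>2 * ?G" using 1 by (simp add: power2_eq_square)
    finally show ?thesis using k(1) by (simp add: power_divide field_simps)
  qed
  have "\<not> trivial_spinor c"
  proof
    assume "trivial_spinor c"
    then obtain d where "wall_disc c (d\<^sup>2)" unfolding square_discriminant_def wall_disc_def by blast
    moreover have "wall_disc c ?G" using B Vc unfolding wall_disc_def by auto
    ultimately obtain m where "?G = m\<^sup>2 * d\<^sup>2" using wall_disc_unique[OF cO] by blast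
    then have "gram_det M B = (gram_det S B / k * m * d)\<^sup>2" using Meq by (simp add: power_mult_distrib power_divide)
    then show False using nonsq by blast
  qed
  then show ?thesis using cSO cx by blast
qed

end

section \<open>Nonsquare determinants in linear families\<close>

text \<open>Replacing \<open>t\<close> by \<open>a * t\<close> multiplies the sum by
  \<open>a ^ m\<close>, and some nonzero \<open>a\<close> has \<open>a ^ m \<noteq> 1\<close>
  because a polynomial of degree \<open>m < q - 1\<close> cannot vanish at all nonzero elements. For
  \<open>m = 0\<close> the shift by 1 shows that \<open>q\<close> is zero in the field.\<close>

lemma sum_powers_zero:
  assumes "m < CARD('a) - 1"
  shows "(\<Sum>t\<in>UNIV. t ^ m) = (0::'a::{field,finite})"
proof (cases "m = 0")
  case True
  have "(\<Sum>t\<in>UNIV. t) = (\<Sum>t\<in>UNIV. t + (1::'a))"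
    by (rule sum.reindex_bij_witness[of _ "\<lambda>t. t + 1" "\<lambda>t. t - 1"]) auto
  then have "(\<Sum>t\<in>(UNIV::'a set). (1::'a)) = 0" by (simp only: sum.distrib) simp
  then show ?thesis using True by simp
next
  case False
  let ?p = "monom (1::'a) m - 1"
  have deg: "degree ?p \<le> m" by (intro degree_diff_le) (auto simp: degree_monom_eq)
  have "coeff ?p m = 1" using False by simp
  then have p0: "?p \<noteq> 0" by (metis coeff_0 zero_neq_one)
  have "card {a. poly ?p a = 0} \<le> m" using card_poly_roots_bound[OF p0] deg by simp
  then have "card {a. poly ?p a = 0} < card (UNIV - {0::'a})"
    using assms by (simp add: card_Diff_subset)
  then have "\<not> UNIV - {0} \<subseteq> {a. poly ?p a = 0}" using card_mono[OF finite] by (metis not_le)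
  then obtain a where "a \<noteq> 0" "poly ?p a \<noteq> 0" by blast
  then have a: "a \<noteq> 0" "a ^ m \<noteq> 1" by (simp_all add: poly_monom)
  have "(\<Sum>t\<in>UNIV. t ^ m) = (\<Sum>t\<in>UNIV. (a * t) ^ m)"
    by (rule sum.reindex_bij_witness[of _ "\<lambda>t. a * t" "\<lambda>t. t / a"]) (use a in auto)
  also have "\<dots> = a ^ m * (\<Sum>t\<in>UNIV. t ^ m)" by (simp add: power_mult_distrib sum_distrib_left)
  finally have "(1 - a ^ m) * (\<Sum>t\<in>UNIV. t ^ m) = 0" by (simp add: left_diff_distrib)
  then show ?thesis using a(2) by simp
qed

text \<open>Ax's argument: every monomial of the expanded product has an exponent below \<open>q - 1\<close>.\<close>

lemma sum_prod_linear_forms_zero: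
  fixes a :: "'j \<Rightarrow> 'b \<Rightarrow> 'a::{field,finite}"
  assumes B: "finite B" and J: "finite J" and less: "card J < card B * (CARD('a) - 1)"
  shows "(\<Sum>t\<in>PiE B (\<lambda>_. UNIV). \<Prod>j\<in>J. \<Sum>b\<in>B. t b * a j b) = 0"
proof -
  have "(\<Sum>t\<in>PiE B (\<lambda>_. UNIV). \<Prod>j\<in>J. \<Sum>b\<in>B. t b * a j b) =
        (\<Sum>t\<in>PiE B (\<lambda>_. UNIV). \<Sum>\<phi>\<in>PiE J (\<lambda>_. B). \<Prod>j\<in>J. t (\<phi> j) * a j (\<phi> j))"
    using B J by (intro sum.cong refl prod_sum_PiE) auto
  also have "\<dots> = (\<Sum>\<phi>\<in>PiE J (\<lambda>_. B). (\<Prod>j\<in>J. a j (\<phi> j)) * (\<Sum>t\<in>PiE B (\<lambda>_. UNIV). \<Prod>j\<in>J. t (\<phi> j)))"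
    by (subst sum.swap) (simp add: prod.distrib sum_distrib_left mult.commute)
  also have "\<dots> = 0"
  proof (intro sum.neutral ballI)
    fix \<phi> assume \<phi>: "\<phi> \<in> PiE J (\<lambda>_. B)"
    \<comment> \<open>\<open>\<phi>\<close> selects one term from each linear form, and
      \<open>n b\<close> is the exponent of \<open>t b\<close> in the resulting monomial. These
      exponents add up to \<open>card J\<close>.\<close>
    define n where "n b = card {j \<in> J. \<phi> j = b}" for b
    have "(\<Prod>j\<in>J. t (\<phi> j)) = (\<Prod>b\<in>B. t b ^ n b)" for t :: "'b \<Rightarrow> 'a"
    proof -
      have "(\<Prod>j\<in>J. t (\<phi> j)) = (\<Prod>b\<in>B. \<Prod>j\<in>{j \<in> J. \<phi> j = b}. t (\<phi> j))"
        by (rule prod.group[symmetric]) (use B J \<phi> in auto)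
      also have "\<dots> = (\<Prod>b\<in>B. t b ^ n b)" by (intro prod.cong) (auto simp: n_def)
      finally show ?thesis .
    qed
    then have "(\<Sum>t\<in>PiE B (\<lambda>_. UNIV :: 'a set). \<Prod>j\<in>J. t (\<phi> j)) = (\<Sum>t\<in>PiE B (\<lambda>_. UNIV). \<Prod>b\<in>B. t b ^ n b)"
      by (intro sum.cong refl) blast
    also have "\<dots> = (\<Prod>b\<in>B. \<Sum>s\<in>(UNIV::'a set). s ^ n b)"
      by (rule prod_sum_PiE[symmetric]) (use B in auto)
    also have "\<dots> = 0"
    proof -
      have "(\<Sum>b\<in>B. n b) = card J"
        using sum.group[OF J B, of \<phi> "\<lambda>_. 1::nat"] \<phi> by (auto simp: n_def)
      then have "\<not> (\<forall>b\<in>B. CARD('a) - 1 \<le> n b)"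
        using sum_bounded_below[of B "CARD('a) - 1" n] less by auto
      then obtain b where "b \<in> B" "n b < CARD('a) - 1" by auto
      then show ?thesis using sum_powers_zero B by (metis prod_zero)
    qed
    finally show "(\<Prod>j\<in>J. a j (\<phi> j)) * (\<Sum>t\<in>PiE B (\<lambda>_. UNIV). \<Prod>j\<in>J. t (\<phi> j)) = 0" by simp
  qed
  finally show ?thesis .
qed

text \<open>The determinant has degree \<open>card B\<close> in equally many variables. Its power,
  expanded over \<open>r\<close>-tuples \<open>\<psi>\<close> of permutations, is a combination of
  products of \<open>r * card B\<close> linear forms, below the bound
  \<open>card B * (q - 1)\<close>.\<close>

lemma sum_gram_det_power_zero:
  fixes a :: "'b \<Rightarrow> 'b \<Rightarrow> 'b \<Rightarrow> 'a::{field,finite}"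
  assumes B: "finite B" "B \<noteq> {}" and r: "r < CARD('a) - 1"
  shows "(\<Sum>t\<in>PiE B (\<lambda>_. UNIV). gram_det (\<lambda>e f. \<Sum>b\<in>B. t b * a b e f) B ^ r) = 0"
proof -
  let ?P = "{p. p permutes B}" and ?L = "\<lambda>t e f. \<Sum>b\<in>B. t b * a b e f"
  let ?T = "PiE B (\<lambda>_. UNIV :: 'a set)"
  have finP: "finite ?P" using B(1) by (rule finite_permutations)
  have "gram_det (?L t) B ^ r = (\<Sum>\<psi>\<in>PiE {..<r} (\<lambda>_. ?P).
      (\<Prod>i<r. of_int (sign (\<psi> i))) * (\<Prod>(i, e)\<in>{..<r} \<times> B. ?L t e (\<psi> i e)))" for t
  proof -
    have "gram_det (?L t) B ^ r = (\<Prod>i<r. \<Sum>p\<in>?P. of_int (sign p) * (\<Prod>e\<in>B. ?L t e (p e)))"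
      by (simp add: gram_det_def)
    also have "\<dots> = (\<Sum>\<psi>\<in>PiE {..<r} (\<lambda>_. ?P). \<Prod>i<r. of_int (sign (\<psi> i)) * (\<Prod>e\<in>B. ?L t e (\<psi> i e)))"
      using finP by (intro prod_sum_PiE) auto
    finally show ?thesis by (simp add: prod.distrib prod.cartesian_product)
  qed
  then have "(\<Sum>t\<in>?T. gram_det (?L t) B ^ r) = (\<Sum>t\<in>?T. \<Sum>\<psi>\<in>PiE {..<r} (\<lambda>_. ?P).
      (\<Prod>i<r. of_int (sign (\<psi> i))) * (\<Prod>(i, e)\<in>{..<r} \<times> B. ?L t e (\<psi> i e)))"
    by simp
  also have "\<dots> = (\<Sum>\<psi>\<in>PiE {..<r} (\<lambda>_. ?P). (\<Prod>i<r. of_int (sign (\<psi> i))) *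
      (\<Sum>t\<in>?T. \<Prod>(i, e)\<in>{..<r} \<times> B. ?L t e (\<psi> i e)))"
    by (subst sum.swap) (simp add: sum_distrib_left)
  also have "\<dots> = 0"
  proof (intro sum.neutral ballI)
    fix \<psi>
    have "card ({..<r} \<times> B) < card B * (CARD('a) - 1)"
      using B r by (simp add: card_cartesian_product card_gt_0_iff)
    then have "(\<Sum>t\<in>?T. \<Prod>j\<in>{..<r} \<times> B. \<Sum>b\<in>B. t b * a b (snd j) (\<psi> (fst j) (snd j))) = 0"
      using B(1) by (intro sum_prod_linear_forms_zero) auto
    then show "(\<Prod>i<r. of_int (sign (\<psi> i))) * (\<Sum>t\<in>?T. \<Prod>(i, e)\<in>{..<r} \<times> B. ?L t e (\<psi> i e)) = 0"
      by (simp add: case_prod_unfold)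
  qed
  finally show ?thesis .
qed

text \<open>Only nonzero squares are excluded: the determinant found may still be 0, and the
  application rules this out by irreducibility.\<close>

lemma exists_nonsquare_gram_det:
  fixes a :: "'b \<Rightarrow> 'b \<Rightarrow> 'b \<Rightarrow> 'a::{field,finite}"
  assumes two: "(2::'a) \<noteq> 0" and B: "finite B" "B \<noteq> {}"
  shows "\<exists>t. (\<nexists>c. c \<noteq> 0 \<and> gram_det (\<lambda>e f. \<Sum>b\<in>B. t b * a b e f) B = c\<^sup>2) \<and> (\<exists>b\<in>B. t b \<noteq> 0)"
proof (rule ccontr)
  assume neg: "\<not> ?thesis"
  let ?T = "PiE B (\<lambda>_. UNIV :: 'a set)"
  let ?d = "\<lambda>t. gram_det (\<lambda>e f. \<Sum>b\<in>B. t b * a b e f) B"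
  \<comment> \<open>The zero parameter as an element of \<open>?T\<close>: members of
    \<open>PiE\<close> are \<open>undefined\<close> outside \<open>B\<close>, so the constant zero
    function need not belong to it.\<close>
  let ?z = "\<lambda>b\<in>B. 0 :: 'a"
  have odd: "odd CARD('a)" using two even_card_iff_two_eq_zero by blast
  have "CARD('a) \<noteq> 1" using card_mono[of UNIV "{0, 1::'a}"] by auto
  then have q: "CARD('a) \<ge> 3" using odd by (metis One_nat_def even_numeral le_antisym not_less_eq_eq
        numeral_2_eq_2 numeral_3_eq_3 one_le_card_finite)
  define r where "r = (CARD('a) - 1) div 2"
  have r: "0 < r" "r < CARD('a) - 1" "2 * r = CARD('a) - 1" using q odd by (auto simp: r_def)
  have z: "?z \<in> ?T" by simp
  have one: "?d t ^ r = 1" if "t \<in> ?T - {?z}" for t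
  proof -
    have "\<exists>b\<in>B. t b \<noteq> 0"
    proof (rule ccontr)
      assume "\<not> ?thesis"
      then have "t = ?z" using that by (auto simp: fun_eq_iff PiE_def extensional_def)
      with that show False by simp
    qed
    then obtain c where c: "c \<noteq> 0" "?d t = c\<^sup>2" using neg by blast
    then have "?d t ^ r = c ^ (CARD('a) - 1)" by (simp add: r(3) flip: power_mult)
    then show ?thesis using power_card_minus_one[OF c(1)] by simp
  qed
  have "?d ?z = gram_det (\<lambda>e f. 0) B" by (intro gram_det_cong) simp
  also have "\<dots> = 0"
  proof -
    obtain b where b: "b \<in> B" using B by blast
    have "gram_det (\<lambda>e f. 0 :: 'a) (insert b (B - {b})) = 0"
      using B(1) by (subst gram_det_insert) auto
    then show ?thesis using b by (simp add: insert_absorb)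
  qed
  finally have dz: "?d ?z = 0" .
  have finT: "finite ?T" using B(1) by (intro finite_PiE) auto
  have "0 = (\<Sum>t\<in>?T. ?d t ^ r)" using sum_gram_det_power_zero[OF B r(2), of a] by simp
  also have "\<dots> = ?d ?z ^ r + (\<Sum>t\<in>?T - {?z}. ?d t ^ r)" by (rule sum.remove[OF finT z])
  also have "\<dots> = (\<Sum>t\<in>?T - {?z}. 1)" using one dz r(1) by simp
  \<comment> \<open>The sum has become the number \<open>q ^ card B - 1\<close> of nonzero
    parameters, which is \<open>- 1\<close> in the field.\<close>
  finally have "of_nat (card (?T - {?z})) = (0::'a)" by simp
  moreover have "card ?T = Suc (card (?T - {?z}))" by (rule card.remove[OF finT z])
  moreover have "card ?T = CARD('a) ^ card B" using B(1) by (simp add: card_PiE)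
  moreover have "of_nat CARD('a) = (0::'a)" using sum_powers_zero[of 0, where 'a='a] q by simp
  ultimately have "(0::'a) ^ card B = 1" by (metis of_nat_Suc of_nat_power add.right_neutral)
  moreover have "card B \<noteq> 0" using B by simp
  ultimately show False by (cases "card B") simp_all
qed

section \<open>Invariant subspaces and the algebra generated by an isometry\<close>

definition irreducible_invariant :: "'a::field^'n^'n \<Rightarrow> ('a^'n) set \<Rightarrow> bool" where
  "irreducible_invariant x U \<longleftrightarrow> invariant x U \<and> U \<noteq> {0} \<and>
     (\<forall>T. invariant x T \<and> T \<subseteq> U \<longrightarrow> T = {0} \<or> T = U)"

lemma irreducible_invariant_exists:
  fixes W :: "('a::field^'n) set"
  assumes "invariant x W" "W \<noteq> {0}"
  shows "\<exists>U\<subseteq>W. irreducible_invariant x U"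
proof -
  let ?R = "\<lambda>U. invariant x U \<and> U \<noteq> {0} \<and> U \<subseteq> W"
  obtain U where U: "?R U" and min: "\<And>T. ?R T \<Longrightarrow> vec.dim U \<le> vec.dim T"
    using ex_has_least_nat[of ?R W vec.dim] assms by blast
  have "T = U" if T: "invariant x T" "T \<subseteq> U" "T \<noteq> {0}" for T
  proof (rule vec.subspace_dim_equal)
    show "vec.dim U \<le> vec.dim T" using min[of T] T U by blast
  qed (use T U in \<open>auto simp: invariant_def\<close>)
  then show ?thesis using U unfolding irreducible_invariant_def by blast
qed

lemma invariant_Int: "invariant x U \<Longrightarrow> invariant x T \<Longrightarrow> invariant x (U \<inter> T)"
  by (auto simp: invariant_def vec.subspace_inter)

lemma funpow_linear:
  fixes f :: "'a::field^'n \<Rightarrow> 'a^'n"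
  assumes "Vector_Spaces.linear (*s) (*s) f"
  shows "(f ^^ n) (u + v) = (f ^^ n) u + (f ^^ n) v" "(f ^^ n) (c *s v) = c *s (f ^^ n) v"
proof -
  interpret Vector_Spaces.linear "(*s)" "(*s)" f by fact
  show "(f ^^ n) (u + v) = (f ^^ n) u + (f ^^ n) v" "(f ^^ n) (c *s v) = c *s (f ^^ n) v"
    by (induction n) (simp_all add: add scale)
qed

text \<open>Maschke's theorem for the cyclic group generated by \<open>x\<close>: an arbitrary
  projection \<open>P0\<close> onto \<open>T\<close> is averaged over conjugation by powers of
  \<open>x\<close>, with \<open>m - i\<close> serving as the exponent of the inverse of the
  \<open>i\<close>-th power. The kernel of the average is the complement.\<close>

lemma invariant_complement_exists:
  fixes x :: "'a::field^'n^'n"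
  assumes T: "invariant x T" and ord: "\<And>v. ((\<lambda>v. v v* x) ^^ m) v = v" and m: "of_nat m \<noteq> (0::'a)"
  shows "\<exists>C. invariant x C \<and> T \<inter> C = {0} \<and> (\<forall>v. \<exists>t\<in>T. \<exists>c\<in>C. v = t + c)"
proof -
  let ?X = "\<lambda>v::'a^'n. v v* x"
  have subT: "vec.subspace T" using T by (simp add: invariant_def)
  obtain D where D: "vec.subspace D" "T \<inter> D = {0}" "\<forall>w\<in>UNIV. \<exists>r\<in>T. \<exists>u\<in>D. w = r + u"
    using complement_exists[OF subT vec.subspace_UNIV] by blast
  obtain P0 where lP0: "Vector_Spaces.linear (*s) (*s) P0" and dec: "\<forall>v. P0 v \<in> T \<and> v - P0 v \<in> D"
      and P0: "\<forall>v. \<forall>t\<in>T. v - t \<in> D \<longrightarrow> P0 v = t"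
    using linear_projection_exists[OF subT D(1,2)] D(3) by blast
  interpret P0: Vector_Spaces.linear "(*s)" "(*s)" P0 by (rule lP0)
  have P0_T: "P0 v \<in> T" for v using dec by blast
  have P0_id: "P0 t = t" if "t \<in> T" for t using P0 that vec.subspace_0[OF D(1)] by simp
  have powT: "(?X ^^ i) t \<in> T" if "t \<in> T" for i t
    using T that by (induction i) (auto simp: invariant_def)
  define S where "S v = (\<Sum>i<m. (?X ^^ (m - i)) (P0 ((?X ^^ i) v)))" for v
  define P where "P v = (1 / of_nat m) *s S v" for v
  note pw = funpow_linear[OF linear_vector_matrix[of x]]
  have S_add: "S (u + v) = S u + S v" and S_scale: "S (c *s u) = c *s S u" for u v c
    by (simp_all add: S_def pw P0.add P0.scale sum.distrib vec.scale_sum_right)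
  have P_add: "P (u + v) = P u + P v" and P_scale: "P (c *s u) = c *s P u" for u v c
    by (simp_all add: P_def S_add S_scale vector_add_ldistrib vec.scale_left_commute)
  have P_T: "P v \<in> T" for v
    unfolding P_def S_def using subT powT P0_T by (intro vec.subspace_scale vec.subspace_sum) auto
  have P_id: "P t = t" if "t \<in> T" for t
  proof -
    have "(?X ^^ (m - i)) (P0 ((?X ^^ i) t)) = t" if "i < m" for i
    proof -
      have "(?X ^^ (m - i)) (P0 ((?X ^^ i) t)) = (?X ^^ (m - i + i)) t"
        using P0_id[OF powT[OF \<open>t \<in> T\<close>]] by (simp only: funpow_add o_apply)
      then show ?thesis using that ord by simp
    qed
    then have "S t = (\<Sum>i<m. t)" by (simp add: S_def)
    also have "\<dots> = of_nat m *s t" by (induction m) (simp_all add: vector_sadd_rdistrib add.commute del: sum_constant)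
    finally show ?thesis using m by (simp add: P_def)
  qed
  have P_X: "P (v v* x) = P v v* x" for v
  proof -
    define h where "h i = (?X ^^ (m - i)) (P0 ((?X ^^ i) v))" for i
    have "S (v v* x) = (\<Sum>i<m. h (Suc i) v* x)"
      unfolding S_def
    proof (intro sum.cong refl)
      fix i assume "i \<in> {..<m}"
      then have "m - i = Suc (m - Suc i)" by simp
      then have "(?X ^^ (m - i)) y = ((?X ^^ (m - Suc i)) y) v* x" for y by simp
      moreover have "(?X ^^ i) (v v* x) = (?X ^^ Suc i) v" by (simp only: funpow_Suc_right o_apply)
      ultimately show "(?X ^^ (m - i)) (P0 ((?X ^^ i) (v v* x))) = h (Suc i) v* x"
        by (simp only: h_def)
    qed
    also have "\<dots> = (\<Sum>i<m. h (Suc i)) v* x" by (simp add: vm.sum)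
    \<comment> \<open>The shift of the index is cyclic because \<open>h m = h 0\<close>.\<close>
    also have "(\<Sum>i<m. h (Suc i)) = (\<Sum>i<m. h i)"
    proof -
      have "h m = h 0" by (simp add: h_def ord)
      moreover have "(\<Sum>i<m. h (Suc i)) + h 0 = (\<Sum>i<m. h i) + h m"
        using sum.lessThan_Suc_shift[of h m] sum.lessThan_Suc[of h m] by (simp add: add.commute)
      ultimately show ?thesis by simp
    qed
    also have "(\<Sum>i<m. h i) = S v" by (simp add: h_def S_def)
    finally show ?thesis by (simp add: P_def vm.scale)
  qed
  let ?C = "{v. P v = 0}"
  have P0': "P 0 = 0" using P_scale[of 0 0] by simp
  have "vec.subspace ?C" by (rule vec.subspaceI) (auto simp: P_add P_scale P0')
  then have "invariant x ?C" by (auto simp: invariant_def P_X)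
  moreover have "T \<inter> ?C = {0}" using P_id P0' vec.subspace_0[OF subT] by fastforce
  moreover have "\<exists>t\<in>T. \<exists>c\<in>?C. v = t + c" for v
  proof (intro bexI)
    have "P (v + (- 1) *s P v) = P v + (- 1) *s P (P v)" by (simp only: P_add P_scale)
    then show "v - P v \<in> ?C" using P_id[OF P_T] by simp
  qed (use P_T in auto)
  ultimately show ?thesis by blast
qed

context nonsing_form
begin

text \<open>Pairs of mutually adjoint operators in the algebra generated by \<open>x\<close> and its inverse \<open>x'\<close>.\<close>

inductive adjoint_pair :: "'a^'n^'n \<Rightarrow> 'a^'n^'n \<Rightarrow> ('a^'n \<Rightarrow> 'a^'n) \<Rightarrow> ('a^'n \<Rightarrow> 'a^'n) \<Rightarrow> bool"
  for x x' where
  one: "adjoint_pair x x' (\<lambda>v. v) (\<lambda>v. v)"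
| mult: "adjoint_pair x x' a a' \<Longrightarrow> adjoint_pair x x' (\<lambda>v. a v v* x) (\<lambda>v. a' v v* x')"
| mult': "adjoint_pair x x' a a' \<Longrightarrow> adjoint_pair x x' (\<lambda>v. a v v* x') (\<lambda>v. a' v v* x)"
| add: "adjoint_pair x x' a a' \<Longrightarrow> adjoint_pair x x' b b' \<Longrightarrow>
    adjoint_pair x x' (\<lambda>v. a v + b v) (\<lambda>v. a' v + b' v)"
| scale: "adjoint_pair x x' a a' \<Longrightarrow> adjoint_pair x x' (\<lambda>v. c *s a v) (\<lambda>v. c *s a' v)"

lemma adjoint_pair_swap: "adjoint_pair x x' a a' \<Longrightarrow> adjoint_pair x x' a' a"
  by (induction rule: adjoint_pair.induct) (auto intro: adjoint_pair.intros)

lemma adjoint_pair_linear: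
  assumes "adjoint_pair x x' a a'"
  shows "a (u + v) = a u + a v" "a (c *s v) = c *s a v"
  using assms
  by (induction arbitrary: u v c rule: adjoint_pair.induct)
    (auto simp: vm.add vm.scale vector_add_ldistrib vec.scale_left_commute)

lemma adjoint_pair_arg_diff: "adjoint_pair x x' a a' \<Longrightarrow> a (u - v) = a u - a v"
  using adjoint_pair_linear(1)[of x x' a a' u "- v"] adjoint_pair_linear(2)[of x x' a a' "- 1" v] by simp

lemma adjoint_pair_commute_x:
  assumes "adjoint_pair x x' a a'" "x' ** x = mat 1" "x ** x' = mat 1"
  shows "a (v v* x) = a v v* x" "a (v v* x') = a v v* x'"
proof -
  have c: "v v* x v* x' = v" "v v* x' v* x = v" for v
    by (simp_all add: vector_matrix_mul_assoc assms(2,3))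
  show "a (v v* x) = a v v* x" "a (v v* x') = a v v* x'"
    using assms(1) by (induction rule: adjoint_pair.induct) (auto simp: vm.add vm.scale c)
qed

lemma adjoint_pair_commute:
  assumes "adjoint_pair x x' a a'" "adjoint_pair x x' b b'" "x' ** x = mat 1" "x ** x' = mat 1"
  shows "a (b v) = b (a v)"
  using assms(1)
  by (induction rule: adjoint_pair.induct)
    (auto simp: adjoint_pair_commute_x[OF assms(2-4)] adjoint_pair_linear[OF assms(2)])

lemma adjoint_pair_adjoint:
  assumes "adjoint_pair x x' a a'" "isometry x" "x' ** x = mat 1" "x ** x' = mat 1"
  shows "\<beta> (a u) v = \<beta> u (a' v)"
  using assms(1)
proof (induction arbitrary: u v rule: adjoint_pair.induct)
  have x'O: "isometry x'" using orthogonal_inverse[OF assms(2,3)] .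
  have c: "v v* x v* x' = v" "v v* x' v* x = v" for v
    by (simp_all add: vector_matrix_mul_assoc assms(3,4))
  have adj: "\<beta> (u v* x) v = \<beta> u (v v* x')" "\<beta> (u v* x') v = \<beta> u (v v* x)" for u v
    using orthogonalD(3)[OF assms(2), of u "v v* x'"] orthogonalD(3)[OF x'O, of u "v v* x"] c by simp_all
  {
    case (mult a a')
    then show ?case
      by (simp add: adj adjoint_pair_commute_x[OF adjoint_pair_swap[OF mult.hyps] assms(3,4)])
  next
    case (mult' a a')
    then show ?case
      by (simp add: adj adjoint_pair_commute_x[OF adjoint_pair_swap[OF mult'.hyps] assms(3,4)])
  }
qed (auto simp: pol_add pol_scale)

lemma adjoint_pair_invariant:
  assumes "adjoint_pair x x' a a'" "invariant x U" "x' ** x = mat 1" "x ** x' = mat 1" "u \<in> U"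
  shows "a u \<in> U"
  using assms(1,5)
proof (induction rule: adjoint_pair.induct)
  case (add a a' b b')
  then show ?case using assms(2) by (auto simp: invariant_def vec.subspace_add)
next
  case (mult' a a')
  then show ?case using invariant_inverse[OF assms(2-4)] by blast
qed (use assms(2) in \<open>auto simp: invariant_def vec.subspace_scale\<close>)

text \<open>Schur's lemma: \<open>a\<close> commutes with \<open>x\<close>, so its kernel in
  \<open>U\<close> is invariant.\<close>

lemma adjoint_pair_kernel:
  assumes a: "adjoint_pair x x' a a'" and U: "irreducible_invariant x U"
    and x': "x' ** x = mat 1" "x ** x' = mat 1"
  shows "(\<forall>u\<in>U. a u = 0) \<or> (\<forall>u\<in>U. a u = 0 \<longrightarrow> u = 0)"
proof -
  have inv: "invariant x U" using U by (simp add: irreducible_invariant_def)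
  let ?T = "{u \<in> U. a u = 0}"
  have a0: "a 0 = 0" using adjoint_pair_linear(2)[OF a, of 0 0] by simp
  have "vec.subspace ?T"
    using inv a0 by (intro vec.subspaceI)
      (auto simp: invariant_def vec.subspace_0 vec.subspace_add vec.subspace_scale adjoint_pair_linear[OF a])
  then have "invariant x ?T"
    using inv by (auto simp: invariant_def adjoint_pair_commute_x[OF a x'])
  then have "?T = {0} \<or> ?T = U" using U unfolding irreducible_invariant_def by blast
  then show ?thesis by blast
qed

lemma adjoint_pair_diff:
  assumes "adjoint_pair x x' a a'" "adjoint_pair x x' b b'"
  shows "adjoint_pair x x' (\<lambda>v. a v - b v) (\<lambda>v. a' v - b' v)"
  using adjoint_pair.add[OF assms(1) adjoint_pair.scale[OF assms(2), of "- 1"]] by simp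

lemma adjoint_pair_zero: "adjoint_pair x x' (\<lambda>v. 0) (\<lambda>v. 0)"
  using adjoint_pair.scale[OF adjoint_pair.one, of x x' 0] by simp

lemma adjoint_pair_sum:
  assumes "finite I" "\<And>i. i \<in> I \<Longrightarrow> adjoint_pair x x' (a i) (a' i)"
  shows "adjoint_pair x x' (\<lambda>v. \<Sum>i\<in>I. t i *s a i v) (\<lambda>v. \<Sum>i\<in>I. t i *s a' i v)"
  using assms
proof (induction I rule: finite_induct)
  case empty
  show ?case using adjoint_pair_zero by simp
next
  case (insert i I)
  have "adjoint_pair x x' (\<lambda>v. t i *s a i v + (\<Sum>i\<in>I. t i *s a i v))
      (\<lambda>v. t i *s a' i v + (\<Sum>i\<in>I. t i *s a' i v))"
    using insert by (intro adjoint_pair.add adjoint_pair.scale) auto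
  then show ?case using insert.hyps by simp
qed

text \<open>The vectors reached from \<open>v\<close> form a nonzero invariant subspace of
  \<open>U\<close>.\<close>

lemma adjoint_pair_orbit:
  assumes U: "irreducible_invariant x U" and x': "x' ** x = mat 1" "x ** x' = mat 1"
    and v: "v \<in> U" "v \<noteq> 0" and u: "u \<in> U"
  shows "\<exists>a a'. adjoint_pair x x' a a' \<and> a v = u"
proof -
  have inv: "invariant x U" using U by (simp add: irreducible_invariant_def)
  let ?T = "{w. \<exists>a a'. adjoint_pair x x' a a' \<and> a v = w}"
  have "vec.subspace ?T"
  proof (rule vec.subspaceI)
    show "0 \<in> ?T" using adjoint_pair_zero by blast
  next
    fix u w assume "u \<in> ?T" "w \<in> ?T"
    then show "u + w \<in> ?T" using adjoint_pair.add by blast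
  next
    fix c w assume "w \<in> ?T"
    then show "c *s w \<in> ?T" using adjoint_pair.scale by blast
  qed
  moreover have "w v* x \<in> ?T" if "w \<in> ?T" for w using that adjoint_pair.mult by blast
  ultimately have "invariant x ?T" unfolding invariant_def by blast
  moreover have "?T \<subseteq> U" using adjoint_pair_invariant[OF _ inv x' v(1)] by blast
  moreover have "v \<in> ?T" using adjoint_pair.one by blast
  ultimately have "?T = U" using U v(2) unfolding irreducible_invariant_def by blast
  then show ?thesis using u by blast
qed

text \<open>For each basis vector \<open>e\<close> an operator taking \<open>v\<close> to
  \<open>e\<close> is chosen. The combination with coefficients \<open>t\<close> sends
  \<open>v\<close> to the vector with coordinates \<open>t\<close>, so it is nonzero, hence
  injective, whenever \<open>t\<close> is. This gives as many parameters as the matrices have rows,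
  which is what the degree count demands.\<close>

lemma adjoint_pair_nonsquare:
  assumes two: "(2::'a) \<noteq> 0"
    and U: "irreducible_invariant x U" and x': "x' ** x = mat 1" "x ** x' = mat 1"
  shows "\<exists>a a' B M. adjoint_pair x x' a a' \<and> basis_of B U \<and> (\<forall>e\<in>B. a e = (\<Sum>k\<in>B. M e k *s k)) \<and>
    (\<nexists>c. gram_det M B = c\<^sup>2) \<and> (\<forall>u\<in>U. a u = 0 \<longrightarrow> u = 0)"
proof -
  have inv: "invariant x U" and U0: "U \<noteq> {0}" using U by (simp_all add: irreducible_invariant_def)
  then have subU: "vec.subspace U" by (simp add: invariant_def)
  obtain v where v: "v \<in> U" "v \<noteq> 0" using U0 vec.subspace_0[OF subU] by blast
  obtain B where B: "basis_of B U" using basis_of_exists[OF subU] by blast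
  note b = basis_of_facts[OF B]
  have "B \<noteq> {}" using b(6) U0 by auto
  have "\<forall>e\<in>B. \<exists>a a'. adjoint_pair x x' a a' \<and> a v = e"
    using adjoint_pair_orbit[OF U x' v] b(2) by blast
  then obtain a a' where a: "\<And>e. e \<in> B \<Longrightarrow> adjoint_pair x x' (a e) (a' e)" "\<And>e. e \<in> B \<Longrightarrow> a e v = e"
    by metis
  have "\<forall>g\<in>B. \<exists>A. \<forall>e\<in>B. a g e = (\<Sum>k\<in>B. A e k *s k)"
  proof
    fix g assume "g \<in> B"
    then have "a g e \<in> U" if "e \<in> B" for e
      using adjoint_pair_invariant[OF a(1) inv x', of g e] b(2) that by blast
    then show "\<exists>A. \<forall>e\<in>B. a g e = (\<Sum>k\<in>B. A e k *s k)" by (rule basis_matrix[OF B])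
  qed
  then obtain A where A: "\<And>g e. g \<in> B \<Longrightarrow> e \<in> B \<Longrightarrow> a g e = (\<Sum>k\<in>B. A g e k *s k)"
    by metis
  obtain t where t: "\<nexists>c. c \<noteq> 0 \<and> gram_det (\<lambda>e f. \<Sum>g\<in>B. t g * A g e f) B = c\<^sup>2" "\<exists>g\<in>B. t g \<noteq> 0"
    using exists_nonsquare_gram_det[OF two b(1) \<open>B \<noteq> {}\<close>, of A] by blast
  let ?a = "\<lambda>v. \<Sum>g\<in>B. t g *s a g v" and ?a' = "\<lambda>v. \<Sum>g\<in>B. t g *s a' g v"
  let ?M = "\<lambda>e f. \<Sum>g\<in>B. t g * A g e f"
  have pair: "adjoint_pair x x' ?a ?a'" by (rule adjoint_pair_sum[OF b(1) a(1)])
  have "?a v = (\<Sum>g\<in>B. t g *s g)" using a(2) by simp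
  moreover have "(\<Sum>g\<in>B. t g *s g) \<noteq> 0"
    using t(2) basis_coeffs_unique[OF B, of t "\<lambda>_. 0"] by auto
  ultimately have "?a v \<noteq> 0" by simp
  then have inj: "\<forall>u\<in>U. ?a u = 0 \<longrightarrow> u = 0" using adjoint_pair_kernel[OF pair U x'] v by blast
  have M: "?a e = (\<Sum>k\<in>B. ?M e k *s k)" if "e \<in> B" for e
  proof -
    have "?a e = (\<Sum>g\<in>B. \<Sum>k\<in>B. (t g * A g e k) *s k)"
      using A that by (simp add: vec.scale_sum_right vec.scale_scale)
    then show ?thesis by (subst (asm) sum.swap) (simp add: vec.scale_sum_left)
  qed
  have surj: "?a ` U = U"
  proof (rule injective_linear_surj_on[OF subU])
    show "?a u \<in> U" if "u \<in> U" for u by (rule adjoint_pair_invariant[OF pair inv x' that])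
    show "?a (u - w) = ?a u - ?a w" for u w by (rule adjoint_pair_arg_diff[OF pair])
  qed (use inj in blast)
  \<comment> \<open>Excludes the square \<open>0\<close>, which the choice of \<open>t\<close> left
    open.\<close>
  have "gram_det ?M B \<noteq> 0"
    by (rule injective_gram_det_nonzero[OF B surj _ _ M])
      (simp_all only: adjoint_pair_linear[OF pair])
  then have "\<nexists>c. gram_det ?M B = c\<^sup>2" using t(1) by (metis zero_power2)
  then show ?thesis
    using pair B M inj by (intro exI[of _ ?a] exI[of _ ?a'] exI[of _ B] exI[of _ ?M]) auto
qed

end

section \<open>Centralizers of semisimple isometries\<close>

lemma gram_det_doubleton:
  assumes "e \<noteq> f"
  shows "gram_det M {e, f} = M e e * M f f - M e f * M f e"
proof -
  have "{p. p permutes {e, f}} = {id, Transposition.transpose e f}"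
    by (auto simp: permutes_doubleton_iff)
  moreover have "Transposition.transpose e f \<noteq> id"
    using assms by (metis id_apply transpose_apply_first)
  ultimately show ?thesis
    using assms by (simp add: gram_det_def sign_swap_id)
qed

context nonsing_form
begin

lemma nonsquare_exists:
  assumes "(2::'a) \<noteq> 0"
  shows "\<exists>y::'a. \<nexists>c. y = c\<^sup>2"
proof (rule ccontr)
  assume "\<not> ?thesis"
  then have "range (\<lambda>c::'a. c\<^sup>2) = UNIV" by blast
  then have "CARD('a) = 1" using card_squares[OF assms] by simp
  moreover have "card {0, 1::'a} \<le> CARD('a)" by (intro card_mono) auto
  ultimately show False by simp
qed

text \<open>On the plane \<open>x\<close> is scalar and commutes with every operator. There
  \<open>s\<close> is skew with \<open>s\<^sup>2 = - ?D\<close>, so \<open>a + t s\<close> has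
  adjoint \<open>a - t s\<close> and determinant \<open>a\<^sup>2 + ?D * t\<^sup>2\<close>, a form
  that represents the nonsquare \<open>N\<close>.\<close>

lemma scalar_plane_centralizer:
  assumes two: "(2::'a) \<noteq> 0" and x: "isometry x"
    and e: "e v* x = \<epsilon> *s e" "Q e \<noteq> 0" and f: "f v* x = \<epsilon> *s f" "Q f \<noteq> 0" and ef: "\<beta> e f = 0"
  shows "nontrivial_spinor_centralizer x"
proof -
  let ?D = "4 * Q e * Q f"
  have four: "(4::'a) \<noteq> 0"
  proof -
    have "(4::'a) = 2 * 2" by simp
    then show ?thesis using two by (metis mult_eq_0_iff)
  qed
  then have D: "?D \<noteq> 0" using e f by simp
  have fe: "\<beta> f e = 0" using ef by (simp add: pol_commute)
  obtain N where N: "\<nexists>c::'a. N = c\<^sup>2" using nonsquare_exists[OF two] by blast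
  obtain a t where at: "a\<^sup>2 + ?D * t\<^sup>2 = N" using sum_weighted_squares[OF two D] by blast
  have t: "t \<noteq> 0" using at N by auto
  have N0: "N \<noteq> 0" using N by (metis zero_power2)
  define W where "W = vec.span {e, f}"
  have "e \<noteq> f" using ef e(2) two by (auto simp: pol_self)
  have cs: "w \<in> W \<longleftrightarrow> (\<exists>c d. w = c *s e + d *s f)" for w
  proof -
    have "w \<in> W \<longleftrightarrow> (\<exists>c d. w - c *s e = d *s f)"
      unfolding W_def vec.span_breakdown_eq[of w e] vec.span_singleton by auto
    also have "\<dots> \<longleftrightarrow> (\<exists>c d. w = c *s e + d *s f)" by (simp only: diff_eq_eq add.commute)
    finally show ?thesis .
  qed
  have coord: "\<beta> (c *s e + d *s f) e = c * (2 * Q e)" "\<beta> (c *s e + d *s f) f = d * (2 * Q f)" for c d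
    by (simp_all add: pol_add pol_scale ef fe pol_self)
  have "e \<notin> vec.span {f}"
  proof
    assume "e \<in> vec.span {f}"
    then obtain d where "e = d *s f" by (auto simp: vec.span_singleton)
    then have "\<beta> e e = 0" using ef fe by (metis mult_zero_right pol_scale(1))
    then show False using e(2) two by (simp add: pol_self)
  qed
  moreover have "f \<noteq> 0" using f(2) by auto
  ultimately have "vec.independent {e, f}" by (intro vec.independent_insertI) (auto simp: vec.independent_empty)
  then have B: "basis_of {e, f} W" by (simp add: basis_of_def W_def)
  \<comment> \<open>Up to scaling a quarter turn: \<open>e\<close> goes to \<open>2 Q e\<close>
    times \<open>f\<close>, and \<open>f\<close> to \<open>- 2 Q f\<close> times
    \<open>e\<close>.\<close>
  define s where "s v = \<beta> v e *s f - \<beta> v f *s e" for v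
  have s_add: "s (u + v) = s u + s v" and s_scale: "s (c *s u) = c *s s u" for u v c
    by (simp_all add: s_def pol_add pol_scale vec_eq_iff algebra_simps)
  have s_diff: "s (u - v) = s u - s v" for u v
    by (simp add: s_def pol_diff vec_eq_iff algebra_simps)
  have s_skew: "\<beta> (s u) v = - \<beta> u (s v)" for u v
    by (simp add: s_def pol_diff pol_scale pol_commute[of e] pol_commute[of f])
  have sef: "s (c *s e + d *s f) = (- d * (2 * Q f)) *s e + (c * (2 * Q e)) *s f" for c d
    by (simp add: s_def coord)
  have ss: "s (s w) = (- ?D) *s w" if w_in: "w \<in> W" for w
  proof -
    obtain c d where w: "w = c *s e + d *s f" using w_in cs[of w] by blast
    show ?thesis unfolding w sef by (simp add: vec_eq_iff algebra_simps)
  qed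
  define b where "b r v = a *s v + r *s s v" for r v
  have b_add: "b r (u + v) = b r u + b r v" and b_scale: "b r (c *s u) = c *s b r u" for r u v c
    by (simp_all add: b_def s_add s_scale vec_eq_iff algebra_simps)
  have sW: "s w \<in> W" for w
    unfolding W_def s_def by (intro vec.span_diff vec.span_scale vec.span_base) auto
  have bW: "b r w \<in> W" if "w \<in> W" for r w
    using that sW unfolding b_def W_def by (intro vec.span_add vec.span_scale) auto
  have bb: "b (- t) (b t w) = N *s w" if "w \<in> W" for w
  proof -
    have "b (- t) (b t w) = (a * a) *s w - (t * t) *s s (s w)"
      unfolding b_def by (simp add: s_add s_scale vec_eq_iff algebra_simps)
    also have "\<dots> = N *s w"
      unfolding ss[OF that] at[symmetric] by (simp add: vec_eq_iff power2_eq_square algebra_simps)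
    finally show ?thesis .
  qed
  have bcomm: "b t (b (- t) w) = b (- t) (b t w)" for w
    by (simp add: b_def s_add s_diff s_scale vec_eq_iff algebra_simps)
  have xW: "w v* x = \<epsilon> *s w" if w_in: "w \<in> W" for w
  proof -
    obtain c d where w: "w = c *s e + d *s f" using w_in cs[of w] by blast
    show ?thesis unfolding w using e(1) f(1) by (simp add: vm.add vm.scale vec_eq_iff algebra_simps)
  qed
  let ?M = "\<lambda>u v. if u = e then (if v = e then a else t * (2 * Q e))
      else (if v = e then - t * (2 * Q f) else a)"
  show ?thesis
  proof (rule commuting_adjoint_centralizer[OF two x B, of "b t" "b (- t)" ?M])
    show "W \<inter> perp W = {0}"
    proof (rule Int_perp_zeroI)
      fix w assume w: "w \<in> W" "\<And>u. u \<in> W \<Longrightarrow> \<beta> w u = 0"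
      then obtain c d where cd: "w = c *s e + d *s f" using cs by blast
      have "e \<in> W" "f \<in> W" by (simp_all add: W_def vec.span_base)
      then have "\<beta> w e = 0" "\<beta> w f = 0" using w(2) by auto
      then have "c * (2 * Q e) = 0" "d * (2 * Q f) = 0" unfolding cd coord by auto
      then have "c = 0" "d = 0" using e(2) f(2) two by auto
      then show "w = 0" using cd by simp
    qed (simp add: W_def vec.subspace_span)
    show "invariant x W" using xW by (simp add: invariant_def W_def vec.span_scale vec.subspace_span)
    show "\<beta> (b t u) v = \<beta> u (b (- t) v)" for u v
      by (simp add: b_def pol_add pol_diff pol_scale s_skew)
    show "b t (w v* x) = b t w v* x" "b (- t) (w v* x) = b (- t) w v* x" if "w \<in> W" for w
      using that xW bW by (simp_all add: b_scale)
    show "w = 0" if "w \<in> W" "b t w = 0" for w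
      using bb[OF that(1)] N0 that(2) b_scale[of "- t" 0 0] by simp
    show "w = 0" if "w \<in> W" "b t w = b (- t) w" for w
    proof -
      have "(2 * t) *s s w = b t w - b (- t) w" by (simp add: b_def vec_eq_iff algebra_simps)
      then have "s w = 0" using that(2) two t by simp
      then have "(- ?D) *s w = 0" using ss[OF that(1)] s_scale[of 0 0] by simp
      then show ?thesis using D by (metis neg_equal_0_iff_equal vec.scale_eq_0_iff)
    qed
    show "b t u = (\<Sum>k\<in>{e, f}. ?M u k *s k)" if "u \<in> {e, f}" for u
    proof -
      have "s e = (2 * Q e) *s f" "s f = (- (2 * Q f)) *s e" by (simp_all add: s_def ef fe pol_self)
      then have "b t e = a *s e + (t * (2 * Q e)) *s f" "b t f = (- t * (2 * Q f)) *s e + a *s f"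
        by (simp_all add: b_def vec.scale_scale)
      moreover have "u = e \<or> u = f" using that by blast
      ultimately show ?thesis using \<open>e \<noteq> f\<close> by auto
    qed
    have "gram_det ?M {e, f} = N"
      using \<open>e \<noteq> f\<close> at by (simp add: gram_det_doubleton power2_eq_square algebra_simps)
    then show "\<nexists>c. gram_det ?M {e, f} = c\<^sup>2" using N by simp
  qed (simp_all add: bW b_add b_scale bcomm)
qed

text \<open>The eigenspaces for \<open>1\<close> and \<open>- 1\<close> are orthogonal to each other
  and span the space, so each is nondegenerate. In dimension at least 3 one of them has dimension at
  least 2 and contains two orthogonal nonsingular vectors.\<close>

lemma involution_centralizer:
  assumes two: "(2::'a) \<noteq> 0" and n: "CARD('n) \<ge> 3" and x: "isometry x"
    and inv: "\<And>v. v v* x v* x = v"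
  shows "nontrivial_spinor_centralizer x"
proof -
  define E where "E \<epsilon> = {v. v v* x = \<epsilon> *s v}" for \<epsilon> :: 'a
  have subE: "vec.subspace (E \<epsilon>)" for \<epsilon>
    by (rule vec.subspaceI) (auto simp: E_def vm.add vm.scale vector_add_ldistrib vec.scale_left_commute)
  have orth: "\<beta> u v = 0" if "u \<in> E 1" "v \<in> E (- 1)" for u v
  proof -
    have "\<beta> u v = - \<beta> u v" using that orthogonalD(3)[OF x, of u v] by (simp add: E_def)
    then show ?thesis by (rule eq_minus_self_imp_zero[OF two])
  qed
  have split: "\<exists>u\<in>E 1. \<exists>w\<in>E (- 1). v = u + w" for v
  proof (intro bexI)
    show "v = (1 / 2) *s (v + v v* x) + (1 / 2) *s (v - v v* x)"
      using two by (simp add: vec_eq_iff field_simps)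
  qed (auto simp: E_def vm.scale vm.add vm.diff inv vec_eq_iff algebra_simps)
  have ndE: "E \<epsilon> \<inter> perp (E \<epsilon>) = {0}" if \<epsilon>: "\<epsilon> = 1 \<or> \<epsilon> = - 1" for \<epsilon>
  proof (rule Int_perp_zeroI[OF subE])
    fix y assume y: "y \<in> E \<epsilon>" "\<And>u. u \<in> E \<epsilon> \<Longrightarrow> \<beta> y u = 0"
    have "\<beta> y v = 0" for v
    proof -
      obtain u w where v: "u \<in> E 1" "w \<in> E (- 1)" "v = u + w" using split[of v] by blast
      have "\<beta> y u = 0 \<and> \<beta> y w = 0"
        using \<epsilon>
      proof
        assume "\<epsilon> = 1"
        then show ?thesis using y v orth by auto
      next
        assume "\<epsilon> = - 1"
        then show ?thesis using y v orth[of u y] by (auto simp: pol_commute)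
      qed
      then show ?thesis by (simp add: v(3) pol_add)
    qed
    then show "y = 0" by (rule pol_nondeg)
  qed
  have "{u + w |u w. u \<in> E 1 \<and> w \<in> E (- 1)} = UNIV"
  proof -
    have "v \<in> {u + w |u w. u \<in> E 1 \<and> w \<in> E (- 1)}" for v using split[of v] by blast
    then show ?thesis by blast
  qed
  then have "vec.dim (E 1) + vec.dim (E (- 1)) \<ge> CARD('n)"
    using vec.dim_sums_Int[OF subE[of 1] subE[of "- 1"]] by (simp add: vec.dim_UNIV card_cart_basis)
  then have "vec.dim (E 1) \<ge> 2 \<or> vec.dim (E (- 1)) \<ge> 2" using n by linarith
  then obtain \<epsilon> where \<epsilon>: "\<epsilon> = 1 \<or> \<epsilon> = - 1" "vec.dim (E \<epsilon>) \<ge> 2" by blast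
  then have "E \<epsilon> \<noteq> {0}" by auto
  then obtain e0 where "e0 \<in> E \<epsilon>" "e0 \<noteq> 0" using vec.subspace_0[OF subE] by blast
  then obtain e where e: "e \<in> E \<epsilon>" "Q e \<noteq> 0"
    using nonsingular_vector_exists[OF ndE[OF \<epsilon>(1)] _ _ subE] by blast
  define F where "F = {v \<in> E \<epsilon>. \<beta> v e = 0}"
  have "vec.dim (E \<epsilon>) \<le> vec.dim F + 1"
    unfolding F_def by (rule dim_kernel_functional[OF subE]) (simp_all add: pol_add pol_scale)
  then have "F \<noteq> {0}" using \<epsilon>(2) by auto
  have subF: "vec.subspace F"
    unfolding F_def by (rule vec.subspaceI)
      (auto simp: pol_add pol_scale vec.subspace_0[OF subE] vec.subspace_add[OF subE] vec.subspace_scale[OF subE])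
  have "F \<inter> perp F = {0}"
  proof (rule Int_perp_zeroI[OF subF])
    fix y assume y: "y \<in> F" "\<And>u. u \<in> F \<Longrightarrow> \<beta> y u = 0"
    have "\<beta> y v = 0" if v: "v \<in> E \<epsilon>" for v
    proof -
      let ?k = "\<beta> v e / (2 * Q e)"
      have "v - ?k *s e \<in> F"
        using v e two vec.subspace_diff[OF subE] vec.subspace_scale[OF subE]
        by (simp add: F_def pol_diff pol_scale pol_self)
      then have "\<beta> y (v - ?k *s e) = 0" by (rule y(2))
      moreover have "\<beta> y e = 0" using y by (simp add: F_def)
      ultimately show ?thesis by (simp add: pol_diff pol_scale)
    qed
    then have "y \<in> E \<epsilon> \<inter> perp (E \<epsilon>)" using y(1) by (auto simp: F_def perp_def)
    then show "y = 0" using ndE[OF \<epsilon>(1)] by blast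
  qed
  moreover obtain f0 where "f0 \<in> F" "f0 \<noteq> 0" using \<open>F \<noteq> {0}\<close> vec.subspace_0[OF subF] by blast
  ultimately obtain f where f: "f \<in> F" "Q f \<noteq> 0"
    using nonsingular_vector_exists subF by blast
  show ?thesis
    by (rule scalar_plane_centralizer[OF two x, of e \<epsilon> f])
      (use e f in \<open>auto simp: F_def E_def pol_commute\<close>)
qed

text \<open>The operator \<open>a\<close> with nonsquare determinant must not be self-adjoint on
  \<open>U\<close>. If it were, \<open>\<beta> (s u) v\<close> and
  \<open>\<beta> (s (a u)) v\<close> would both be alternating and nondegenerate by
  \<open>sq\<close>, and \<open>det a\<close> would be a quotient of two square
  discriminants.\<close>

lemma nondegenerate_irreducible_centralizer:
  assumes two: "(2::'a) \<noteq> 0" and x: "isometry x"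
    and U: "irreducible_invariant x U" and nd: "U \<inter> perp U = {0}"
    and sq: "\<And>u. u \<in> U \<Longrightarrow> u v* x v* x = u \<Longrightarrow> u = 0"
  shows "nontrivial_spinor_centralizer x"
proof -
  obtain x' where x': "isometry x'" "x' ** x = mat 1" "x ** x' = mat 1"
    using orthogonal_obtain_inverse[OF x] by metis
  have inv: "invariant x U" using U by (simp add: irreducible_invariant_def)
  obtain a a' B M where a: "adjoint_pair x x' a a'" and B: "basis_of B U"
    and M: "\<forall>e\<in>B. a e = (\<Sum>k\<in>B. M e k *s k)" and nsq: "\<nexists>c. gram_det M B = c\<^sup>2"
    and inj: "\<forall>u\<in>U. a u = 0 \<longrightarrow> u = 0"
    using adjoint_pair_nonsquare[OF two U x'(2,3)] by blast
  note b = basis_of_facts[OF B] and a' = adjoint_pair_swap[OF a]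
  have aU: "a u \<in> U" "a' u \<in> U" if "u \<in> U" for u
    using adjoint_pair_invariant[OF a inv x'(2,3) that] adjoint_pair_invariant[OF a' inv x'(2,3) that] by auto
  note adj = adjoint_pair_adjoint[OF a x x'(2,3)]
  define s where "s v = v v* x - v v* x'" for v
  have s: "adjoint_pair x x' s (\<lambda>v. v v* x' - v v* x)"
    unfolding s_def
    using adjoint_pair_diff[OF adjoint_pair.mult[OF adjoint_pair.one] adjoint_pair.mult'[OF adjoint_pair.one]] .
  have s_skew: "\<beta> (s u) v = - \<beta> u (s v)" for u v
    using adjoint_pair_adjoint[OF s x x'(2,3), of u v] by (simp add: s_def pol_diff)
  have sU: "s u \<in> U" if "u \<in> U" for u by (rule adjoint_pair_invariant[OF s inv x'(2,3) that])
  have s_inj: "u = 0" if "u \<in> U" "s u = 0" for u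
  proof (rule sq[OF that(1)])
    have "u v* x = u v* x'" using that(2) by (simp add: s_def)
    then show "u v* x v* x = u" by (simp add: vector_matrix_mul_assoc x')
  qed
  note skew_alt = eq_minus_self_imp_zero[OF two]
  have not_symmetric: "\<not> (\<forall>u\<in>U. a u - a' u = 0)"
  proof
    assume "\<forall>u\<in>U. a u - a' u = 0"
    then have eq: "a u = a' u" if "u \<in> U" for u using that by simp
    let ?A = "\<lambda>u v. \<beta> (s u) v" and ?A1 = "\<lambda>u v. \<beta> (s (a u)) v"
    have "\<exists>k. k \<noteq> 0 \<and> gram_det ?A B = k\<^sup>2"
    proof (rule alternating_gram_det_square[OF B])
      show "bilinear_on U ?A"
        by (simp add: bilinear_on_def adjoint_pair_linear[OF s] pol_add pol_scale)
      show "\<forall>u\<in>U. \<beta> (s u) u = 0" using s_skew skew_alt by (metis pol_commute)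
      show "\<forall>u\<in>U. (\<forall>v\<in>U. \<beta> (s u) v = 0) \<longrightarrow> u = 0"
      proof (intro ballI impI)
        fix u assume u: "u \<in> U" "\<forall>v\<in>U. \<beta> (s u) v = 0"
        then have "s u \<in> U \<inter> perp U" using sU by (simp add: perp_def)
        then show "u = 0" using nd s_inj[OF u(1)] by blast
      qed
    qed
    then obtain k where k: "k \<noteq> 0" "gram_det ?A B = k\<^sup>2" by blast
    have "\<exists>k. k \<noteq> 0 \<and> gram_det ?A1 B = k\<^sup>2"
    proof (rule alternating_gram_det_square[OF B])
      show "bilinear_on U ?A1"
        by (simp add: bilinear_on_def adjoint_pair_linear[OF s] adjoint_pair_linear[OF a] pol_add pol_scale)
      show "\<forall>u\<in>U. \<beta> (s (a u)) u = 0"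
      proof
        fix u assume u: "u \<in> U"
        have "\<beta> (s (a u)) u = \<beta> (a (s u)) u"
          using adjoint_pair_commute[OF s a x'(2,3)] by simp
        also have "\<dots> = \<beta> (s u) (a u)" using adj eq[OF u] by simp
        also have "\<dots> = - \<beta> (s (a u)) u" using s_skew[of u "a u"] by (simp add: pol_commute)
        finally show "\<beta> (s (a u)) u = 0" by (rule skew_alt)
      qed
      show "\<forall>u\<in>U. (\<forall>v\<in>U. \<beta> (s (a u)) v = 0) \<longrightarrow> u = 0"
      proof (intro ballI impI)
        fix u assume u: "u \<in> U" "\<forall>v\<in>U. \<beta> (s (a u)) v = 0"
        then have "s (a u) \<in> U \<inter> perp U" using sU aU by (simp add: perp_def)
        then have "a u = 0" using nd s_inj[OF aU(1)[OF u(1)]] by blast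
        then show "u = 0" using inj u(1) by blast
      qed
    qed
    then obtain l where l: "l \<noteq> 0" "gram_det ?A1 B = l\<^sup>2" by blast
    have "gram_det ?A1 B = gram_det (\<lambda>e f. \<Sum>k\<in>B. M e k * ?A k f) B"
    proof (rule gram_det_cong)
      fix e f assume ef: "e \<in> B" "f \<in> B"
      have "?A1 e f = ?A (\<Sum>k\<in>B. M e k *s k) f" using M ef(1) by simp
      also have "\<dots> = (\<Sum>k\<in>B. M e k * ?A k f)"
        by (rule bilinear_on_sum(1)[where W=UNIV and f="?A" and g="\<lambda>k. k"])
          (auto simp: bilinear_on_def adjoint_pair_linear[OF s] pol_add pol_scale b(1) vec.subspace_UNIV)
      finally show "?A1 e f = (\<Sum>k\<in>B. M e k * ?A k f)" .
    qed
    then have "l\<^sup>2 = gram_det M B * k\<^sup>2" using k(2) l(2) by (simp add: gram_det_mult)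
    then have "gram_det M B = (l / k)\<^sup>2" using k(1) by (simp add: power_divide field_simps)
    then show False using nsq by blast
  qed
  \<comment> \<open>Since \<open>a - a'\<close> is not zero on \<open>U\<close>, irreducibility
    makes it injective there.\<close>
  have a_ne: "u = 0" if "u \<in> U" "a u = a' u" for u
    using adjoint_pair_kernel[OF adjoint_pair_diff[OF a a'] U x'(2,3)] not_symmetric that by auto
  show ?thesis
  proof (rule commuting_adjoint_centralizer[OF two x B nd, of a a' M])
    show "invariant x U" by (rule inv)
    show "a w \<in> U" "a' w \<in> U" if "w \<in> U" for w using aU[OF that] by blast+
    show "a (u + v) = a u + a v" "a' (u + v) = a' u + a' v" "a (c *s u) = c *s a u"
      "a' (c *s u) = c *s a' u" for u v c
      by (rule adjoint_pair_linear[OF a] adjoint_pair_linear[OF a'])+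
    show "\<beta> (a u) v = \<beta> u (a' v)" for u v by (rule adj)
    show "a (a' w) = a' (a w)" for w by (rule adjoint_pair_commute[OF a a' x'(2,3)])
    show "a (w v* x) = a w v* x" "a' (w v* x) = a' w v* x" for w
      by (rule adjoint_pair_commute_x[OF a x'(2,3)] adjoint_pair_commute_x[OF a' x'(2,3)])+
    show "w = 0" if "w \<in> U" "a w = 0" for w using inj that by blast
    show "w = 0" if "w \<in> U" "a w = a' w" for w by (rule a_ne[OF that])
    show "a e = (\<Sum>k\<in>B. M e k *s k)" if "e \<in> B" for e using M that by blast
  qed (rule nsq)
qed

text \<open>The pairing of the two isotropic spaces makes \<open>W = U + U'\<close> nondegenerate.
  The operator \<open>g\<close>, equal to \<open>a\<close> on \<open>U\<close> and to 1 on
  \<open>U'\<close>, has adjoint \<open>h\<close>, equal to 1 on \<open>U\<close> and to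
  \<open>a'\<close> on \<open>U'\<close>, and its determinant is that of \<open>a\<close>. This also
  shows \<open>a \<noteq> 1\<close>, as 1 is a square.\<close>

lemma isotropic_pair_centralizer:
  assumes two: "(2::'a) \<noteq> 0" and x: "isometry x"
    and U: "irreducible_invariant x U" and iso: "U \<subseteq> perp U" "U' \<subseteq> perp U'"
    and inv': "invariant x U'" and pair: "U \<inter> perp U' = {0}" "U' \<inter> perp U = {0}"
  shows "nontrivial_spinor_centralizer x"
proof -
  obtain x' where x': "isometry x'" "x' ** x = mat 1" "x ** x' = mat 1"
    using orthogonal_obtain_inverse[OF x] by metis
  have inv: "invariant x U" using U by (simp add: irreducible_invariant_def)
  have subU: "vec.subspace U" "vec.subspace U'" using inv inv' by (simp_all add: invariant_def)
  obtain a a' B M where a: "adjoint_pair x x' a a'" and B: "basis_of B U"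
    and M: "\<forall>e\<in>B. a e = (\<Sum>k\<in>B. M e k *s k)" and nsq: "\<nexists>c. gram_det M B = c\<^sup>2"
    and inj: "\<forall>u\<in>U. a u = 0 \<longrightarrow> u = 0"
    using adjoint_pair_nonsquare[OF two U x'(2,3)] by blast
  obtain B' where B': "basis_of B' U'" using basis_of_exists[OF subU(2)] by blast
  note b = basis_of_facts[OF B] and b' = basis_of_facts[OF B'] and a' = adjoint_pair_swap[OF a]
  have aU: "a u \<in> U" if "u \<in> U" for u by (rule adjoint_pair_invariant[OF a inv x'(2,3) that])
  have a'U: "a' u \<in> U'" if "u \<in> U'" for u by (rule adjoint_pair_invariant[OF a' inv' x'(2,3) that])
  note adj = adjoint_pair_adjoint[OF a x x'(2,3)]
  have UU': "U \<inter> U' = {0}"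
    using iso(2) pair(1) vec.subspace_0[OF subU(1)] vec.subspace_0[OF subU(2)] by blast
  have zero: "u = 0 \<and> v = 0" if "u \<in> U" "v \<in> U'" "u + v = 0" for u v
  proof -
    have "u = - v" using that(3) by (simp add: eq_neg_iff_add_eq_0)
    then have "u \<in> U'" using vec.subspace_neg[OF subU(2) that(2)] by simp
    then have "u = 0" using that(1) UU' by blast
    then show ?thesis using that(3) by simp
  qed
  obtain P where P: "\<And>u v. u \<in> U \<Longrightarrow> v \<in> U' \<Longrightarrow> P (u + v) = u"
    using projection_exists[OF subU UU'] by blast
  define W where "W = {u + v |u v. u \<in> U \<and> v \<in> U'}"
  have W: "\<exists>u\<in>U. \<exists>v\<in>U'. w = u + v" if "w \<in> W" for w using that by (auto simp: W_def)
  define g where "g w = a (P w) + (w - P w)" for w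
  define h where "h w = P w + a' (w - P w)" for w
  have g: "g (u + v) = a u + v" and h: "h (u + v) = u + a' v" if "u \<in> U" "v \<in> U'" for u v
    using P[OF that] by (simp_all add: g_def h_def)
  have iso_zero: "\<beta> u v = 0" if "u \<in> U \<and> v \<in> U \<or> u \<in> U' \<and> v \<in> U'" for u v
    using that iso by (auto simp: perp_def)
  have a_ne: "u = 0" if "u \<in> U" "a u = u" for u
  proof -
    have "\<not> (\<forall>u\<in>U. a u - u = 0)"
    proof
      assume "\<forall>u\<in>U. a u - u = 0"
      then have "a e = e" if "e \<in> B" for e using b(2) that by auto
      then have "(\<Sum>k\<in>B. M e k *s k) = e" if "e \<in> B" for e using M that by metis
      moreover have "(\<Sum>k\<in>B. (if e = k then 1 else 0) *s k) = e" if "e \<in> B" for e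
        using that b(1) by (simp add: if_distrib[of "\<lambda>c. c *s _"] cong: if_cong)
      ultimately have eq: "(\<Sum>k\<in>B. M e k *s k) = (\<Sum>k\<in>B. (if e = k then 1 else 0) *s k)"
        if "e \<in> B" for e using that by simp
      have "M e k = (if e = k then 1 else 0)" if "e \<in> B" "k \<in> B" for e k
        by (rule basis_coeffs_unique[OF B eq[OF that(1)] that(2)])
      then have "gram_det M B = 1"
        using gram_det_Un_identity[OF b(1), of "{}" M] by simp
      then show False using nsq by (metis one_power2)
    qed
    then show ?thesis
      using adjoint_pair_kernel[OF adjoint_pair_diff[OF a adjoint_pair.one] U x'(2,3)] that by auto
  qed
  have a_surj: "(\<lambda>u. a u - u) ` U = U"
  proof (rule injective_linear_surj_on[OF subU(1)])
    show "a u - u \<in> U" if "u \<in> U" for u using aU[OF that] that vec.subspace_diff[OF subU(1)] by blast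
    show "a (u - v) - (u - v) = a u - u - (a v - v)" for u v
      using adjoint_pair_arg_diff[OF a, of u v] by simp
    show "u = 0" if "u \<in> U" "a u - u = 0" for u using a_ne that by simp
  qed
  \<comment> \<open>\<open>U'\<close> is only known to be invariant, so injectivity of
    \<open>a' - 1\<close> on it is obtained by duality from surjectivity of \<open>a - 1\<close> on
    \<open>U\<close>.\<close>
  have a'_ne: "v = 0" if v: "v \<in> U'" "a' v = v" for v
  proof -
    have "\<beta> v w = 0" if w: "w \<in> U" for w
    proof -
      obtain u where "u \<in> U" "w = a u - u" using w a_surj by blast
      then show ?thesis using adj[of u v] v(2) by (simp add: pol_diff pol_commute[of v])
    qed
    then have "v \<in> U' \<inter> perp U" using v(1) by (simp add: perp_def)
    then show ?thesis using pair(2) by blast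
  qed
  have subW: "vec.subspace W" unfolding W_def by (rule vec.subspace_sums[OF subU])
  have "0 \<notin> B" using b(5) vec.dependent_zero[of B] by blast
  have disj: "B \<inter> B' = {}"
  proof (rule equals0I)
    fix k assume k: "k \<in> B \<inter> B'"
    then have "k \<in> U \<inter> U'" using b(2) b'(2) by auto
    then have "k = 0" unfolding UU' by simp
    with k \<open>0 \<notin> B\<close> show False by simp
  qed
  then have "card (B \<union> B') = card B + card B'" using b(1) b'(1) by (intro card_Un_disjoint)
  have spanW: "vec.span (B \<union> B') = W" unfolding vec.span_Un b(6) b'(6) W_def ..
  have bas: "basis_of (B \<union> B') W"
  proof -
    have "vec.dim W = card (B \<union> B')"
      using vec.dim_sums_Int[OF subU] UU' b(4) b'(4) \<open>card (B \<union> B') = card B + card B'\<close>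
      by (simp add: W_def)
    moreover have "B \<union> B' \<subseteq> W" unfolding spanW[symmetric] by (rule vec.span_superset)
    ultimately have "vec.independent (B \<union> B')"
      using vec.card_eq_dim[of "B \<union> B'" W] spanW b(1) b'(1) by simp
    then show ?thesis using spanW by (simp add: basis_of_def)
  qed
  let ?M = "\<lambda>e k. if e \<in> B then (if k \<in> B then M e k else 0) else if e = k then 1 else 0"
  show ?thesis
  proof (rule commuting_adjoint_centralizer[OF two x bas, of g h ?M])
    show "W \<inter> perp W = {0}"
    proof (rule Int_perp_zeroI[OF subW])
      fix w assume w: "w \<in> W" "\<And>u. u \<in> W \<Longrightarrow> \<beta> w u = 0"
      then obtain u v where uv: "u \<in> U" "v \<in> U'" "w = u + v" using W by blast
      have sub: "U \<subseteq> W" "U' \<subseteq> W"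
        unfolding W_def using vec.subspace_0[OF subU(1)] vec.subspace_0[OF subU(2)] by force+
      have "\<beta> v y = 0" if "y \<in> U" for y
      proof -
        have "\<beta> w y = 0" using w(2) that sub by blast
        then show ?thesis using iso_zero[of u y] uv that by (simp add: pol_add)
      qed
      then have "v \<in> U' \<inter> perp U" using uv by (simp add: perp_def)
      then have v0: "v = 0" using pair by blast
      have "\<beta> u y = 0" if "y \<in> U'" for y
      proof -
        have "\<beta> w y = 0" using w(2) that sub by blast
        then show ?thesis using v0 uv by simp
      qed
      then have "u \<in> U \<inter> perp U'" using uv by (simp add: perp_def)
      then have "u = 0" using pair by blast
      then show "w = 0" using uv v0 by simp
    qed
    show "invariant x W"
      unfolding invariant_def
    proof (intro conjI ballI subW)
      fix w assume "w \<in> W"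
      then obtain u v where "u \<in> U" "v \<in> U'" "w = u + v" using W by blast
      then show "w v* x \<in> W" using inv inv' by (auto simp: W_def vm.add invariant_def)
    qed
  next
    fix w assume "w \<in> W"
    then obtain u v where uv: "u \<in> U" "v \<in> U'" "w = u + v" using W by blast
    have ux: "u v* x \<in> U" "v v* x \<in> U'" using inv inv' uv by (auto simp: invariant_def)
    show "g w \<in> W" "h w \<in> W" using uv aU a'U by (auto simp: W_def g h)
    show "g (c *s w) = c *s g w" "h (c *s w) = c *s h w" for c
      using uv g[of "c *s u" "c *s v"] h[of "c *s u" "c *s v"] vec.subspace_scale[OF subU(1)]
        vec.subspace_scale[OF subU(2)]
      by (simp_all add: g h vector_add_ldistrib adjoint_pair_linear[OF a] adjoint_pair_linear[OF a'])
    show "g (h w) = h (g w)" using uv aU a'U by (simp add: g h)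
    show "g (w v* x) = g w v* x" "h (w v* x) = h w v* x"
      using uv ux by (simp_all add: vm.add g h adjoint_pair_commute_x[OF a x'(2,3)]
          adjoint_pair_commute_x[OF a' x'(2,3)])
    show "w = 0" if "g w = 0"
    proof -
      have "a u = 0 \<and> v = 0" using zero[OF aU[OF uv(1)] uv(2)] that uv by (simp add: g)
      then show ?thesis using inj uv by auto
    qed
    show "w = 0" if "g w = h w"
    proof -
      have "(a u - u) + (v - a' v) = 0" using that uv by (simp add: g h algebra_simps)
      moreover have "a u - u \<in> U" "v - a' v \<in> U'"
        using uv aU a'U vec.subspace_diff[OF subU(1)] vec.subspace_diff[OF subU(2)] by blast+
      ultimately have "a u - u = 0" "v - a' v = 0" using zero by blast+
      then have "u = 0" "v = 0" using a_ne[OF uv(1)] a'_ne[OF uv(2)] by simp_all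
      then show ?thesis using uv by simp
    qed
  next
    fix w y assume "w \<in> W" "y \<in> W"
    then obtain u v u' v' where uv: "u \<in> U" "v \<in> U'" "w = u + v" "u' \<in> U" "v' \<in> U'" "y = u' + v'"
      using W by metis
    have s: "w + y = (u + u') + (v + v')" using uv by simp
    have s2: "u + u' \<in> U" "v + v' \<in> U'"
      using uv vec.subspace_add[OF subU(1)] vec.subspace_add[OF subU(2)] by blast+
    show "g (w + y) = g w + g y" "h (w + y) = h w + h y"
      unfolding s g[OF s2] h[OF s2] using uv
      by (simp_all add: g h adjoint_pair_linear[OF a] adjoint_pair_linear[OF a'])
    show "\<beta> (g w) y = \<beta> w (h y)"
      using uv aU a'U adj[of u v'] by (simp add: g h pol_add iso_zero)
  next
    fix e assume e: "e \<in> B \<union> B'"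
    show "g e = (\<Sum>k\<in>B \<union> B'. ?M e k *s k)"
    proof (cases "e \<in> B")
      case True
      then have "g e = a e" using g[of e 0] b(2) vec.subspace_0[OF subU(2)] by auto
      also have "\<dots> = (\<Sum>k\<in>B. ?M e k *s k)" using M True by simp
      also have "\<dots> = (\<Sum>k\<in>B \<union> B'. ?M e k *s k)"
        using True b(1) b'(1) by (intro sum.mono_neutral_left) auto
      finally show ?thesis .
    next
      case False
      then have "e \<in> U'" using e b'(2) by blast
      have "a 0 = 0" using adjoint_pair_linear(2)[OF a, of 0 0] by simp
      then have "g e = e" using g[of 0 e] \<open>e \<in> U'\<close> vec.subspace_0[OF subU(1)] by simp
      then show ?thesis
        using False e b(1) b'(1) by (simp add: if_distrib[of "\<lambda>c. c *s _"] cong: if_cong)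
    qed
  next
    have "gram_det ?M (B \<union> B') = gram_det ?M B"
      using b(1) b'(1) disj by (intro gram_det_Un_identity) auto
    also have "\<dots> = gram_det M B" by (rule gram_det_cong) simp
    finally show "\<nexists>c. gram_det ?M (B \<union> B') = c\<^sup>2" using nsq by simp
  qed
qed

text \<open>The search is confined to the moved space \<open>?D\<close> of \<open>x\<^sup>2\<close>,
  which by semisimplicity contains no nonzero vector fixed by \<open>x\<^sup>2\<close>. An
  irreducible subspace is either nondegenerate or totally isotropic. If all those in
  \<open>?D\<close> are isotropic, one of them, \<open>U\<close>, is paired with an irreducible
  \<open>U'\<close> inside an invariant complement of \<open>perp U\<close>.\<close>

theorem semisimple_nontrivial_spinor_centralizer:
  assumes two: "(2::'a) \<noteq> 0" and n: "CARD('n) \<ge> 3" and x: "isometry x"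
    and ss: "semisimple x"
  shows "nontrivial_spinor_centralizer x"
proof (cases "\<forall>v. v v* x v* x = v")
  case True
  then show ?thesis using involution_centralizer[OF two n x] by blast
next
  case False
  let ?m = "group.ord GL x"
  have ord: "((\<lambda>v. v v* x) ^^ ?m) v = v" for v
    using invertible_finite_order(2)[OF orthogonalD(1)[OF x]] .
  have ord2: "((\<lambda>v. v v* (x ** x)) ^^ ?m) v = v" for v
  proof -
    have "((\<lambda>v. v v* x v* x) ^^ ?m) v = ((\<lambda>v. v v* x) ^^ ?m) (((\<lambda>v. v v* x) ^^ ?m) v)"
      by (rule funpow_compose_commute) simp
    then show ?thesis using ord by (simp add: vector_matrix_mul_assoc)
  qed
  note m = semisimple_order[OF ss]
  let ?D = "moved_space (x ** x)"
  have FD: "fixed_space (x ** x) \<inter> ?D = {0}" by (rule fixed_Int_moved[OF ord2 m])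
  have invD: "invariant x ?D"
    unfolding invariant_def
  proof (intro conjI ballI subspace_moved_space)
    fix u assume "u \<in> ?D"
    then obtain w where "u = w - w v* (x ** x)" by (auto simp: moved_space_def)
    then have "u v* x = (w v* x) - (w v* x) v* (x ** x)"
      by (simp add: vm.diff vector_matrix_mul_assoc matrix_mul_assoc)
    then show "u v* x \<in> ?D" unfolding moved_space_def by blast
  qed
  have fixD: "u = 0" if "u \<in> ?D" "u v* x v* x = u" for u
    using that FD by (auto simp: fixed_space_def simp flip: vector_matrix_mul_assoc)
  obtain v0 where v0: "v0 v* x v* x \<noteq> v0" using False by blast
  have "?D \<noteq> {0}"
  proof
    assume "?D = {0}"
    moreover have "v0 - v0 v* (x ** x) \<in> ?D" unfolding moved_space_def by blast
    ultimately show False using v0 by (simp flip: vector_matrix_mul_assoc)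
  qed
  show ?thesis
  proof (cases "\<exists>U\<subseteq>?D. irreducible_invariant x U \<and> \<not> U \<subseteq> perp U")
    case True
    then obtain U where U: "U \<subseteq> ?D" "irreducible_invariant x U" "\<not> U \<subseteq> perp U" by blast
    have inv: "invariant x U" using U(2) by (simp add: irreducible_invariant_def)
    then have "invariant x (perp U)" by (rule invariant_perp[OF x])
    then have "invariant x (U \<inter> perp U)" using inv by (rule invariant_Int[rotated])
    then have "U \<inter> perp U = {0}" using U(2,3) unfolding irreducible_invariant_def by blast
    then show ?thesis
      using nondegenerate_irreducible_centralizer[OF two x U(2)] fixD U(1) by blast
  next
    case False
    then have iso: "U \<subseteq> perp U" if "U \<subseteq> ?D" "irreducible_invariant x U" for U using that by blast
    obtain U where U: "U \<subseteq> ?D" "irreducible_invariant x U"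
      using irreducible_invariant_exists[OF invD \<open>?D \<noteq> {0}\<close>] by blast
    have inv: "invariant x U" and U0: "U \<noteq> {0}" using U(2) by (simp_all add: irreducible_invariant_def)
    have subU: "vec.subspace U" using inv by (simp add: invariant_def)
    have invp: "invariant x (perp U)" by (rule invariant_perp[OF x inv])
    obtain C where C: "invariant x C" "perp U \<inter> C = {0}" "\<forall>v. \<exists>t\<in>perp U. \<exists>c\<in>C. v = t + c"
      using invariant_complement_exists[OF invp ord m] by blast
    have "C \<noteq> {0}"
    proof
      assume "C = {0}"
      then have "perp U = UNIV" using C(3) by auto
      then have "U = perp UNIV" using perp_perp[OF subU] by simp
      then show False using U0 by simp
    qed
    then obtain U' where U': "U' \<subseteq> C" "irreducible_invariant x U'"
      using irreducible_invariant_exists[OF C(1)] by blast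
    have inv': "invariant x U'" and U'0: "U' \<noteq> {0}" using U'(2) by (simp_all add: irreducible_invariant_def)
    have subU': "vec.subspace U'" using inv' by (simp add: invariant_def)
    have pair2: "U' \<inter> perp U = {0}" using U'(1) C(2) vec.subspace_0[OF subU'] vec.subspace_0[OF subspace_perp] by blast
    have invp': "invariant x (perp U')" by (rule invariant_perp[OF x inv'])
    have pair1: "U \<inter> perp U' = {0}"
    proof -
      have "U \<inter> perp U' \<noteq> U"
      proof
        assume "U \<inter> perp U' = U"
        then have "\<beta> u v = 0" if "u \<in> U" "v \<in> U'" for u v using that unfolding perp_def by blast
        then have "\<beta> v u = 0" if "u \<in> U" "v \<in> U'" for u v using that pol_commute[of v u] by simp
        then have "U' \<subseteq> perp U" by (auto simp: perp_def)
        then show False using pair2 U'0 by blast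
      qed
      moreover have "invariant x (U \<inter> perp U')" using inv invp' by (rule invariant_Int)
      ultimately show ?thesis using U(2) unfolding irreducible_invariant_def by blast
    qed
    let ?s = "\<lambda>u::'a^'n. u - u v* x v* x"
    have sdiff: "?s (u - v) = ?s u - ?s v" for u v by (simp add: vm.diff)
    have surjU: "?s ` U = U"
    proof (rule injective_linear_surj_on[OF subU])
      show "?s u \<in> U" if "u \<in> U" for u
        using inv that vec.subspace_diff[OF subU] by (simp add: invariant_def)
      show "u = 0" if "u \<in> U" "?s u = 0" for u using fixD[of u] U(1) that by auto
    qed (rule sdiff)
    \<comment> \<open>Duality again: \<open>1 - x\<^sup>2\<close> is onto \<open>U\<close>, and a
      vector fixed by \<open>x\<^sup>2\<close> is orthogonal to its image. Hence
      \<open>1 - x\<^sup>2\<close> is also bijective on \<open>U'\<close>, which puts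
      \<open>U'\<close> into \<open>?D\<close> and makes it isotropic.\<close>
    have fixU': "u = 0" if u: "u \<in> U'" "u v* x v* x = u" for u
    proof -
      have "\<beta> u w = 0" if w: "w \<in> U" for w
      proof -
        have "w \<in> ?s ` U" using w surjU by simp
        then obtain y where "w = ?s y" by blast
        moreover have "\<beta> u (y v* x v* x) = \<beta> u y"
          using orthogonalD(3)[OF x, of "u v* x" "y v* x"] orthogonalD(3)[OF x, of u y] u(2) by simp
        ultimately show ?thesis by (simp add: pol_diff)
      qed
      then have "u \<in> U' \<inter> perp U" using u by (simp add: perp_def)
      then show ?thesis using pair2 by blast
    qed
    have surjU': "?s ` U' = U'"
    proof (rule injective_linear_surj_on[OF subU'])
      show "?s u \<in> U'" if "u \<in> U'" for u
        using inv' that vec.subspace_diff[OF subU'] by (simp add: invariant_def)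
      show "u = 0" if "u \<in> U'" "?s u = 0" for u using fixU'[of u] that by auto
    qed (rule sdiff)
    have "U' \<subseteq> ?D"
    proof
      fix u assume "u \<in> U'"
      then have "u \<in> ?s ` U'" using surjU' by simp
      then obtain y where "u = ?s y" by blast
      then have "u = y - y v* (x ** x)" by (simp add: vector_matrix_mul_assoc)
      then show "u \<in> ?D" unfolding moved_space_def by blast
    qed
    then show ?thesis
      using isotropic_pair_centralizer[OF two x U(2) iso[OF U] iso[OF _ U'(2)] inv' pair1 pair2] by blast
  qed
qed

end

section \<open>Conjugacy classes in the two groups\<close>

theorem theorem4p1p16:
  fixes Q :: "'a::{field,finite}^'n \<Rightarrow> 'a"
    and x :: "'a^'n^'n"
  assumes "CARD('n) \<ge> 3"
    and "nonsingular_quadratic_form Q"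
    and "x \<in> Omega_group Q"
    and "semisimple x"
  shows "(odd CARD('a) \<or> even CARD('a) \<and> \<not> invertible (x + mat 1) \<longrightarrow>
            conj_class (Omega_group Q) x = conj_class (special_orthogonal_group Q) x) \<and>
         (even CARD('a) \<and> invertible (x + mat 1) \<longrightarrow>
            special_orthogonal_group Q - Omega_group Q \<noteq> {} \<and>
            (\<forall>z \<in> special_orthogonal_group Q - Omega_group Q.
               conj_by x z \<in> Omega_group Q \<and>
               conj_class (special_orthogonal_group Q) x =
                 conj_class (Omega_group Q) x \<union> conj_class (Omega_group Q) (conj_by x z) \<and>
               conj_class (Omega_group Q) x \<noteq> conj_class (Omega_group Q) (conj_by x z)))"
proof -
  interpret nonsing_form Q by unfold_locales (rule assms(2))
  let ?SO = "special_orthogonal_group Q" and ?\<Omega> = "Omega_group Q"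
  note n = assms(1) and ss = assms(4)
  have xO: "isometry x"
    using assms(3) by (simp add: Omega_group_def special_orthogonal_group_def)
  have \<Omega>SO: "?\<Omega> \<subseteq> ?SO" by (auto simp: Omega_group_def)
  have SO_O: "?SO \<subseteq> orthogonal_group Q" by (auto simp: special_orthogonal_group_def)
  have SO_mult: "g ** h \<in> ?SO" if "g \<in> ?SO" "h \<in> ?SO" for g h
    using that by (simp add: special_orthogonal_group_def orthogonal_mult det_mul)
  have SO_inv: "\<exists>h\<in>?SO. h ** g = mat 1 \<and> g ** h = mat 1" if g: "g \<in> ?SO" for g
  proof -
    obtain h where h: "isometry h" "h ** g = mat 1" "g ** h = mat 1"
      using orthogonal_obtain_inverse g SO_O by blast
    have "det h * det g = 1" using h(2) by (metis det_I det_mul)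
    then show ?thesis using h g by (auto simp: special_orthogonal_group_def)
  qed
  have SO_invertible: "invertible g" if "g \<in> ?SO" for g using that SO_O orthogonalD(1) by blast
  have conj_mult: "conj_by x (c ** z) = conj_by x z" if "c \<in> ?SO" "z \<in> ?SO" "c ** x = x ** c" for c z
  proof -
    obtain c' where c': "c' ** c = mat 1" "c ** c' = mat 1" using SO_inv[OF \<open>c \<in> ?SO\<close>] by blast
    have "conj_by x c = c' ** (c ** x)" by (simp add: conj_by_eq[OF c'] that(3) matrix_mul_assoc)
    then have "conj_by x c = x" by (simp add: matrix_mul_assoc c')
    then show ?thesis using conj_by_mult[OF that(1,2)[THEN SO_invertible]] by simp
  qed
  have sub: "conj_class ?\<Omega> x \<subseteq> conj_class ?SO x" using \<Omega>SO by (auto simp: conj_class_def)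
  \<comment> \<open>A conjugator \<open>z\<close> outside \<open>\<Omega>\<close> is replaced by
    \<open>c ** z\<close>, which lies in \<open>\<Omega>\<close> and gives the same conjugate
    because \<open>c\<close> centralizes \<open>x\<close>.\<close>
  have coincide: "conj_class ?\<Omega> x = conj_class ?SO x"
    if c: "c \<in> ?SO" "c ** x = x ** c" "\<And>z. z \<in> ?SO - ?\<Omega> \<Longrightarrow> c ** z \<in> ?\<Omega>" for c
  proof
    show "conj_class ?SO x \<subseteq> conj_class ?\<Omega> x"
    proof
      fix y assume "y \<in> conj_class ?SO x"
      then obtain z where z: "z \<in> ?SO" "y = conj_by x z" by (auto simp: conj_class_def)
      show "y \<in> conj_class ?\<Omega> x"
      proof (cases "z \<in> ?\<Omega>")
        case True
        then show ?thesis using z by (auto simp: conj_class_def)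
      next
        case False
        then have "c ** z \<in> ?\<Omega>" using c(3) z(1) by blast
        moreover have "y = conj_by x (c ** z)" using conj_mult[OF c(1) z(1) c(2)] z(2) by simp
        ultimately show ?thesis by (auto simp: conj_class_def)
      qed
    qed
  qed (rule sub)
  show ?thesis
  proof (cases "odd CARD('a)")
    case True
    then have two: "(2::'a) \<noteq> 0" using even_card_iff_two_eq_zero by blast
    have \<Omega>: "g \<in> ?\<Omega> \<longleftrightarrow> g \<in> ?SO \<and> trivial_spinor g" for g
      using True by (simp add: Omega_group_def spinor_norm_def)
    obtain c where c: "c \<in> ?SO" "c ** x = x ** c"
        "\<not> trivial_spinor c"
      using semisimple_nontrivial_spinor_centralizer[OF two n xO ss] by blast
    have "conj_class ?\<Omega> x = conj_class ?SO x"
    proof (rule coincide[OF c(1,2)])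
      fix z assume z: "z \<in> ?SO - ?\<Omega>"
      then have "\<not> trivial_spinor z"
        using \<Omega>[of z] by blast
      moreover have "isometry c" "isometry z" using c(1) z SO_O by blast+
      ultimately have "trivial_spinor (c ** z)"
        using trivial_spinor_mult[OF two _ c(3)] by blast
      then show "c ** z \<in> ?\<Omega>" using \<Omega>[of "c ** z"] SO_mult[OF c(1), of z] z by blast
    qed
    then show ?thesis using True by simp
  next
    case False
    then have two: "(2::'a) = 0" using even_card_iff_two_eq_zero by blast
    have minus: "- a = a" for a :: 'a
    proof -
      have "a + a = 0" using two by (simp flip: mult_2)
      then show ?thesis by (simp add: eq_neg_iff_add_eq_0[symmetric])
    qed
    have vminus: "- v = v" for v :: "'a^'n" using minus by (simp add: vec_eq_iff)
    have "(of_nat k :: bit) = 0 \<longleftrightarrow> even k" for k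
      by (induction k) (auto simp: bit_not_zero_iff)
    then have \<Omega>: "g \<in> ?\<Omega> \<longleftrightarrow> g \<in> ?SO \<and> even (vec.dim (moved_space g))" for g
      using False by (simp add: Omega_group_def spinor_norm_def)
    \<comment> \<open>The inverse of an isometry is its adjoint and so has the same determinant; the
      square of the determinant is 1, and \<open>- 1 = 1\<close> here.\<close>
    have O_SO: "g \<in> ?SO" if "isometry g" for g
    proof -
      have "det g = 1"
      proof -
        obtain h where h: "h ** g = mat 1" "g ** h = mat 1" using orthogonal_obtain_inverse[OF \<open>g \<in> _\<close>] by metis
        have "det g = det h"
        proof (rule det_adjoint)
          fix u v
          show "\<beta> (u v* g) v = \<beta> u (v v* h)"
            using orthogonalD(3)[OF that, of u "v v* h"] by (simp add: vector_matrix_mul_assoc h)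
        qed
        then have "det g * det g = 1" using h(1) by (metis det_I det_mul)
        then have "det g = 1 \<or> det g = - 1" by (simp add: square_eq_1_iff)
        then show ?thesis using minus by metis
      qed
      then show ?thesis using that by (simp add: special_orthogonal_group_def)
    qed
    have hom: "c ** z \<in> ?\<Omega>" if "c \<in> ?SO" "odd (vec.dim (moved_space c))" "z \<in> ?SO - ?\<Omega>" for c z
      using dim_moved_mult[of z c] that SO_O SO_mult by (auto simp: \<Omega>)
    have fx: "fixed_space x = {v. v v* (x + mat 1) = 0}"
    proof -
      have "v v* x = v \<longleftrightarrow> v v* (x + mat 1) = 0" for v
        using eq_neg_iff_add_eq_0[of "v v* x" v] unfolding vminus
        by (simp add: vector_matrix_mult_add_rdistrib)
      then show ?thesis by (simp add: fixed_space_def)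
    qed
    have inv_iff: "invertible (x + mat 1) \<longleftrightarrow> fixed_space x = {0}"
      unfolding invertible_iff_kernel fx by auto
    show ?thesis
    proof (cases "invertible (x + mat 1)")
      case False
      \<comment> \<open>The moved space is the orthogonal complement of the fixed space, so this
        trivial intersection makes the fixed space nondegenerate and provides a nonsingular fixed
        vector.\<close>
      have FV: "fixed_space x \<inter> moved_space x = {0}"
        by (rule fixed_Int_moved[OF invertible_finite_order(2)[OF orthogonalD(1)[OF xO]] semisimple_order[OF ss]])
      obtain v0 where v0: "v0 \<in> fixed_space x" "v0 \<noteq> 0"
        using False inv_iff vec.subspace_0[OF subspace_fixed_space] by blast
      obtain u where u: "u \<in> fixed_space x" "Q u \<noteq> 0"
        using nonsingular_vector_exists[OF _ v0 subspace_fixed_space] FV perp_fixed_space[OF xO] by auto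
      have "conj_class ?\<Omega> x = conj_class ?SO x"
      proof (rule coincide)
        show "reflection u \<in> ?SO" by (rule O_SO[OF reflection_orthogonal[OF u(2)]])
        show "reflection u ** x = x ** reflection u"
          using commutes_reflection[OF xO] u(1) by (simp add: fixed_space_def)
        show "reflection u ** z \<in> ?\<Omega>" if "z \<in> ?SO - ?\<Omega>" for z
          using hom[OF O_SO[OF reflection_orthogonal[OF u(2)]] _ that] dim_moved_reflection[OF u(2)] by simp
      qed
      then show ?thesis using False by simp
    next
      case True
      then have f0: "fixed_space x = {0}" using inv_iff by blast
      have even_comm: "g \<in> ?\<Omega>" if "g \<in> ?SO" "g ** x = x ** g" for g
        using even_moved_commuting[OF two xO f0 _ that(2)] that(1) SO_O unfolding \<Omega> by blast
      have mult_iff: "g ** h \<in> ?\<Omega> \<longleftrightarrow> (g \<in> ?\<Omega> \<longleftrightarrow> h \<in> ?\<Omega>)" if "g \<in> ?SO" "h \<in> ?SO" for g h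
        using dim_moved_mult[of h g] that SO_O SO_mult[OF that] unfolding \<Omega> by auto
      have inv_\<Omega>: "h \<in> ?\<Omega> \<longleftrightarrow> g \<in> ?\<Omega>" if "g \<in> ?SO" "h \<in> ?SO" "h ** g = mat 1" for g h
        using even_moved_inverse[of g h] that SO_O unfolding \<Omega> by blast
      have nonempty: "?SO - ?\<Omega> \<noteq> {}"
      proof -
        have "axis undefined 1 \<noteq> (0 :: 'a^'n)" by simp
        then obtain u where u: "Q u \<noteq> 0"
          using nonsingular_vector_exists[of UNIV "axis undefined 1"] vec.subspace_UNIV by auto
        have "reflection u \<in> ?SO - ?\<Omega>"
          using O_SO[OF reflection_orthogonal[OF u]] dim_moved_reflection[OF u] by (simp add: \<Omega>)
        then show ?thesis by blast
      qed
      have "conj_by x z \<in> ?\<Omega> \<and>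
          conj_class ?SO x = conj_class ?\<Omega> x \<union> conj_class ?\<Omega> (conj_by x z) \<and>
          conj_class ?\<Omega> x \<noteq> conj_class ?\<Omega> (conj_by x z)" if z: "z \<in> ?SO - ?\<Omega>" for z
      proof -
        obtain z' where z': "z' \<in> ?SO" "z' ** z = mat 1" "z ** z' = mat 1" using SO_inv z by blast
        have xz: "conj_by x z = z' ** x ** z" by (rule conj_by_eq[OF z'(2,3)])
        have xSO: "x \<in> ?SO" using assms(3) \<Omega>SO by blast
        have 1: "conj_by x z \<in> ?\<Omega>"
          unfolding xz using mult_iff[OF SO_mult[OF z'(1) xSO], of z] mult_iff[OF z'(1) xSO]
            inv_\<Omega>[of z z'] z z' assms(3) by blast
        have conj2: "conj_by (conj_by x z) w = conj_by x (z ** w)" if w: "w \<in> ?SO" for w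
          using conj_by_mult[of z w x] SO_invertible z w by auto
        have 2: "conj_class ?SO x \<subseteq> conj_class ?\<Omega> x \<union> conj_class ?\<Omega> (conj_by x z)"
        proof
          fix y assume "y \<in> conj_class ?SO x"
          then obtain w where w: "w \<in> ?SO" "y = conj_by x w" by (auto simp: conj_class_def)
          show "y \<in> conj_class ?\<Omega> x \<union> conj_class ?\<Omega> (conj_by x z)"
          proof (cases "w \<in> ?\<Omega>")
            case True
            then show ?thesis using w by (auto simp: conj_class_def)
          next
            case False
            have "z' ** w \<in> ?\<Omega>" using mult_iff[OF z'(1) w(1)] inv_\<Omega>[of z z'] z z' False by blast
            moreover have "z ** (z' ** w) = w" by (simp add: matrix_mul_assoc z')
            then have "y = conj_by (conj_by x z) (z' ** w)"
              using conj2[OF SO_mult[OF z'(1) w(1)]] w(2) by simp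
            ultimately show ?thesis by (auto simp: conj_class_def)
          qed
        qed
        have 3: "conj_class ?\<Omega> (conj_by x z) \<subseteq> conj_class ?SO x"
        proof
          fix y assume "y \<in> conj_class ?\<Omega> (conj_by x z)"
          then obtain w where w: "w \<in> ?\<Omega>" "y = conj_by (conj_by x z) w" by (auto simp: conj_class_def)
          then have "y = conj_by x (z ** w)" "z ** w \<in> ?SO" using conj2 \<Omega>SO SO_mult z by auto
          then show "y \<in> conj_class ?SO x" by (auto simp: conj_class_def)
        qed
        \<comment> \<open>Equal classes would give \<open>w\<close> in \<open>\<Omega>\<close> with
          the same conjugate as \<open>z\<close>. Then \<open>z ** w'\<close> centralizes
          \<open>x\<close> and lies in \<open>\<Omega>\<close> by \<open>even_comm\<close>, which
          forces \<open>z\<close> into \<open>\<Omega>\<close>.\<close>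
        have 4: "conj_class ?\<Omega> x \<noteq> conj_class ?\<Omega> (conj_by x z)"
        proof
          assume eq: "conj_class ?\<Omega> x = conj_class ?\<Omega> (conj_by x z)"
          have one: "mat 1 \<in> ?\<Omega>"
            unfolding \<Omega> by (simp add: special_orthogonal_group_def orthogonal_one)
          have "conj_by (conj_by x z) (mat 1) = conj_by x z"
            using conj2[of "mat 1"] one \<Omega>SO by auto
          then have "conj_by x z \<in> conj_class ?\<Omega> (conj_by x z)"
            using one by (auto simp: conj_class_def intro!: exI[of _ "mat 1"])
          then obtain w where w: "w \<in> ?\<Omega>" "conj_by x z = conj_by x w"
            unfolding eq[symmetric] by (auto simp: conj_class_def)
          have wSO: "w \<in> ?SO" using w(1) \<Omega>SO by blast
          obtain w' where w': "w' \<in> ?SO" "w' ** w = mat 1" "w ** w' = mat 1" using SO_inv wSO by blast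
          have "(z ** w') ** x = x ** (z ** w')" using w(2) conj_by_eq_iff[OF z'(2,3) w'(2,3)] by blast
          then have "z ** w' \<in> ?\<Omega>" using even_comm SO_mult z w' by blast
          then show False using mult_iff[of z w'] inv_\<Omega>[OF wSO w'(1,2)] z w' w(1) by blast
        qed
        show ?thesis using 1 2 3 4 sub by blast
      qed
      then show ?thesis using nonempty True False by simp
    qed
  qed
qed

end
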